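(* There exists a constant $C>0$ and, for every $\epsilon>0$, a constant $C_\epsilon>0$ (none of them depending on $z$, $n$, $\mu$ or $\pi$) such that the following holds for all $z>0$ and all integers $n\ge2$. Let $\mu\in\mathcal J_{0,n}$ and let $\pi$ be a self-financing portfolio strategy in the $n$-step binomial market with initial stock price $z$ such that $(\mu\circ\lambda^{(n)}_\xi,\pi)$ is a hedge. Put $\varphi=\mu\circ\lambda^{(n)}_B$ and $$\sigma=(T\wedge\theta^{(n)}_\varphi)\,\mathbb I_{\varphi<n}+T\,\mathbb I_{\varphi=n},$$ and let $Z^B_t$, $t\in[0,T]$, be the value of the self-financing portfolio strategy $\pi^B$ in the Black–Scholes market constructed from $\pi$. Then $$\sup_{\tau\in\mathcal T^B_{0T}}E^B\big(R^B_z(\sigma,\tau)-Z^B_{\sigma\wedge\tau}\big)^+\le C\,(F_0(z)+\Delta_0(z)+z+1)\,n^{-1/4}(\ln n)^{3/4},$$ and for every $\epsilon>0$, $$E^B\sup_{0\le t\le T}\big(R^B_z(\sigma,t)-Z^B_{\sigma\wedge t}\big)^+\le C_\epsilon\,(F_0(z)+\Delta_0(z)+z+1)\,n^{-\frac14+\epsilon}.$$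
   Context: Fix $T>0$ (horizon), $r>0$ (interest rate), $\kappa>0$ (volatility). Write $a^+=\max(a,0)$. Payoff functionals. For $t\ge 0$ let $M[0,t]$ be the space of Borel measurable real functions on $[0,t]$ with the uniform distance $d_{0t}(\upsilon,\tilde\upsilon)=\sup_{0\le s\le t}|\upsilon_s-\tilde\upsilon_s|$. For each $t\ge0$ let $F_t$ and $\Delta_t$ be nonnegative functions on $M[0,t]$ (a function defined on a longer interval is evaluated through its restriction to $[0,t]$) such that for some constant $L\ge1$ and all $t\ge s\ge0$, $\upsilon,\tilde\upsilon\in M[0,t]$, $$|F_s(\upsilon)-F_s(\tilde\upsilon)|+|\Delta_s(\upsilon)-\Delta_s(\tilde\upsilon)|\le L(s+1)\,d_{0s}(\upsilon,\tilde\upsilon),$$ $$|F_t(\upsilon)-F_s(\upsilon)|+|\Delta_t(\upsilon)-\Delta_s(\upsilon)|\le L\Big(|t-s|\big(1+\sup_{u\in[0,t]}|\upsilon_u|\big)+\sup_{u\in[s,t]}|\upsilon_u-\upsilon_s|\Big).$$ $F_0(\upsilon)$ and $\Delta_0(\upsilon)$ depend only on $\upsilon_0$ and are written $F_0(z),\Delta_0(z)$ when $\upsilon_0=z$. Put $G_t=F_t+\Delta_t$. Black–Scholes market. Let $(B_t)_{t\ge0}$ be a standard Brownian motion on a complete probability space with probability $P^B$ (the martingale measure) and expectation $E^B$, and let $(\mathcal F^B_t)_{t\ge0}$ be its completed (hence right-continuous) natural filtration. Set $B^*_t=B_t-\frac{\kappa}{2}t$ and, for $z>0$, let the stock price be $S^B_t(z)=z\exp(rt+\kappa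 B^*_t)$; the bond price is proportional to $e^{rt}$. For $s,t\ge0$ the payoff is $$R^B_z(s,t)=G_s(S^B(z))\mathbb I_{s<t}+F_t(S^B(z))\mathbb I_{t\le s}.$$ $\mathcal T^B_{0T}$ is the set of stopping times with respect to $(\mathcal F^B_t)$ with values in $[0,T]$. Embedding times. Put $\theta^{(n)}_0=0$ and $\theta^{(n)}_{k}=\inf\{t>\theta^{(n)}_{k-1}:\ |B^*_t-B^*_{\theta^{(n)}_{k-1}}|=\sqrt{T/n}\}$, $k\ge1$. Let $\lambda^{(n)}_B$ be the $\{-1,1\}^n$-valued random vector with $k$-th coordinate $\sqrt{n/T}\,\big(B^*_{\theta^{(n)}_k}-B^*_{\theta^{(n)}_{k-1}}\big)$, $k=1,\dots,n$. Binomial market. Let $\xi_1,\xi_2,\dots$ be i.i.d. random variables taking the value $1$ with probability $p^{(n)}=(1+e^{\kappa\sqrt{T/n}})^{-1}$ and $-1$ with probability $1-p^{(n)}$, and let $\lambda^{(n)}_\xi=(\xi_1,\dots,\xi_n)$. The stock price is the piecewise constant process $$S^{(n)}_t(z)=z\exp\Big(\sum_{k=1}^{[nt/T]}\big(\tfrac{rT}{n}+\kappa\sqrt{\tfrac Tn}\,\xi_k\big)\Big),\quad 0\le t\le T,$$ where $[\cdot]$ is the integer part, trading takes place at times $kT/n$, $k=0,\dots,n$, and the bond price is proportional to $e^{rkT/n}$ at time $kT/n$. The game option payoff in this market is $$R^{(n)}_z(s,t)=G_s(S^{(n)}(z))\mathbb I_{s<t}+F_t(S^{(n)}(z))\mathbb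 I_{t\le s}.$$ $\mathcal J_{0,n}$ is the set of functions $\mu:\{-1,1\}^n\to\{0,1,\dots,n\}$ such that if $\mu(x)=k$ and $x'_j=x_j$ for all $j\le k$, then $\mu(x')=k$ (so $\mu\circ\lambda^{(n)}_\xi$ is a stopping time for the filtration generated by $\xi_1,\dots,\xi_n$). A self-financing portfolio strategy $\pi$ is given by an initial capital $Z_0\in\mathbb R$ and stock holdings $\gamma_k=\gamma_k(\xi_1,\dots,\xi_{k-1})$ on the $k$-th period, $k=1,\dots,n$; its value $Z_k$ at time $kT/n$ satisfies $$e^{-rkT/n}Z_k=Z_0+\sum_{j=1}^k\gamma_j\big(e^{-rjT/n}S^{(n)}_{jT/n}(z)-e^{-r(j-1)T/n}S^{(n)}_{(j-1)T/n}(z)\big).$$ With $m=\mu\circ\lambda^{(n)}_\xi$, the pair $(m,\pi)$ is called a hedge if $Z_{m\wedge k}\ge R^{(n)}_z(mT/n,kT/n)$ almost surely for all $k=0,1,\dots,n$. The strategy $\pi^B$. Given $\pi$, the strategy $\pi^B$ in the Black–Scholes market starts with the same initial capital $Z_0$, holds the number $\gamma_k$ of stocks, evaluated with $\xi_j$ replaced by the $j$-th coordinate of $\lambda^{(n)}_B$, during $(\theta^{(n)}_{k-1},\theta^{(n)}_k]$, $k=1,\dots,n$, and, if $\theta^{(n)}_n<T$, sells all stocks at time $\theta^{(n)}_n$, invests everything in bonds and does nothing afterwards. Thus its value $Z^B_t$, $0\le t\le T$, satisfies $$e^{-rt}Z^B_t=Z_0+\sum_{k=1}^n\gamma_k\big(\lambda^{(n)}_B\big)\Big(\check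 S^B_{t\wedge\theta^{(n)}_k}-\check S^B_{t\wedge\theta^{(n)}_{k-1}}\Big),\qquad \check S^B_t=e^{-rt}S^B_t(z),$$ where $\gamma_k(\lambda^{(n)}_B)$ depends only on the first $k-1$ coordinates; in particular the discounted value $e^{-rt}Z^B_t$ is constant on $[T\wedge\theta^{(n)}_n,T]$. *)

theory Defs
  imports "HOL-Probability.Probability"
begin

section \<open>Payoff functionals\<close>

text \<open>Elements of $M[0,t]$ are represented by functions on the whole line, of which only the
  restriction to $[0,t]$ matters.\<close>

definition path_space :: "real \<Rightarrow> (real \<Rightarrow> real) set" where
  "path_space t = borel_measurable (restrict_space borel {0..t})"

text \<open>Paths may be unbounded, so suprema are taken in the extended nonnegative reals.\<close>

definition sup_dist :: "real \<Rightarrow> (real \<Rightarrow> real) \<Rightarrow> (real \<Rightarrow> real) \<Rightarrow> ennreal" where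
  "sup_dist t v w = (SUP s\<in>{0..t}. ennreal \<bar>v s - w s\<bar>)"

text \<open>The third conjunct says that \<open>F t\<close> and \<open>\<Delta> t\<close> are functions on $M[0,t]$, that is, they
  see a path only through its restriction to $[0,t]$. In the last conjunct the product
  \<open>0 * \<infinity> = 0\<close> occurs only for \<open>s = t\<close>, when the left-hand side vanishes.\<close>

definition payoff_functionals ::
  "(real \<Rightarrow> (real \<Rightarrow> real) \<Rightarrow> real) \<Rightarrow> (real \<Rightarrow> (real \<Rightarrow> real) \<Rightarrow> real) \<Rightarrow> real \<Rightarrow> bool" where
  "payoff_functionals F \<Delta> L \<longleftrightarrow>
     L \<ge> 1 \<and>
     (\<forall>t\<ge>0. \<forall>v\<in>path_space t. F t v \<ge> 0 \<and> \<Delta> t v \<ge> 0) \<and>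
     (\<forall>t\<ge>0. \<forall>v\<in>path_space t. \<forall>w\<in>path_space t.
        (\<forall>u\<in>{0..t}. v u = w u) \<longrightarrow> F t v = F t w \<and> \<Delta> t v = \<Delta> t w) \<and>
     (\<forall>s\<ge>0. \<forall>t\<ge>s. \<forall>v\<in>path_space t. \<forall>w\<in>path_space t.
        ennreal (\<bar>F s v - F s w\<bar> + \<bar>\<Delta> s v - \<Delta> s w\<bar>) \<le> ennreal (L * (s + 1)) * sup_dist s v w) \<and>
     (\<forall>s\<ge>0. \<forall>t\<ge>s. \<forall>v\<in>path_space t.
        ennreal (\<bar>F t v - F s v\<bar> + \<bar>\<Delta> t v - \<Delta> s v\<bar>)
          \<le> ennreal L * (ennreal \<bar>t - s\<bar> * (1 + (SUP u\<in>{0..t}. ennreal \<bar>v u\<bar>))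
                          + (SUP u\<in>{s..t}. ennreal \<bar>v u - v s\<bar>)))"

text \<open>The game option payoff along a price path \<open>v\<close>, cancelled by the seller at time \<open>s\<close> and
  exercised by the buyer at time \<open>t\<close>.\<close>

definition game_payoff ::
  "(real \<Rightarrow> (real \<Rightarrow> real) \<Rightarrow> real) \<Rightarrow> (real \<Rightarrow> (real \<Rightarrow> real) \<Rightarrow> real) \<Rightarrow> (real \<Rightarrow> real) \<Rightarrow>
     real \<Rightarrow> real \<Rightarrow> real" where
  "game_payoff F \<Delta> v s t = (F s v + \<Delta> s v) * of_bool (s < t) + F t v * of_bool (t \<le> s)"


section \<open>The Black--Scholes market\<close>

definition standard_brownian_motion :: "'a measure \<Rightarrow> (real \<Rightarrow> 'a \<Rightarrow> real) \<Rightarrow> bool" where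
  "standard_brownian_motion M B \<longleftrightarrow>
     prob_space M \<and>
     (\<forall>t\<ge>0. B t \<in> borel_measurable M) \<and>
     (AE \<omega> in M. B 0 \<omega> = 0) \<and>
     (\<forall>s\<ge>0. \<forall>t>s. distributed M lborel (\<lambda>\<omega>. B t \<omega> - B s \<omega>)
        (\<lambda>x. ennreal (normal_density 0 (sqrt (t - s)) x))) \<and>
     (\<forall>(m::nat) t. 0 \<le> t 0 \<and> (\<forall>i<m. t i \<le> t (Suc i)) \<longrightarrow>
        prob_space.indep_vars M (\<lambda>_. borel) (\<lambda>i \<omega>. B (t (Suc i)) \<omega> - B (t i) \<omega>) {..<m}) \<and>
     (AE \<omega> in M. continuous_on {0..} (\<lambda>t. B t \<omega>))"

text \<open>For a complete measure \<open>M\<close> the \<open>M\<close>-null sets include all subsets of sets of measure zero,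
  so adjoining \<open>null_sets M\<close> completes the natural filtration.\<close>

definition completed_filtration :: "'a measure \<Rightarrow> (real \<Rightarrow> 'a \<Rightarrow> real) \<Rightarrow> real \<Rightarrow> 'a measure" where
  "completed_filtration M B t =
     sigma (space M)
       ((\<Union>s\<in>{0..t}. {B s -` A \<inter> space M |A. A \<in> sets borel}) \<union> null_sets M)"

definition bounded_stopping_times ::
  "'a measure \<Rightarrow> (real \<Rightarrow> 'a \<Rightarrow> real) \<Rightarrow> real \<Rightarrow> ('a \<Rightarrow> real) set" where
  "bounded_stopping_times M B T =
     {\<tau>. stopping_time (completed_filtration M B) \<tau> \<and> (\<forall>\<omega>\<in>space M. \<tau> \<omega> \<in> {0..T})}"

definition bstar :: "real \<Rightarrow> (real \<Rightarrow> 'a \<Rightarrow> real) \<Rightarrow> 'a \<Rightarrow> real \<Rightarrow> real" where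
  "bstar \<kappa> B \<omega> t = B t \<omega> - \<kappa> / 2 * t"

definition bs_stock ::
  "real \<Rightarrow> real \<Rightarrow> (real \<Rightarrow> 'a \<Rightarrow> real) \<Rightarrow> real \<Rightarrow> 'a \<Rightarrow> real \<Rightarrow> real" where
  "bs_stock r \<kappa> B z \<omega> t = z * exp (r * t + \<kappa> * bstar \<kappa> B \<omega> t)"


section \<open>Embedding times\<close>

text \<open>Successive times at which the path \<open>b\<close> has moved by \<open>h\<close>. The value is \<open>\<infinity>\<close> if the path
  never does so again; the argument \<open>real_of_ereal \<infinity> = 0\<close> is then never used, as no real
  exceeds \<open>\<infinity>\<close>.\<close>

fun hitting_times :: "real \<Rightarrow> (real \<Rightarrow> real) \<Rightarrow> nat \<Rightarrow> ereal" where
  "hitting_times h b 0 = 0"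
| "hitting_times h b (Suc k) =
     (INF t\<in>{t. hitting_times h b k < ereal t \<and>
                \<bar>b t - b (real_of_ereal (hitting_times h b k))\<bar> = h}. ereal t)"

definition embed_time ::
  "real \<Rightarrow> real \<Rightarrow> (real \<Rightarrow> 'a \<Rightarrow> real) \<Rightarrow> nat \<Rightarrow> nat \<Rightarrow> 'a \<Rightarrow> ereal" where
  "embed_time T \<kappa> B n k \<omega> = hitting_times (sqrt (T / n)) (bstar \<kappa> B \<omega>) k"

definition capped :: "real \<Rightarrow> ereal \<Rightarrow> real" where
  "capped t x = real_of_ereal (min (ereal t) x)"

definition embed_signs ::
  "real \<Rightarrow> real \<Rightarrow> (real \<Rightarrow> 'a \<Rightarrow> real) \<Rightarrow> nat \<Rightarrow> 'a \<Rightarrow> nat \<Rightarrow> real" where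
  "embed_signs T \<kappa> B n \<omega> =
     (\<lambda>k\<in>{1..n}. sqrt (n / T) *
        (bstar \<kappa> B \<omega> (real_of_ereal (embed_time T \<kappa> B n k \<omega>))
         - bstar \<kappa> B \<omega> (real_of_ereal (embed_time T \<kappa> B n (k - 1) \<omega>))))"


section \<open>The binomial market\<close>

definition sign_vectors :: "nat \<Rightarrow> (nat \<Rightarrow> real) set" where
  "sign_vectors n = {1..n} \<rightarrow>\<^sub>E {-1, 1}"

definition up_prob :: "real \<Rightarrow> real \<Rightarrow> nat \<Rightarrow> real" where
  "up_prob T \<kappa> n = 1 / (1 + exp (\<kappa> * sqrt (T / n)))"

definition iid_signs :: "'b measure \<Rightarrow> (nat \<Rightarrow> 'b \<Rightarrow> real) \<Rightarrow> real \<Rightarrow> bool" where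
  "iid_signs N \<xi> p \<longleftrightarrow>
     prob_space N \<and>
     prob_space.indep_vars N (\<lambda>_. borel) \<xi> {1..} \<and>
     (\<forall>k\<ge>1. measure N {\<omega> \<in> space N. \<xi> k \<omega> = 1} = p \<and>
            measure N {\<omega> \<in> space N. \<xi> k \<omega> = -1} = 1 - p)"

definition sample_signs :: "(nat \<Rightarrow> 'b \<Rightarrow> real) \<Rightarrow> nat \<Rightarrow> 'b \<Rightarrow> nat \<Rightarrow> real" where
  "sample_signs \<xi> n \<omega> = (\<lambda>k\<in>{1..n}. \<xi> k \<omega>)"

text \<open>Quantities of the binomial market are functions of the sign vector \<open>x\<close>.\<close>

definition binomial_stock ::
  "real \<Rightarrow> real \<Rightarrow> real \<Rightarrow> nat \<Rightarrow> real \<Rightarrow> (nat \<Rightarrow> real) \<Rightarrow> real \<Rightarrow> real" where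
  "binomial_stock T r \<kappa> n z x t =
     z * exp (\<Sum>k=1..nat \<lfloor>n * t / T\<rfloor>. r * T / n + \<kappa> * sqrt (T / n) * x k)"

definition discrete_stopping :: "nat \<Rightarrow> ((nat \<Rightarrow> real) \<Rightarrow> nat) set" where
  "discrete_stopping n =
     {\<mu>. (\<forall>x\<in>sign_vectors n. \<mu> x \<in> {0..n}) \<and>
         (\<forall>x\<in>sign_vectors n. \<forall>x'\<in>sign_vectors n.
            (\<forall>j\<in>{1..\<mu> x}. x' j = x j) \<longrightarrow> \<mu> x' = \<mu> x)}"

text \<open>Stock holdings: \<open>\<gamma> k\<close> depends on the coordinates \<open>1, \<dots>, k - 1\<close> only. A self-financing
  strategy is a pair of an initial capital \<open>Z0\<close> and such holdings.\<close>

definition predictable_holdings :: "nat \<Rightarrow> (nat \<Rightarrow> (nat \<Rightarrow> real) \<Rightarrow> real) \<Rightarrow> bool" where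
  "predictable_holdings n \<gamma> \<longleftrightarrow>
     (\<forall>k\<in>{1..n}. \<forall>x\<in>sign_vectors n. \<forall>x'\<in>sign_vectors n.
        (\<forall>j\<in>{1..<k}. x j = x' j) \<longrightarrow> \<gamma> k x = \<gamma> k x')"

definition binomial_value ::
  "real \<Rightarrow> real \<Rightarrow> real \<Rightarrow> nat \<Rightarrow> real \<Rightarrow> real \<Rightarrow> (nat \<Rightarrow> (nat \<Rightarrow> real) \<Rightarrow> real) \<Rightarrow>
     (nat \<Rightarrow> real) \<Rightarrow> nat \<Rightarrow> real" where
  "binomial_value T r \<kappa> n z Z0 \<gamma> x k =
     exp (r * k * T / n) *
       (Z0 + (\<Sum>j=1..k. \<gamma> j x *
          (exp (- r * j * T / n) * binomial_stock T r \<kappa> n z x (j * T / n)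
           - exp (- r * (real j - 1) * T / n) * binomial_stock T r \<kappa> n z x ((real j - 1) * T / n))))"

definition binomial_hedge ::
  "real \<Rightarrow> real \<Rightarrow> real \<Rightarrow> (real \<Rightarrow> (real \<Rightarrow> real) \<Rightarrow> real) \<Rightarrow> (real \<Rightarrow> (real \<Rightarrow> real) \<Rightarrow> real) \<Rightarrow>
     'b measure \<Rightarrow> (nat \<Rightarrow> 'b \<Rightarrow> real) \<Rightarrow> nat \<Rightarrow> real \<Rightarrow>
     ((nat \<Rightarrow> real) \<Rightarrow> nat) \<Rightarrow> real \<Rightarrow> (nat \<Rightarrow> (nat \<Rightarrow> real) \<Rightarrow> real) \<Rightarrow> bool" where
  "binomial_hedge T r \<kappa> F \<Delta> N \<xi> n z \<mu> Z0 \<gamma> \<longleftrightarrow>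
     (AE \<omega> in N. \<forall>k\<in>{0..n}.
        let x = sample_signs \<xi> n \<omega>; m = \<mu> x in
        binomial_value T r \<kappa> n z Z0 \<gamma> x (min m k)
          \<ge> game_payoff F \<Delta> (binomial_stock T r \<kappa> n z x) (m * T / n) (k * T / n))"


section \<open>The transferred hedge\<close>

definition cancel_time ::
  "real \<Rightarrow> real \<Rightarrow> (real \<Rightarrow> 'a \<Rightarrow> real) \<Rightarrow> nat \<Rightarrow> ((nat \<Rightarrow> real) \<Rightarrow> nat) \<Rightarrow> 'a \<Rightarrow> real" where
  "cancel_time T \<kappa> B n \<mu> \<omega> =
     (let \<phi> = \<mu> (embed_signs T \<kappa> B n \<omega>)
      in capped T (embed_time T \<kappa> B n \<phi> \<omega>) * of_bool (\<phi> < n) + T * of_bool (\<phi> = n))"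

definition bs_discounted_stock ::
  "real \<Rightarrow> real \<Rightarrow> (real \<Rightarrow> 'a \<Rightarrow> real) \<Rightarrow> real \<Rightarrow> 'a \<Rightarrow> real \<Rightarrow> real" where
  "bs_discounted_stock r \<kappa> B z \<omega> t = exp (- r * t) * bs_stock r \<kappa> B z \<omega> t"

definition bs_value ::
  "real \<Rightarrow> real \<Rightarrow> real \<Rightarrow> (real \<Rightarrow> 'a \<Rightarrow> real) \<Rightarrow> nat \<Rightarrow> real \<Rightarrow> real \<Rightarrow>
     (nat \<Rightarrow> (nat \<Rightarrow> real) \<Rightarrow> real) \<Rightarrow> 'a \<Rightarrow> real \<Rightarrow> real" where
  "bs_value T r \<kappa> B n z Z0 \<gamma> \<omega> t =
     exp (r * t) *
       (Z0 + (\<Sum>k=1..n. \<gamma> k (embed_signs T \<kappa> B n \<omega>) *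
          (bs_discounted_stock r \<kappa> B z \<omega> (capped t (embed_time T \<kappa> B n k \<omega>))
           - bs_discounted_stock r \<kappa> B z \<omega> (capped t (embed_time T \<kappa> B n (k - 1) \<omega>)))))"

text \<open>The positive part of the shortfall when the seller cancels at time \<open>s\<close> and the buyer
  exercises at time \<open>t\<close>.\<close>

definition shortfall ::
  "real \<Rightarrow> real \<Rightarrow> real \<Rightarrow> (real \<Rightarrow> (real \<Rightarrow> real) \<Rightarrow> real) \<Rightarrow> (real \<Rightarrow> (real \<Rightarrow> real) \<Rightarrow> real) \<Rightarrow>
     (real \<Rightarrow> 'a \<Rightarrow> real) \<Rightarrow> nat \<Rightarrow> real \<Rightarrow> real \<Rightarrow> (nat \<Rightarrow> (nat \<Rightarrow> real) \<Rightarrow> real) \<Rightarrow>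
     'a \<Rightarrow> real \<Rightarrow> real \<Rightarrow> real" where
  "shortfall T r \<kappa> F \<Delta> B n z Z0 \<gamma> \<omega> s t =
     max (game_payoff F \<Delta> (bs_stock r \<kappa> B z \<omega>) s t
            - bs_value T r \<kappa> B n z Z0 \<gamma> \<omega> (min s t)) 0"

end

theory Submission
  imports Defs
begin

text \<open>The shortfall is bounded path by path and uniformly in the exercise time. The expectation of its
supremum is then of order \<open>n powr (-1/4) * ln n powr (3/4)\<close>, which gives the bound for a single
stopping time at once, and the other one because \<open>ln n\<close> grows more slowly than any power of \<open>n\<close>.

\<^bold>\<open>Along one path.\<close> All sign vectors have positive probability, so the hedging inequality
holds for each of them. At the \<open>k\<close>-th hitting time \<open>\<theta>\<^sub>k\<close> the discounted Black--Scholes price equals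
the discounted binomial price after the first \<open>k\<close> embedded signs; therefore the two discounted
portfolio values agree there. Between two hitting times the holding is constant, the discounted value
is affine in the price, and the price stays between its two possible values at the next hit. So the
value at time \<open>t\<close> dominates the value at one of the two binomial successors
(\<open>bs_value_between_hits\<close>). Both successors agree with the embedded signs so far, hence neither
is cancelled earlier, and the hedging inequality there reduces the shortfall to the difference of a
payoff functional at \<open>t\<close> on the continuous path and at a grid time on the binomial path. The
regularity of the payoffs bounds it by a multiple of
\<open>(F\<^sub>0 + \<Delta>\<^sub>0 + z + 1) * exp (\<kappa> * R) * (d + w + sqrt (T / n))\<close>, where \<open>R\<close> bounds \<open>B\<^sup>*\<close> on
\<open>[0,T]\<close>, \<open>d\<close> bounds the distances of the hitting times from the grid, and \<open>w\<close> is the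
oscillation of \<open>B\<^sup>*\<close> over time distances up to \<open>d\<close> (\<open>shortfall_le\<close>).

\<^bold>\<open>In the mean.\<close> The squared increments between hitting times add up to \<open>k * T / n\<close> at
\<open>\<theta>\<^sub>k\<close>. By Ito's formula this sum differs from \<open>\<theta>\<^sub>k\<close> by a stochastic integral whose integrand is
at most \<open>sqrt (T / n)\<close>, up to a drift of the same order, so \<open>\<theta>\<^sub>k\<close> has Gaussian tails at that scale.
The stochastic integral is reached through dyadic sums of adapted factors times increments of the
path: conditioning on the past, one step at a time, bounds their exponential moments
(\<open>exp_sum_bound\<close>), and Fatou's lemma carries the bound to the limit (\<open>qv_error_exp_moment\<close>). A
union bound over \<open>k \<le> n\<close> gives \<open>d\<close> of order \<open>sqrt (ln n / n)\<close> outside an event of probability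
of order \<open>1 / n\<close>. The same exponential bound, with the factor switched off once a level is passed, is a
maximal inequality (\<open>grid_max_tail\<close>). It controls the oscillation over all blocks of length
\<open>d\<close> and yields \<open>w\<close> of order \<open>sqrt (d * ln n)\<close>, which is the rate claimed. The factor
\<open>exp (\<kappa> * R)\<close> is separated by Young's inequality (\<open>embedding_error_bound\<close>).\<close>

section \<open>Brownian motion and its history\<close>


text \<open>Rounding a time down to the dyadic subdivision of \<open>[0,t]\<close>. For \<open>t = 0\<close> the quotient is
\<open>0\<close>, and both parts remain true.\<close>

lemma dyadic_floor_tendsto:
  fixes s t :: real
  assumes "0 \<le> s" "s \<le> t"
  shows "(\<lambda>q. real (nat \<lfloor>s * 2 ^ q / t\<rfloor>) * t / 2 ^ q) \<longlonglongrightarrow> s"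
    and "nat \<lfloor>s * 2 ^ q / t\<rfloor> \<le> 2 ^ q"
proof -
  show "nat \<lfloor>s * 2 ^ q / t\<rfloor> \<le> 2 ^ q" for q :: nat
  proof (cases "t = 0")
    case False
    then have "s * 2 ^ q / t \<le> 2 ^ q" using assms by (simp add: field_simps)
    then have "\<lfloor>s * 2 ^ q / t\<rfloor> \<le> \<lfloor>(2::real) ^ q\<rfloor>" by (rule floor_mono)
    also have "\<dots> = 2 ^ q" by (metis floor_of_int of_int_numeral of_int_power)
    finally show ?thesis by (simp add: nat_le_iff)
  qed simp
  show "(\<lambda>q. real (nat \<lfloor>s * 2 ^ q / t\<rfloor>) * t / 2 ^ q) \<longlonglongrightarrow> s"
  proof (cases "t = 0")
    case True then show ?thesis using assms by simp
  next
    case False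
    then have t: "t > 0" using assms by simp
    have ge: "0 \<le> s * 2 ^ q / t" for q using assms t by simp
    have eq: "real (nat \<lfloor>s * 2 ^ q / t\<rfloor>) = of_int \<lfloor>s * 2 ^ q / t\<rfloor>" for q
      using ge[of q] by simp
    have up: "real (nat \<lfloor>s * 2 ^ q / t\<rfloor>) * t / 2 ^ q \<le> s" for q
    proof -
      have "real (nat \<lfloor>s * 2 ^ q / t\<rfloor>) \<le> s * 2 ^ q / t" unfolding eq by simp
      then show ?thesis using t by (simp add: field_simps)
    qed
    have lo: "s - t / 2 ^ q \<le> real (nat \<lfloor>s * 2 ^ q / t\<rfloor>) * t / 2 ^ q" for q
    proof -
      have "s * 2 ^ q / t - 1 \<le> real (nat \<lfloor>s * 2 ^ q / t\<rfloor>)" unfolding eq by linarith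
      then have "(s * 2 ^ q / t - 1) * (t / 2 ^ q) \<le> real (nat \<lfloor>s * 2 ^ q / t\<rfloor>) * (t / 2 ^ q)"
        using t by (intro mult_right_mono) auto
      moreover have "(s * 2 ^ q / t - 1) * (t / 2 ^ q) = s - t / 2 ^ q"
        using t by (simp add: field_simps)
      ultimately show ?thesis by simp
    qed
    have "(\<lambda>q. s - t * (1/2) ^ q) \<longlonglongrightarrow> s - t * 0"
      by (intro tendsto_intros LIMSEQ_power_zero) auto
    then have "(\<lambda>q. s - t / 2 ^ q) \<longlonglongrightarrow> s" by (simp add: power_one_over)
    then show ?thesis
      by (rule tendsto_sandwich[OF _ _ _ tendsto_const, rotated -1]) (use up lo in auto)
  qed
qed

text \<open>A Brownian motion all of whose paths are continuous and start at \<open>0\<close>; every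
\<open>standard_brownian_motion\<close> agrees with one almost surely (\<open>continuous_modification\<close>).
Having this at every point of the space makes hitting times measurable for the history of the
path itself.\<close>

locale continuous_bm = prob_space M for M :: "'a measure" +
  fixes W :: "real \<Rightarrow> 'a \<Rightarrow> real"
  assumes W_meas: "0 \<le> t \<Longrightarrow> W t \<in> borel_measurable M"
    and W_0: "\<omega> \<in> space M \<Longrightarrow> W 0 \<omega> = 0"
    and W_gauss: "0 \<le> s \<Longrightarrow> s < t \<Longrightarrow> distributed M lborel (\<lambda>\<omega>. W t \<omega> - W s \<omega>)
        (\<lambda>x. ennreal (normal_density 0 (sqrt (t - s)) x))"
    and W_indep: "0 \<le> \<tau> 0 \<Longrightarrow> (\<And>i. i < (m::nat) \<Longrightarrow> \<tau> i \<le> \<tau> (Suc i)) \<Longrightarrow>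
        indep_vars (\<lambda>_. borel) (\<lambda>i \<omega>. W (\<tau> (Suc i)) \<omega> - W (\<tau> i) \<omega>) {..<m}"
    and W_cont: "\<omega> \<in> space M \<Longrightarrow> continuous_on {0..} (\<lambda>t. W t \<omega>)"
begin

text \<open>The natural filtration, without null sets added.\<close>

definition history :: "real \<Rightarrow> 'a measure" where
  "history t = sigma (space M) (\<Union>s\<in>{0..t}. {W s -` A \<inter> space M |A. A \<in> sets borel})"

lemma space_history [simp]: "space (history t) = space M"
  unfolding history_def by (rule space_measure_of) auto

lemma sets_history: "sets (history t) = sigma_sets (space M) (\<Union>s\<in>{0..t}. {W s -` A \<inter> space M |A. A \<in> sets borel})"
  unfolding history_def by (rule sets_measure_of) auto

lemma sets_history_subset: "sets (history t) \<subseteq> sets M"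
  unfolding sets_history using W_meas by (intro sets.sigma_sets_subset) (auto intro!: measurable_sets)

lemma W_history [measurable]: "0 \<le> s \<Longrightarrow> s \<le> t \<Longrightarrow> W s \<in> borel_measurable (history t)"
  by (rule measurableI) (force simp: sets_history intro!: sigma_sets.Basic)+

lemma sets_history_mono: "s \<le> t \<Longrightarrow> sets (history s) \<subseteq> sets (history t)"
  unfolding sets_history by (intro sigma_sets_mono') force

lemma history_mono: "f \<in> measurable (history s) N \<Longrightarrow> s \<le> t \<Longrightarrow> f \<in> measurable (history t) N"
  using sets_history_mono[of s t] by (auto simp: measurable_def)

lemma history_measurable_M: "f \<in> measurable (history s) N \<Longrightarrow> f \<in> measurable M N"
  using sets_history_subset[of s] by (auto simp: measurable_def)

text \<open>The independence axiom speaks about finitely many consecutive increments. Increments on the dyadic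
subdivisions of \<open>[0,t]\<close> generate an increasing sequence of \<sigma>-algebras, whose union is therefore
closed under intersections, and which determines the continuous path on \<open>[0,t]\<close>.\<close>

definition dyadic_incr :: "real \<Rightarrow> nat \<Rightarrow> 'a \<Rightarrow> nat \<Rightarrow> real" where
  "dyadic_incr t q \<omega> = (\<lambda>i\<in>{..<2 ^ q}. W (real (Suc i) * t / 2 ^ q) \<omega> - W (real i * t / 2 ^ q) \<omega>)"

definition dyadic_history :: "real \<Rightarrow> nat \<Rightarrow> 'a measure" where
  "dyadic_history t q = vimage_algebra (space M) (dyadic_incr t q) (PiM {..<2 ^ q} (\<lambda>_. borel))"

lemma space_dyadic_history [simp]: "space (dyadic_history t q) = space M" by (simp add: dyadic_history_def)

lemma W_dyadic_history:
  assumes "i \<le> 2 ^ q"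
  shows "W (real i * t / 2 ^ q) \<in> borel_measurable (dyadic_history t q)"
proof -
  have D: "dyadic_incr t q \<in> measurable (dyadic_history t q) (PiM {..<2 ^ q} (\<lambda>_. borel))"
    unfolding dyadic_history_def by (rule measurable_vimage_algebra1) (auto simp: dyadic_incr_def space_PiM)
  have "(\<lambda>\<omega>. \<Sum>l<i. dyadic_incr t q \<omega> l) \<in> borel_measurable (dyadic_history t q)"
  proof (rule borel_measurable_sum)
    fix l assume "l \<in> {..<i}"
    then have "l \<in> {..<2 ^ q}" using assms by simp
    from measurable_compose[OF D measurable_component_singleton[OF this]]
    show "(\<lambda>\<omega>. dyadic_incr t q \<omega> l) \<in> borel_measurable (dyadic_history t q)" .
  qed
  moreover have "(\<Sum>l<i. dyadic_incr t q \<omega> l) = W (real i * t / 2 ^ q) \<omega>" if "\<omega> \<in> space M" for \<omega>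
  proof -
    have "(\<Sum>l<i. dyadic_incr t q \<omega> l)
        = (\<Sum>l<i. W (real (Suc l) * t / 2 ^ q) \<omega> - W (real l * t / 2 ^ q) \<omega>)"
      using assms by (intro sum.cong) (auto simp: dyadic_incr_def)
    also have "\<dots> = W (real i * t / 2 ^ q) \<omega> - W (real 0 * t / 2 ^ q) \<omega>"
      by (rule sum_lessThan_telescope)
    finally show ?thesis using W_0[OF that] by simp
  qed
  ultimately show ?thesis by (subst measurable_cong) (auto simp: eq_commute)
qed

lemma sets_dyadic_history_mono:
  assumes "q \<le> q'"
  shows "sets (dyadic_history t q) \<subseteq> sets (dyadic_history t q')"
proof -
  have "dyadic_incr t q \<in> measurable (dyadic_history t q') (PiM {..<2 ^ q} (\<lambda>_. borel))"
    unfolding dyadic_incr_def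
  proof (rule measurable_restrict)
    fix i :: nat assume i: "i \<in> {..<2 ^ q}"
    have *: "W (real j * t / 2 ^ q) \<in> borel_measurable (dyadic_history t q')" if "j \<le> 2 ^ q" for j
    proof -
      have pw: "(2::nat) ^ q * 2 ^ (q' - q) = 2 ^ q'" using assms by (simp flip: power_add)
      then have "real j * t / 2 ^ q = real (j * 2 ^ (q' - q)) * t / 2 ^ q'"
        using assms by (simp add: field_simps flip: power_add)
      moreover have "j * 2 ^ (q' - q) \<le> 2 ^ q'"
        using mult_right_mono[OF that, of "2 ^ (q' - q)"] pw by simp
      ultimately show ?thesis using W_dyadic_history[of "j * 2 ^ (q' - q)" q' t] by simp
    qed
    show "(\<lambda>\<omega>. W (real (Suc i) * t / 2 ^ q) \<omega> - W (real i * t / 2 ^ q) \<omega>) \<in> borel_measurable (dyadic_history t q')"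
      using i by (intro borel_measurable_diff *) auto
  qed
  from measurable_sets[OF this] show ?thesis
    unfolding dyadic_history_def[of t q]
    by (subst sets_vimage_algebra2) (auto simp: dyadic_incr_def space_PiM)
qed

lemma indep_set_UN_dyadic_history:
  assumes "0 \<le> t" "t < u"
  shows "indep_set (\<Union>q. sets (dyadic_history t q)) {(\<lambda>\<omega>. W u \<omega> - W t \<omega>) -` A \<inter> space M |A. A \<in> sets borel}"
  unfolding indep_set_def
proof -
  have "indep_set (sets (dyadic_history t q)) {(\<lambda>\<omega>. W u \<omega> - W t \<omega>) -` A \<inter> space M |A. A \<in> sets borel}" for q
  proof -
    define \<tau> where "\<tau> i = (if i \<le> 2 ^ q then real i * t / 2 ^ q else u)" for i :: nat
    define X where "X i \<omega> = W (\<tau> (Suc i)) \<omega> - W (\<tau> i) \<omega>" for i \<omega>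
    have "\<tau> i \<le> \<tau> (Suc i)" if "i < Suc (2 ^ q)" for i
    proof (cases "Suc i \<le> 2 ^ q")
      case True then show ?thesis using assms by (auto simp: \<tau>_def divide_right_mono mult_right_mono)
    next
      case False
      then have "i = 2 ^ q" using that by simp
      then show ?thesis using assms by (simp add: \<tau>_def)
    qed
    then have "indep_vars (\<lambda>_. borel) X {..<Suc (2 ^ q)}"
      unfolding X_def using assms by (intro W_indep) (auto simp: \<tau>_def)
    then have "indep_var (PiM {..<2 ^ q} (\<lambda>_. borel)) (\<lambda>\<omega>. \<lambda>i\<in>{..<2 ^ q}. X i \<omega>)
        (PiM {2 ^ q} (\<lambda>_. borel)) (\<lambda>\<omega>. \<lambda>i\<in>{2 ^ q}. X i \<omega>)"
      by (rule indep_var_restrict) auto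
    then have ind: "indep_set (sigma_sets (space M) {(\<lambda>\<omega>. \<lambda>i\<in>{..<2 ^ q}. X i \<omega>) -` A \<inter> space M |A. A \<in> sets (PiM {..<2 ^ q} (\<lambda>_. borel))})
      (sigma_sets (space M) {(\<lambda>\<omega>. \<lambda>i\<in>{2 ^ q}. X i \<omega>) -` A \<inter> space M |A. A \<in> sets (PiM {2 ^ q} (\<lambda>_. borel))})"
      by (simp add: indep_var_eq)
    have d: "(\<lambda>\<omega>. \<lambda>i\<in>{..<2 ^ q}. X i \<omega>) = dyadic_incr t q"
      by (auto simp: fun_eq_iff dyadic_incr_def X_def \<tau>_def restrict_def)
    have A: "sets (dyadic_history t q) \<subseteq> sigma_sets (space M) {(\<lambda>\<omega>. \<lambda>i\<in>{..<2 ^ q}. X i \<omega>) -` A \<inter> space M |A. A \<in> sets (PiM {..<2 ^ q} (\<lambda>_. borel))}"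
      unfolding d dyadic_history_def
      by (subst sets_vimage_algebra2) (auto simp: dyadic_incr_def space_PiM)
    have B: "{(\<lambda>\<omega>. W u \<omega> - W t \<omega>) -` A \<inter> space M |A. A \<in> sets borel} \<subseteq>
      sigma_sets (space M) {(\<lambda>\<omega>. \<lambda>i\<in>{2 ^ q}. X i \<omega>) -` A \<inter> space M |A. A \<in> sets (PiM {2 ^ q} (\<lambda>_. borel))}"
    proof clarify
      fix A :: "real set" assume A: "A \<in> sets borel"
      have "(\<lambda>\<omega>. W u \<omega> - W t \<omega>) -` A \<inter> space M
        = (\<lambda>\<omega>. \<lambda>i\<in>{2 ^ q}. X i \<omega>) -` ((\<lambda>x. x (2 ^ q)) -` A \<inter> space (PiM {2 ^ q} (\<lambda>_. borel))) \<inter> space M"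
        by (auto simp: X_def \<tau>_def space_PiM)
      moreover have "(\<lambda>x. x (2 ^ q)) -` A \<inter> space (PiM {2 ^ q} (\<lambda>_. borel)) \<in> sets (PiM {2 ^ q :: nat} (\<lambda>_. borel))"
        by (rule measurable_sets[OF _ A]) (auto intro: measurable_component_singleton)
      ultimately show "(\<lambda>\<omega>. W u \<omega> - W t \<omega>) -` A \<inter> space M \<in> sigma_sets (space M) {(\<lambda>\<omega>. \<lambda>i\<in>{2 ^ q}. X i \<omega>) -` A \<inter> space M |A. A \<in> sets (PiM {2 ^ q} (\<lambda>_. borel))}"
        by blast
    qed
    show ?thesis
      using ind A B unfolding indep_set_def
      by (elim indep_sets_mono_sets) (auto split: bool.split)
  qed
  then show "indep_sets (case_bool (\<Union>q. sets (dyadic_history t q)) {(\<lambda>\<omega>. W u \<omega> - W t \<omega>) -` A \<inter> space M |A. A \<in> sets borel}) UNIV"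
    unfolding indep_set_def[symmetric] indep_sets2_eq by blast
qed

text \<open>Independence passes from the intersection-stable union of the dyadic histories to the \<sigma>-algebra that
it generates, and by continuity the latter contains the whole history up to \<open>t\<close>.\<close>

lemma indep_history_incr:
  assumes "0 \<le> t" "t < u"
  shows "indep_set (sets (history t)) {(\<lambda>\<omega>. W u \<omega> - W t \<omega>) -` A \<inter> space M |A. A \<in> sets borel}"
proof -
  let ?X = "\<lambda>\<omega>. W u \<omega> - W t \<omega>"
  let ?A = "\<Union>q. sets (dyadic_history t q)"
  let ?B = "{?X -` A \<inter> space M |A. A \<in> sets borel}"
  have subA: "?A \<subseteq> Pow (space M)" using sets.sets_into_space[of _ "dyadic_history t _"] by auto
  have "Int_stable ?A"
  proof (rule Int_stableI)
    fix a b assume "a \<in> ?A" "b \<in> ?A"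
    then obtain q q' where "a \<in> sets (dyadic_history t q)" "b \<in> sets (dyadic_history t q')" by auto
    then have "a \<in> sets (dyadic_history t (max q q'))" "b \<in> sets (dyadic_history t (max q q'))"
      using sets_dyadic_history_mono[of q "max q q'" t] sets_dyadic_history_mono[of q' "max q q'" t] by auto
    then show "a \<inter> b \<in> ?A" by blast
  qed
  moreover have "Int_stable ?B"
  proof (rule Int_stableI)
    fix a b assume "a \<in> ?B" "b \<in> ?B"
    then obtain A B where "a = ?X -` A \<inter> space M" "A \<in> sets borel" "b = ?X -` B \<inter> space M" "B \<in> sets borel"
      by blast
    then have "a \<inter> b = ?X -` (A \<inter> B) \<inter> space M" "A \<inter> B \<in> sets borel" by auto
    then show "a \<inter> b \<in> ?B" by blast
  qed
  ultimately have ind: "indep_set (sigma_sets (space M) ?A) (sigma_sets (space M) ?B)"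
    using indep_set_UN_dyadic_history[OF assms] by (intro indep_set_sigma_sets)
  have "W s \<in> borel_measurable (sigma (space M) ?A)" if s: "0 \<le> s" "s \<le> t" for s
  proof (rule borel_measurable_LIMSEQ_real)
    fix q
    have "W (real (nat \<lfloor>s * 2 ^ q / t\<rfloor>) * t / 2 ^ q) \<in> borel_measurable (dyadic_history t q)"
      using dyadic_floor_tendsto(2)[OF s] by (rule W_dyadic_history)
    then show "W (real (nat \<lfloor>s * 2 ^ q / t\<rfloor>) * t / 2 ^ q) \<in> borel_measurable (sigma (space M) ?A)"
      by (auto simp: measurable_def sets_measure_of[OF subA] space_measure_of[OF subA])
  next
    fix \<omega> assume "\<omega> \<in> space (sigma (space M) ?A)"
    then have \<omega>: "\<omega> \<in> space M" by (simp add: space_measure_of[OF subA])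
    show "(\<lambda>q. W (real (nat \<lfloor>s * 2 ^ q / t\<rfloor>) * t / 2 ^ q) \<omega>) \<longlonglongrightarrow> W s \<omega>"
      by (rule continuous_on_tendsto_compose[OF W_cont[OF \<omega>] dyadic_floor_tendsto(1)[OF s]])
        (use s in auto)
  qed
  then have "sets (history t) \<subseteq> sigma_sets (space M) ?A"
    unfolding sets_history
    by (intro sigma_sets_mono) (auto simp: measurable_def sets_measure_of[OF subA] space_measure_of[OF subA])
  moreover have "?B \<subseteq> sigma_sets (space M) ?B" by auto
  ultimately show ?thesis
    using ind unfolding indep_set_def
    by (elim indep_sets_mono_sets) (auto split: bool.split)
qed

text \<open>Conditioning on the history in integrated form: an increment after \<open>t\<close> may be integrated out
with everything known at time \<open>t\<close> kept fixed. The pair of the identity and the increment has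
a product law.\<close>

lemma nn_integral_freeze_history:
  assumes "0 \<le> t" "t < u" and g[measurable]: "case_prod g \<in> borel_measurable (history t \<Otimes>\<^sub>M borel)"
  shows "(\<integral>\<^sup>+\<omega>. g \<omega> (W u \<omega> - W t \<omega>) \<partial>M) =
    (\<integral>\<^sup>+\<omega>. (\<integral>\<^sup>+x. ennreal (normal_density 0 (sqrt (u - t)) x) * g \<omega> x \<partial>lborel) \<partial>M)"
proof -
  let ?X = "\<lambda>\<omega>. W u \<omega> - W t \<omega>"
  let ?D = "density lborel (\<lambda>x. ennreal (normal_density 0 (sqrt (u - t)) x))"
  have rvX: "?X \<in> borel_measurable M" using W_meas[of u] W_meas[of t] assms by auto
  have id: "(\<lambda>\<omega>. \<omega>) \<in> measurable M (history t)"
    using sets_history_subset[of t] sets.sets_into_space[of _ "history t"] by (auto simp: measurable_def Int_absorb2)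
  have dX: "distr M borel ?X = ?D"
    using W_gauss[OF assms(1,2)] by (simp add: distributed_def cong: distr_cong)
  have "prob_space (distr M borel ?X)" by (rule prob_space_distr[OF rvX])
  then interpret D: prob_space ?D unfolding dX .
  have sD: "sigma_finite_measure ?D" by unfold_locales
  have eq: "distr M (history t) (\<lambda>\<omega>. \<omega>) \<Otimes>\<^sub>M ?D = distr M (history t \<Otimes>\<^sub>M borel) (\<lambda>\<omega>. (\<omega>, ?X \<omega>))"
  proof (rule pair_measure_eqI)
    show "sigma_finite_measure (distr M (history t) (\<lambda>\<omega>. \<omega>))"
      using prob_space_distr[OF id] by (simp add: prob_space_def finite_measure_def)
    show "sigma_finite_measure ?D" by (rule sD)
    show "sets (distr M (history t) (\<lambda>\<omega>. \<omega>) \<Otimes>\<^sub>M ?D) = sets (distr M (history t \<Otimes>\<^sub>M borel) (\<lambda>\<omega>. (\<omega>, ?X \<omega>)))"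
      by (simp cong: sets_pair_measure_cong)
    fix A B assume "A \<in> sets (distr M (history t) (\<lambda>\<omega>. \<omega>))" "B \<in> sets ?D"
    then have A: "A \<in> sets (history t)" and B: "B \<in> sets borel" by auto
    have AM: "A \<in> sets M" "A \<subseteq> space M"
      using A sets_history_subset[of t] sets.sets_into_space[OF A] by auto
    have BM: "?X -` B \<inter> space M \<in> sets M" by (rule measurable_sets[OF rvX B])
    have "emeasure (distr M (history t) (\<lambda>\<omega>. \<omega>)) A * emeasure ?D B
       = emeasure M A * emeasure M (?X -` B \<inter> space M)"
      unfolding dX[symmetric] using A B AM by (simp add: emeasure_distr[OF id] emeasure_distr[OF rvX] Int_absorb2)
    also have "\<dots> = emeasure M (A \<inter> (?X -` B \<inter> space M))"
    proof -
      have "?X -` B \<inter> space M \<in> {?X -` A \<inter> space M |A. A \<in> sets borel}" using B by blast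
      from indep_setD[OF indep_history_incr[OF assms(1,2)] A this]
      show ?thesis by (simp add: emeasure_eq_measure ennreal_mult[symmetric])
    qed
    also have "A \<inter> (?X -` B \<inter> space M) = (\<lambda>\<omega>. (\<omega>, ?X \<omega>)) -` (A \<times> B) \<inter> space M"
      using AM by auto
    also have "emeasure M \<dots> = emeasure (distr M (history t \<Otimes>\<^sub>M borel) (\<lambda>\<omega>. (\<omega>, ?X \<omega>))) (A \<times> B)"
      using A B by (subst emeasure_distr) (auto intro!: measurable_Pair id rvX)
    finally show "emeasure (distr M (history t) (\<lambda>\<omega>. \<omega>)) A * emeasure ?D B = emeasure (distr M (history t \<Otimes>\<^sub>M borel) (\<lambda>\<omega>. (\<omega>, ?X \<omega>))) (A \<times> B)" .
  qed
  have "(\<integral>\<^sup>+\<omega>. g \<omega> (?X \<omega>) \<partial>M) = (\<integral>\<^sup>+p. case_prod g p \<partial>distr M (history t \<Otimes>\<^sub>M borel) (\<lambda>\<omega>. (\<omega>, ?X \<omega>)))"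
    by (subst nn_integral_distr) (auto intro!: measurable_Pair id rvX)
  also have "\<dots> = (\<integral>\<^sup>+p. case_prod g p \<partial>(distr M (history t) (\<lambda>\<omega>. \<omega>) \<Otimes>\<^sub>M ?D))" by (simp only: eq)
  also have "\<dots> = (\<integral>\<^sup>+\<omega>. (\<integral>\<^sup>+x. g \<omega> x \<partial>?D) \<partial>distr M (history t) (\<lambda>\<omega>. \<omega>))"
    by (subst D.nn_integral_fst[symmetric]) (auto cong: measurable_cong_sets sets_pair_measure_cong)
  also have "\<dots> = (\<integral>\<^sup>+\<omega>. (\<integral>\<^sup>+x. g \<omega> x \<partial>?D) \<partial>M)"
  proof (subst nn_integral_distr[OF id])
    have "case_prod g \<in> borel_measurable (history t \<Otimes>\<^sub>M ?D)"
      using g by (simp cong: measurable_cong_sets sets_pair_measure_cong)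
    from D.borel_measurable_nn_integral[OF this]
    show "(\<lambda>\<omega>. \<integral>\<^sup>+x. g \<omega> x \<partial>?D) \<in> borel_measurable (distr M (history t) (\<lambda>\<omega>. \<omega>))" by simp
  qed simp
  also have "\<dots> = (\<integral>\<^sup>+\<omega>. (\<integral>\<^sup>+x. ennreal (normal_density 0 (sqrt (u - t)) x) * g \<omega> x \<partial>lborel) \<partial>M)"
  proof (rule nn_integral_cong)
    fix \<omega> assume "\<omega> \<in> space M"
    then have "g \<omega> \<in> borel_measurable borel"
      using measurable_Pair2[OF g, of \<omega>] by simp
    then show "(\<integral>\<^sup>+x. g \<omega> x \<partial>?D) = (\<integral>\<^sup>+x. ennreal (normal_density 0 (sqrt (u - t)) x) * g \<omega> x \<partial>lborel)"
      by (subst nn_integral_density) auto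
  qed
  finally show ?thesis .
qed

lemma incr_measurable:
  assumes "0 \<le> t" "t \<le> u" and V: "(\<lambda>(\<omega>, x). V \<omega> x) \<in> borel_measurable (history t \<Otimes>\<^sub>M borel)"
  shows "(\<lambda>\<omega>. V \<omega> (W u \<omega> - W t \<omega>)) \<in> borel_measurable (history u)"
proof -
  have X: "(\<lambda>\<omega>. W u \<omega> - W t \<omega>) \<in> borel_measurable (history u)"
    using assms by (intro borel_measurable_diff W_history) auto
  have i: "(\<lambda>\<omega>. \<omega>) \<in> measurable (history u) (history t)"
    by (rule history_mono[of _ t]) (use assms in auto)
  from measurable_compose[OF measurable_Pair[OF i X] V] show ?thesis by simp
qed

text \<open>The exponential of the sum is, after division by the exponential of the bounds, a discrete
supermartingale: integrating out the last increment with the past frozen costs the factor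
\<open>exp (\<beta> j)\<close>. Both the maximal inequality and the control of the hitting times are instances.\<close>

lemma exp_sum_bound:
  fixes V :: "nat \<Rightarrow> 'a \<Rightarrow> real \<Rightarrow> real" and t \<beta> :: "nat \<Rightarrow> real"
  assumes t0: "0 \<le> t 0" and tm: "\<And>j. j < J \<Longrightarrow> t j < t (Suc j)"
    and V: "\<And>j. j < J \<Longrightarrow> (\<lambda>(\<omega>, x). V j \<omega> x) \<in> borel_measurable (history (t j) \<Otimes>\<^sub>M borel)"
    and b: "\<And>j \<omega>. j < J \<Longrightarrow> \<omega> \<in> space M \<Longrightarrow>
      (\<integral>\<^sup>+x. ennreal (normal_density 0 (sqrt (t (Suc j) - t j)) x) * ennreal (exp (V j \<omega> x)) \<partial>lborel)
        \<le> ennreal (exp (\<beta> j))"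
  shows "(\<integral>\<^sup>+\<omega>. ennreal (exp (\<Sum>j<J. V j \<omega> (W (t (Suc j)) \<omega> - W (t j) \<omega>))) \<partial>M)
    \<le> ennreal (exp (\<Sum>j<J. \<beta> j))"
proof -
  let ?S = "\<lambda>K \<omega>. \<Sum>j<K. V j \<omega> (W (t (Suc j)) \<omega> - W (t j) \<omega>)"
  have tmono: "t i \<le> t j" if "i \<le> j" "j \<le> J" for i j
    using that
  proof (induction j rule: dec_induct)
    case (step k) then show ?case using tm[of k] by simp
  qed simp
  have tpos: "0 \<le> t j" if "j \<le> J" for j using tmono[of 0 j] that t0 by simp
  have "K \<le> J \<Longrightarrow> (\<integral>\<^sup>+\<omega>. ennreal (exp (?S K \<omega>)) \<partial>M) \<le> ennreal (exp (\<Sum>j<K. \<beta> j))" for K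
  proof (induction K)
    case 0 then show ?case by (simp add: emeasure_space_1)
  next
    case (Suc K)
    then have K: "K < J" by simp
    have SK: "?S K \<in> borel_measurable (history (t K))"
    proof (rule borel_measurable_sum)
      fix j assume "j \<in> {..<K}"
      then have j: "j < J" "Suc j \<le> K" "j \<le> K" using K by auto
      show "(\<lambda>\<omega>. V j \<omega> (W (t (Suc j)) \<omega> - W (t j) \<omega>)) \<in> borel_measurable (history (t K))"
        by (rule history_mono[OF incr_measurable[OF tpos less_imp_le[OF tm] V] tmono]) (use j K in auto)
    qed
    let ?g = "\<lambda>\<omega> x. ennreal (exp (?S K \<omega>)) * ennreal (exp (V K \<omega> x))"
    have gm: "case_prod ?g \<in> borel_measurable (history (t K) \<Otimes>\<^sub>M borel)"
      using SK V[OF K] by (auto simp: split_beta' intro!: borel_measurable_times)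
    have "(\<integral>\<^sup>+\<omega>. ennreal (exp (?S (Suc K) \<omega>)) \<partial>M)
        = (\<integral>\<^sup>+\<omega>. ?g \<omega> (W (t (Suc K)) \<omega> - W (t K) \<omega>) \<partial>M)"
      by (simp add: exp_add ennreal_mult)
    also have "\<dots> = (\<integral>\<^sup>+\<omega>. (\<integral>\<^sup>+x. ennreal (normal_density 0 (sqrt (t (Suc K) - t K)) x) * ?g \<omega> x \<partial>lborel) \<partial>M)"
      by (rule nn_integral_freeze_history[OF _ _ gm]) (use tpos[of K] tm[OF K] K in auto)
    also have "\<dots> \<le> (\<integral>\<^sup>+\<omega>. ennreal (exp (?S K \<omega>)) * ennreal (exp (\<beta> K)) \<partial>M)"
    proof (rule nn_integral_mono)
      fix \<omega> assume \<omega>: "\<omega> \<in> space M"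
      then have m: "V K \<omega> \<in> borel_measurable borel"
        using measurable_Pair2[OF V[OF K], of \<omega>] by simp
      have "(\<integral>\<^sup>+x. ennreal (normal_density 0 (sqrt (t (Suc K) - t K)) x) * ?g \<omega> x \<partial>lborel)
        = (\<integral>\<^sup>+x. ennreal (exp (?S K \<omega>)) * (ennreal (normal_density 0 (sqrt (t (Suc K) - t K)) x) * ennreal (exp (V K \<omega> x))) \<partial>lborel)"
        by (simp add: mult_ac)
      also have "\<dots> = ennreal (exp (?S K \<omega>)) * (\<integral>\<^sup>+x. ennreal (normal_density 0 (sqrt (t (Suc K) - t K)) x) * ennreal (exp (V K \<omega> x)) \<partial>lborel)"
        using m by (intro nn_integral_cmult) auto
      also have "\<dots> \<le> ennreal (exp (?S K \<omega>)) * ennreal (exp (\<beta> K))"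
        by (intro mult_left_mono b K \<omega>) auto
      finally show "(\<integral>\<^sup>+x. ennreal (normal_density 0 (sqrt (t (Suc K) - t K)) x) * ?g \<omega> x \<partial>lborel)
        \<le> ennreal (exp (?S K \<omega>)) * ennreal (exp (\<beta> K))" .
    qed
    also have "\<dots> = (\<integral>\<^sup>+\<omega>. ennreal (exp (?S K \<omega>)) \<partial>M) * ennreal (exp (\<beta> K))"
      using history_measurable_M[OF SK] by (intro nn_integral_multc) auto
    also have "\<dots> \<le> ennreal (exp (\<Sum>j<K. \<beta> j)) * ennreal (exp (\<beta> K))"
      using Suc by (intro mult_right_mono) auto
    also have "\<dots> = ennreal (exp (\<Sum>j<Suc K. \<beta> j))" by (simp add: exp_add ennreal_mult)
    finally show ?case .
  qed
  then show ?thesis by simp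
qed

end

section \<open>Exponential moments of increments and of the maximal deviation\<close>


text \<open>Completing the square turns the integrand into a multiple of a Gaussian density of variance
\<open>\<delta> / (1 - 2 * b * \<delta>)\<close>.\<close>

lemma nn_integral_gaussian_exp_quadratic:
  fixes a b \<delta> :: real
  assumes d: "\<delta> > 0" and b: "2 * b * \<delta> < 1"
  shows "(\<integral>\<^sup>+x. ennreal (normal_density 0 (sqrt \<delta>) x) * ennreal (exp (a * x + b * x\<^sup>2)) \<partial>lborel)
    = ennreal (exp (a\<^sup>2 * \<delta> / (2 * (1 - 2 * b * \<delta>))) / sqrt (1 - 2 * b * \<delta>))"
proof -
  define D where "D = 1 - 2 * b * \<delta>"
  define \<delta>' where "\<delta>' = \<delta> / D"
  have D: "D > 0" using b by (simp add: D_def)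
  have d': "\<delta>' > 0" using d D by (simp add: \<delta>'_def)
  let ?K = "exp (a\<^sup>2 * \<delta> / (2 * D)) / sqrt D"
  have K: "?K \<ge> 0" using D by simp
  have eq: "normal_density 0 (sqrt \<delta>) x * exp (a * x + b * x\<^sup>2)
     = ?K * normal_density (a * \<delta>') (sqrt \<delta>') x" for x
  proof -
    have "- x\<^sup>2 / (2 * \<delta>) + (a * x + b * x\<^sup>2) = a\<^sup>2 * \<delta> / (2 * D) - (x - a * \<delta>')\<^sup>2 / (2 * \<delta>')"
    proof -
      have "(x - a * \<delta>')\<^sup>2 / (2 * \<delta>') = x\<^sup>2 * D / (2 * \<delta>) - a * x + a\<^sup>2 * \<delta> / (2 * D)"
        using d D unfolding \<delta>'_def by (simp add: field_simps power2_eq_square)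
      moreover have "x\<^sup>2 * D / (2 * \<delta>) = x\<^sup>2 / (2 * \<delta>) - b * x\<^sup>2"
        using d unfolding D_def by (simp add: field_simps)
      ultimately show ?thesis by simp
    qed
    then have e: "exp (- x\<^sup>2 / (2 * \<delta>)) * exp (a * x + b * x\<^sup>2)
      = exp (a\<^sup>2 * \<delta> / (2 * D)) * exp (- (x - a * \<delta>')\<^sup>2 / (2 * \<delta>'))"
      by (simp add: exp_add[symmetric])
    have r: "1 / sqrt (2 * pi * \<delta>) = 1 / sqrt D * (1 / sqrt (2 * pi * \<delta>'))"
      using d D unfolding \<delta>'_def by (simp add: real_sqrt_mult real_sqrt_divide)
    show ?thesis
      using d d' e r by (simp add: normal_density_def mult_ac)
  qed
  have "(\<integral>\<^sup>+x. ennreal (normal_density 0 (sqrt \<delta>) x) * ennreal (exp (a * x + b * x\<^sup>2)) \<partial>lborel)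
    = (\<integral>\<^sup>+x. ennreal ?K * ennreal (normal_density (a * \<delta>') (sqrt \<delta>') x) \<partial>lborel)"
    using K by (intro nn_integral_cong) (simp add: ennreal_mult[symmetric] eq)
  also have "\<dots> = ennreal ?K * (\<integral>\<^sup>+x. ennreal (normal_density (a * \<delta>') (sqrt \<delta>') x) \<partial>lborel)"
    by (intro nn_integral_cmult) auto
  also have "(\<integral>\<^sup>+x. ennreal (normal_density (a * \<delta>') (sqrt \<delta>') x) \<partial>lborel) = 1"
  proof -
    have "prob_space (density lborel (normal_density (a * \<delta>') (sqrt \<delta>')))"
      using d' by (intro prob_space_normal_density) auto
    from prob_space.emeasure_space_1[OF this] show ?thesis
      by (simp add: emeasure_density)
  qed
  finally show ?thesis unfolding D_def by simp
qed

lemma nn_integral_gaussian_exp_linear: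
  fixes a \<delta> :: real
  assumes "\<delta> > 0"
  shows "(\<integral>\<^sup>+x. ennreal (normal_density 0 (sqrt \<delta>) x) * ennreal (exp (a * x)) \<partial>lborel)
    = ennreal (exp (a\<^sup>2 * \<delta> / 2))"
  using nn_integral_gaussian_exp_quadratic[OF assms, of 0 a] assms by simp

text \<open>One step of the path with drift, seen from a point at distance \<open>c\<close> from the last hitting level:
the square of the distance grows by \<open>\<delta>\<close> on average, and the compensated growth is \<open>2 * c\<close> times the
increment up to smaller terms. Its exponential moment is that of a centred Gaussian of variance of
order \<open>h\<^sup>2 * \<delta>\<close>, the terms with a further factor \<open>\<delta>\<close> being negligible as the grid is refined.\<close>

lemma nn_integral_gaussian_exp_square_increment:
  fixes c h \<kappa> \<rho> \<delta> :: real
  assumes d: "\<delta> > 0" and l: "\<bar>\<rho>\<bar> * \<delta> \<le> 1 / 4" and c: "\<bar>c\<bar> \<le> h" and k: "\<kappa> \<ge> 0"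
  shows "(\<integral>\<^sup>+x. ennreal (normal_density 0 (sqrt \<delta>) x) *
      ennreal (exp (\<rho> * ((c + (x - \<kappa> / 2 * \<delta>))\<^sup>2 - c\<^sup>2 - \<delta>))) \<partial>lborel)
    \<le> ennreal (exp (\<delta> * (8 * \<rho>\<^sup>2 * h\<^sup>2 + \<bar>\<rho>\<bar> * h * \<kappa> + \<delta> * (4 * \<rho>\<^sup>2 + 2 * \<rho>\<^sup>2 * \<kappa>\<^sup>2 * \<delta> + \<bar>\<rho>\<bar> * \<kappa>\<^sup>2 / 4))))"
proof -
  define \<alpha> where "\<alpha> = 2 * \<rho> * c - \<rho> * \<kappa> * \<delta>"
  define D where "D = 1 - 2 * \<rho> * \<delta>"
  define e where "e = \<rho> * (\<kappa>\<^sup>2 * \<delta>\<^sup>2 / 4 - c * \<kappa> * \<delta> - \<delta>)"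
  have ld: "\<bar>\<rho> * \<delta>\<bar> \<le> 1 / 4" using l d by (simp add: abs_mult)
  then have D: "D \<ge> 1 / 2" unfolding D_def by linarith
  have "(\<integral>\<^sup>+x. ennreal (normal_density 0 (sqrt \<delta>) x) *
      ennreal (exp (\<rho> * ((c + (x - \<kappa> / 2 * \<delta>))\<^sup>2 - c\<^sup>2 - \<delta>))) \<partial>lborel)
    = (\<integral>\<^sup>+x. ennreal (exp e) * (ennreal (normal_density 0 (sqrt \<delta>) x) * ennreal (exp (\<alpha> * x + \<rho> * x\<^sup>2))) \<partial>lborel)"
  proof (intro nn_integral_cong)
    fix x
    have "\<rho> * ((c + (x - \<kappa> / 2 * \<delta>))\<^sup>2 - c\<^sup>2 - \<delta>) = e + (\<alpha> * x + \<rho> * x\<^sup>2)"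
      unfolding e_def \<alpha>_def by (simp add: power2_eq_square field_simps)
    then show "ennreal (normal_density 0 (sqrt \<delta>) x) * ennreal (exp (\<rho> * ((c + (x - \<kappa> / 2 * \<delta>))\<^sup>2 - c\<^sup>2 - \<delta>)))
      = ennreal (exp e) * (ennreal (normal_density 0 (sqrt \<delta>) x) * ennreal (exp (\<alpha> * x + \<rho> * x\<^sup>2)))"
      by (simp only: exp_add[of e] ennreal_mult[OF exp_ge_zero exp_ge_zero] mult.left_commute)
  qed
  also have "\<dots> = ennreal (exp e) * (\<integral>\<^sup>+x. ennreal (normal_density 0 (sqrt \<delta>) x) * ennreal (exp (\<alpha> * x + \<rho> * x\<^sup>2)) \<partial>lborel)"
    by (intro nn_integral_cmult) auto
  also have "\<dots> = ennreal (exp e) * ennreal (exp (\<alpha>\<^sup>2 * \<delta> / (2 * D)) / sqrt D)"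
    using nn_integral_gaussian_exp_quadratic[OF d, of \<rho> \<alpha>] D unfolding D_def by simp
  also have "\<dots> = ennreal (exp (e + \<alpha>\<^sup>2 * \<delta> / (2 * D) - ln D / 2))"
  proof -
    have "sqrt D = exp (ln D / 2)" using D by (simp add: ln_sqrt[symmetric])
    then show ?thesis using D by (simp add: ennreal_mult[symmetric] exp_diff exp_add)
  qed
  also have "\<dots> \<le> ennreal (exp (\<delta> * (8 * \<rho>\<^sup>2 * h\<^sup>2 + \<bar>\<rho>\<bar> * h * \<kappa> + \<delta> * (4 * \<rho>\<^sup>2 + 2 * \<rho>\<^sup>2 * \<kappa>\<^sup>2 * \<delta> + \<bar>\<rho>\<bar> * \<kappa>\<^sup>2 / 4))))"
  proof (intro ennreal_leI iffD2[OF exp_le_cancel_iff])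
    have "\<bar>ln (1 + (- 2 * \<rho> * \<delta>)) - (- 2 * \<rho> * \<delta>)\<bar> \<le> 2 * (- 2 * \<rho> * \<delta>)\<^sup>2"
      by (rule abs_ln_one_plus_x_minus_x_bound) (use ld in auto)
    then have 1: "- ln D / 2 \<le> \<rho> * \<delta> + 4 * \<rho>\<^sup>2 * \<delta>\<^sup>2"
      unfolding D_def by (simp add: power_mult_distrib)
    have "\<alpha>\<^sup>2 * \<delta> / (2 * D) \<le> \<alpha>\<^sup>2 * \<delta> / 1"
      using D d by (intro divide_left_mono) auto
    moreover have "\<alpha>\<^sup>2 \<le> 8 * \<rho>\<^sup>2 * h\<^sup>2 + 2 * \<rho>\<^sup>2 * \<kappa>\<^sup>2 * \<delta>\<^sup>2"
    proof -
      have "0 \<le> (2 * \<rho> * c + \<rho> * \<kappa> * \<delta>)\<^sup>2" by simp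
      then have "\<alpha>\<^sup>2 \<le> 8 * \<rho>\<^sup>2 * c\<^sup>2 + 2 * \<rho>\<^sup>2 * \<kappa>\<^sup>2 * \<delta>\<^sup>2"
        unfolding \<alpha>_def by (simp add: power2_eq_square algebra_simps)
      moreover have "c\<^sup>2 \<le> h\<^sup>2" using c by (metis abs_ge_zero power2_abs power_mono)
      then have "8 * \<rho>\<^sup>2 * c\<^sup>2 \<le> 8 * \<rho>\<^sup>2 * h\<^sup>2" by (intro mult_left_mono) auto
      ultimately show ?thesis by linarith
    qed
    then have "\<alpha>\<^sup>2 * \<delta> \<le> (8 * \<rho>\<^sup>2 * h\<^sup>2 + 2 * \<rho>\<^sup>2 * \<kappa>\<^sup>2 * \<delta>\<^sup>2) * \<delta>"
      using d by (intro mult_right_mono) auto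
    moreover have "\<rho> * (\<kappa>\<^sup>2 * \<delta>\<^sup>2 / 4) \<le> \<bar>\<rho>\<bar> * (\<kappa>\<^sup>2 * \<delta>\<^sup>2 / 4)" by (intro mult_right_mono) auto
    moreover have "- (\<rho> * (c * \<kappa> * \<delta>)) \<le> \<bar>\<rho>\<bar> * (h * \<kappa> * \<delta>)"
    proof -
      have "- (\<rho> * (c * \<kappa> * \<delta>)) \<le> \<bar>\<rho> * (c * \<kappa> * \<delta>)\<bar>" by linarith
      also have "\<dots> = \<bar>\<rho>\<bar> * (\<bar>c\<bar> * \<kappa> * \<delta>)" using k d by (simp add: abs_mult)
      also have "\<dots> \<le> \<bar>\<rho>\<bar> * (h * \<kappa> * \<delta>)" using c k d by (intro mult_left_mono mult_right_mono) auto
      finally show ?thesis .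
    qed
    ultimately have "e + \<alpha>\<^sup>2 * \<delta> / (2 * D) - ln D / 2 \<le>
       4 * \<rho>\<^sup>2 * \<delta>\<^sup>2 + (8 * \<rho>\<^sup>2 * h\<^sup>2 + 2 * \<rho>\<^sup>2 * \<kappa>\<^sup>2 * \<delta>\<^sup>2) * \<delta> + \<bar>\<rho>\<bar> * (\<kappa>\<^sup>2 * \<delta>\<^sup>2 / 4) + \<bar>\<rho>\<bar> * (h * \<kappa> * \<delta>)"
      using 1 unfolding e_def by (simp add: algebra_simps)
    also have "\<dots> = \<delta> * (8 * \<rho>\<^sup>2 * h\<^sup>2 + \<bar>\<rho>\<bar> * h * \<kappa> + \<delta> * (4 * \<rho>\<^sup>2 + 2 * \<rho>\<^sup>2 * \<kappa>\<^sup>2 * \<delta> + \<bar>\<rho>\<bar> * \<kappa>\<^sup>2 / 4))"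
      by (simp add: algebra_simps power2_eq_square)
    finally show "e + \<alpha>\<^sup>2 * \<delta> / (2 * D) - ln D / 2 \<le> \<delta> * (8 * \<rho>\<^sup>2 * h\<^sup>2 + \<bar>\<rho>\<bar> * h * \<kappa> + \<delta> * (4 * \<rho>\<^sup>2 + 2 * \<rho>\<^sup>2 * \<kappa>\<^sup>2 * \<delta> + \<bar>\<rho>\<bar> * \<kappa>\<^sup>2 / 4))"
 .
  qed
  finally show ?thesis .
qed

text \<open>Summing increments only until the level \<open>a\<close> is passed freezes the sum at or above \<open>a\<close>. This
expresses the event that a maximum exceeds \<open>a\<close> through a single sum with adapted factors.\<close>

lemma stopped_sum_ge:
  fixes S :: "nat \<Rightarrow> real"
  assumes "S 0 = 0" "a > 0"
  shows "(\<forall>i\<le>J. S i < a) \<Longrightarrow> (\<Sum>j<J. (if \<forall>i\<le>j. S i < a then S (Suc j) - S j else 0)) = S J"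
    and "(\<exists>i\<le>J. a \<le> S i) \<Longrightarrow> a \<le> (\<Sum>j<J. (if \<forall>i\<le>j. S i < a then S (Suc j) - S j else 0))"
proof -
  let ?C = "\<lambda>J. \<Sum>j<J. (if \<forall>i\<le>j. S i < a then S (Suc j) - S j else 0)"
  have 1: "(\<forall>i\<le>J. S i < a) \<Longrightarrow> ?C J = S J" for J
  proof (induction J)
    case (Suc J) then show ?case by (simp add: le_Suc_eq)
  qed (simp add: assms)
  show "(\<forall>i\<le>J. S i < a) \<Longrightarrow> ?C J = S J" by (rule 1)
  show "(\<exists>i\<le>J. a \<le> S i) \<Longrightarrow> a \<le> ?C J"
  proof (induction J)
    case 0 then show ?case using assms by simp
  next
    case (Suc J)
    show ?case
    proof (cases "\<exists>i\<le>J. a \<le> S i")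
      case True
      then have "\<not> (\<forall>i\<le>J. S i < a)" by (auto simp: not_less)
      then have "?C (Suc J) = ?C J" by (simp only: sum.lessThan_Suc if_False add_0_right)
      then show ?thesis using Suc.IH[OF True] by simp
    next
      case False
      have all: "\<forall>i\<le>J. S i < a"
      proof (intro allI impI)
        fix i assume "i \<le> J"
        then have "\<not> a \<le> S i" using False by blast
        then show "S i < a" by linarith
      qed
      then have "?C (Suc J) = S J + (S (Suc J) - S J)"
        using 1[OF all] by (subst sum.lessThan_Suc) (simp only: if_P[OF all])
      moreover have "a \<le> S (Suc J)" using Suc.prems False by (auto simp: le_Suc_eq)
      ultimately show ?thesis by simp
    qed
  qed
qed

text \<open>Suprema of continuous functions are limits of maxima over countably many fixed points; this is the
source of all measurability statements about suprema and hitting times below.\<close>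

lemma grid_max_tendsto_SUP:
  fixes f :: "real \<Rightarrow> real"
  assumes cont: "continuous_on {u..u + \<eta>} f" and eta: "0 \<le> \<eta>"
  shows "(\<lambda>m. MAX i\<in>{..2 ^ m}. f (u + real i * \<eta> / 2 ^ m)) \<longlonglongrightarrow> (SUP s\<in>{u..u + \<eta>}. f s)"
proof -
  let ?g = "\<lambda>m. MAX i\<in>{..2 ^ m}. f (u + real i * \<eta> / 2 ^ m)"
  obtain s where s: "s \<in> {u..u + \<eta>}" "\<And>s'. s' \<in> {u..u + \<eta>} \<Longrightarrow> f s' \<le> f s"
    using continuous_attains_sup[OF compact_Icc _ cont] eta by auto
  then have os: "(SUP s\<in>{u..u + \<eta>}. f s) = f s"
    by (intro cSup_eq_maximum) auto
  have ss: "0 \<le> s - u" "s - u \<le> \<eta>" using s by auto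
  let ?p = "\<lambda>m. u + real (nat \<lfloor>(s - u) * 2 ^ m / \<eta>\<rfloor>) * \<eta> / 2 ^ m"
  have "(\<lambda>m. ?p m) \<longlonglongrightarrow> u + (s - u)" by (intro tendsto_intros dyadic_floor_tendsto(1)[OF ss])
  then have pt: "?p \<longlonglongrightarrow> s" by simp
  have grid_in: "u + real i * \<eta> / 2 ^ m \<in> {u..u + \<eta>}" if "i \<le> 2 ^ m" for i m :: nat
  proof -
    have "real i \<le> real (2 ^ m)" using that by (rule of_nat_mono)
    then have "real i * \<eta> / 2 ^ m \<le> 2 ^ m * \<eta> / 2 ^ m"
      using eta by (intro divide_right_mono mult_right_mono) auto
    then show ?thesis using eta by simp
  qed
  have lim: "(\<lambda>m. f (?p m)) \<longlonglongrightarrow> f s"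
    by (rule continuous_on_tendsto_compose[OF cont pt s(1)])
      (intro always_eventually allI grid_in dyadic_floor_tendsto(2)[OF ss])
  have lo: "f (?p m) \<le> ?g m" for m
    by (rule Max_ge) (use dyadic_floor_tendsto(2)[OF ss, of m] in auto)
  have up: "?g m \<le> f s" for m
    by (rule Max.boundedI) (auto intro!: s(2) grid_in)
  show ?thesis unfolding os
    by (rule tendsto_sandwich[OF always_eventually always_eventually lim tendsto_const]) (use lo up in auto)
qed

context continuous_bm begin

text \<open>Markov's inequality for the exponential of the increment sum that is stopped on passing \<open>a\<close>. The sign
\<open>\<sigma>\<close> treats the maximum and the minimum together.\<close>

lemma grid_max_tail:
  fixes u \<eta> a \<mu> \<sigma> :: real and J :: nat
  assumes u: "0 \<le> u" and eta: "0 < \<eta>" and J: "0 < J" and a: "0 < a" and sg: "\<bar>\<sigma>\<bar> = 1" and mu: "\<mu> \<ge> 0"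
  shows "emeasure M {\<omega> \<in> space M. \<exists>i\<le>J. a \<le> \<sigma> * (W (u + real i * \<eta> / J) \<omega> - W u \<omega>)}
    \<le> ennreal (exp (\<mu>\<^sup>2 * \<eta> / 2 - \<mu> * a))"
proof -
  define t where "t i = u + real i * \<eta> / J" for i
  define S where "S i \<omega> = \<sigma> * (W (t i) \<omega> - W u \<omega>)" for i \<omega>
  define alive where "alive j \<omega> \<longleftrightarrow> (\<forall>i\<le>j. S i \<omega> < a)" for j :: nat and \<omega>
  define V where "V j \<omega> x = (if alive j \<omega> then \<mu> * \<sigma> * x else 0)" for j :: nat and \<omega> x
  have tdiff: "t (Suc j) - t j = \<eta> / J" for j unfolding t_def of_nat_Suc distrib_right add_divide_distrib by simp
  have tpos: "u \<le> t j" for j using eta by (simp add: t_def)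
  have tmono: "t i \<le> t j" if "i \<le> j" for i j
    using that eta by (auto simp: t_def intro!: divide_right_mono mult_right_mono)
  have S_meas: "S i \<in> borel_measurable (history (t j))" if "i \<le> j" for i j
    unfolding S_def using u tpos[of i] tpos[of j] tmono[OF that]
    by (intro borel_measurable_times borel_measurable_diff W_history) auto
  have set_meas: "{\<omega> \<in> space M. alive j \<omega>} \<in> sets (history (t j))" for j
  proof -
    have one: "{\<omega> \<in> space M. S i \<omega> < a} \<in> sets (history (t j))" if "i \<le> j" for i
      using borel_measurable_less[OF S_meas[OF that] borel_measurable_const[of a]] unfolding space_history .
    have "(\<Inter>i\<in>{..j}. {\<omega> \<in> space M. S i \<omega> < a}) \<in> sets (history (t j))"
      by (rule sets.finite_INT) (use one in blast)+
    moreover have "(\<Inter>i\<in>{..j}. {\<omega> \<in> space M. S i \<omega> < a}) = {\<omega> \<in> space M. alive j \<omega>}"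
      unfolding alive_def by blast
    ultimately show ?thesis by (simp only:)
  qed
  have V_meas: "(\<lambda>(\<omega>, x). V j \<omega> x) \<in> borel_measurable (history (t j) \<Otimes>\<^sub>M borel)" for j
  proof -
    have "(\<lambda>p. indicator {\<omega> \<in> space M. alive j \<omega>} (fst p) * (\<mu> * \<sigma> * snd p) :: real)
        \<in> borel_measurable (history (t j) \<Otimes>\<^sub>M borel)"
      by (intro borel_measurable_times borel_measurable_const measurable_snd
        measurable_compose[OF measurable_fst borel_measurable_indicator[OF set_meas]])
    moreover have "indicator {\<omega> \<in> space M. alive j \<omega>} (fst p) * (\<mu> * \<sigma> * snd p) = (\<lambda>(\<omega>, x). V j \<omega> x) p"
      if "p \<in> space (history (t j) \<Otimes>\<^sub>M borel)" for p
      using that by (auto simp: V_def space_pair_measure indicator_def split_beta)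
    ultimately show ?thesis by (rule measurable_cong[THEN iffD1, rotated])
  qed
  have bd: "(\<integral>\<^sup>+x. ennreal (normal_density 0 (sqrt (t (Suc j) - t j)) x) * ennreal (exp (V j \<omega> x)) \<partial>lborel)
        \<le> ennreal (exp (\<mu>\<^sup>2 * (\<eta> / J) / 2))" for j \<omega>
  proof -
    define c where "c = (if alive j \<omega> then \<mu> * \<sigma> else 0)"
    have "V j \<omega> x = c * x" for x by (simp add: V_def c_def)
    then have "(\<integral>\<^sup>+x. ennreal (normal_density 0 (sqrt (t (Suc j) - t j)) x) * ennreal (exp (V j \<omega> x)) \<partial>lborel)
      = ennreal (exp (c\<^sup>2 * (\<eta> / J) / 2))"
      using nn_integral_gaussian_exp_linear[of "\<eta> / J" c] eta J by (simp add: tdiff)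
    also have "\<dots> \<le> ennreal (exp (\<mu>\<^sup>2 * (\<eta> / J) / 2))"
    proof -
      have "\<sigma>\<^sup>2 = 1" using sg by (metis one_power2 power2_abs)
      then have "c\<^sup>2 \<le> \<mu>\<^sup>2" by (auto simp: c_def power_mult_distrib)
      then show ?thesis using eta J
        by (intro ennreal_leI iffD2[OF exp_le_cancel_iff] divide_right_mono mult_right_mono) auto
    qed
    finally show ?thesis .
  qed
  let ?E = "\<lambda>\<omega>. \<Sum>j<J. V j \<omega> (W (t (Suc j)) \<omega> - W (t j) \<omega>)"
  have main: "(\<integral>\<^sup>+\<omega>. ennreal (exp (?E \<omega>)) \<partial>M) \<le> ennreal (exp (\<Sum>j<J. \<mu>\<^sup>2 * (\<eta> / J) / 2))"
  proof (rule exp_sum_bound, goal_cases)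
    case (3 j) show ?case by (rule V_meas)
  next
    case (4 j \<omega>) show ?case by (rule bd)
  next
    case 1
    show ?case using tpos[of 0] u by simp
  next
    case (2 j)
    have "0 < \<eta> / J" using eta J by simp
    then show ?case using tdiff[of j] by linarith
  qed
  have E_eq: "?E \<omega> = \<mu> * (\<Sum>j<J. (if \<forall>i\<le>j. S i \<omega> < a then S (Suc j) \<omega> - S j \<omega> else 0))" for \<omega>
    unfolding sum_distrib_left
    unfolding alive_def[symmetric] by (intro sum.cong) (auto simp: V_def S_def algebra_simps)
  have "emeasure M {\<omega> \<in> space M. \<exists>i\<le>J. a \<le> S i \<omega>}
    = (\<integral>\<^sup>+\<omega>. indicator {\<omega> \<in> space M. \<exists>i\<le>J. a \<le> S i \<omega>} \<omega> \<partial>M)"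
  proof (rule nn_integral_indicator[symmetric])
    have "{\<omega> \<in> space M. \<exists>i\<le>J. a \<le> S i \<omega>} = space M - {\<omega> \<in> space M. alive J \<omega>}"
      unfolding alive_def by (auto simp: not_less)
    then show "{\<omega> \<in> space M. \<exists>i\<le>J. a \<le> S i \<omega>} \<in> sets M"
      using set_meas[of J] sets_history_subset[of "t J"] by auto
  qed
  also have "\<dots> \<le> (\<integral>\<^sup>+\<omega>. ennreal (exp (- \<mu> * a)) * ennreal (exp (?E \<omega>)) \<partial>M)"
  proof (intro nn_integral_mono)
    fix \<omega> assume "\<omega> \<in> space M"
    show "indicator {\<omega> \<in> space M. \<exists>i\<le>J. a \<le> S i \<omega>} \<omega> \<le> ennreal (exp (- \<mu> * a)) * ennreal (exp (?E \<omega>))"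
    proof (cases "\<exists>i\<le>J. a \<le> S i \<omega>")
      case True
      have "S 0 \<omega> = 0" by (simp add: S_def t_def)
      from stopped_sum_ge(2)[of "\<lambda>i. S i \<omega>", OF this a True]
      have "\<mu> * a \<le> ?E \<omega>" unfolding E_eq using mu by (intro mult_left_mono) auto
      then have "1 \<le> exp (- \<mu> * a) * exp (?E \<omega>)" by (simp add: exp_add[symmetric])
      then have "ennreal 1 \<le> ennreal (exp (- \<mu> * a) * exp (?E \<omega>))" by (rule ennreal_leI)
      then show ?thesis by (simp add: ennreal_mult indicator_def)
    qed (auto simp: indicator_def)
  qed
  also have "\<dots> = ennreal (exp (- \<mu> * a)) * (\<integral>\<^sup>+\<omega>. ennreal (exp (?E \<omega>)) \<partial>M)"
  proof (rule nn_integral_cmult)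
    have "?E \<in> borel_measurable M"
    proof (rule borel_measurable_sum)
      fix j
      show "(\<lambda>\<omega>. V j \<omega> (W (t (Suc j)) \<omega> - W (t j) \<omega>)) \<in> borel_measurable M"
        using tpos[of j] u tmono[of j "Suc j"] by (intro history_measurable_M[OF incr_measurable[OF _ _ V_meas]]) auto
    qed
    then show "(\<lambda>\<omega>. ennreal (exp (?E \<omega>))) \<in> borel_measurable M" by measurable
  qed
  also have "\<dots> \<le> ennreal (exp (- \<mu> * a)) * ennreal (exp (\<Sum>j<J. \<mu>\<^sup>2 * (\<eta> / J) / 2))"
    by (intro mult_left_mono main) auto
  also have "\<dots> = ennreal (exp (\<mu>\<^sup>2 * \<eta> / 2 - \<mu> * a))"
    using J by (simp add: ennreal_mult[symmetric] exp_add[symmetric])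
  finally show ?thesis unfolding S_def t_def .
qed


definition grid_dev :: "real \<Rightarrow> real \<Rightarrow> nat \<Rightarrow> 'a \<Rightarrow> real" where
  "grid_dev u \<eta> m \<omega> = (MAX i\<in>{..2 ^ m}. \<bar>W (u + real i * \<eta> / 2 ^ m) \<omega> - W u \<omega>\<bar>)"

definition max_dev :: "real \<Rightarrow> real \<Rightarrow> 'a \<Rightarrow> real" where
  "max_dev u \<eta> \<omega> = (SUP s\<in>{u..u + \<eta>}. \<bar>W s \<omega> - W u \<omega>\<bar>)"

lemma grid_dev_measurable: "0 \<le> u \<Longrightarrow> 0 < \<eta> \<Longrightarrow> grid_dev u \<eta> m \<in> borel_measurable M"
  unfolding grid_dev_def
  by (intro borel_measurable_Max borel_measurable_abs borel_measurable_diff W_meas) auto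

lemma grid_dev_nonneg: "0 \<le> grid_dev u \<eta> m \<omega>"
proof -
  have "\<bar>W (u + real 0 * \<eta> / 2 ^ m) \<omega> - W u \<omega>\<bar> \<le> grid_dev u \<eta> m \<omega>"
    unfolding grid_dev_def by (intro Max_ge finite_imageI imageI) simp_all
  then show ?thesis by simp
qed

lemma grid_dev_tail:
  assumes u: "0 \<le> u" and eta: "0 < \<eta>" and l: "0 < l"
  shows "emeasure M {\<omega> \<in> space M. real i \<le> l * grid_dev u \<eta> m \<omega>} \<le> ennreal (2 * exp (2 * l\<^sup>2 * \<eta> - 2 * real i))"
proof (cases "i = 0")
  case True
  have "emeasure M {\<omega> \<in> space M. real i \<le> l * grid_dev u \<eta> m \<omega>} \<le> ennreal 1"
    using emeasure_space[of M] emeasure_space_1 by simp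
  also have "\<dots> \<le> ennreal (2 * exp (2 * l\<^sup>2 * \<eta> - 2 * real i))"
  proof (rule ennreal_leI)
    have "0 \<le> 2 * l\<^sup>2 * \<eta>" using eta by simp
    then have "1 \<le> exp (2 * l\<^sup>2 * \<eta>)" by simp
    then have "1 \<le> 2 * exp (2 * l\<^sup>2 * \<eta>)" by linarith
    then show "1 \<le> 2 * exp (2 * l\<^sup>2 * \<eta> - 2 * real i)" using True by simp
  qed
  finally show ?thesis .
next
  case False
  let ?A = "\<lambda>\<sigma>. {\<omega> \<in> space M. \<exists>j\<le>2 ^ m. real i / l \<le> \<sigma> * (W (u + real j * \<eta> / real (2 ^ m)) \<omega> - W u \<omega>)}"
  have A: "?A \<sigma> \<in> sets M" for \<sigma>
  proof -
    have "(\<Union>j\<in>{..2 ^ m}. {\<omega> \<in> space M. real i / l \<le> \<sigma> * (W (u + real j * \<eta> / real (2 ^ m)) \<omega> - W u \<omega>)}) \<in> sets M"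
      using u eta
      by (intro sets.finite_UN borel_measurable_le borel_measurable_const borel_measurable_times borel_measurable_diff W_meas) auto
    also have "(\<Union>j\<in>{..2 ^ m}. {\<omega> \<in> space M. real i / l \<le> \<sigma> * (W (u + real j * \<eta> / real (2 ^ m)) \<omega> - W u \<omega>)}) = ?A \<sigma>"
      by blast
    finally show ?thesis .
  qed
  have tail: "emeasure M (?A \<sigma>) \<le> ennreal (exp (2 * l\<^sup>2 * \<eta> - 2 * real i))" if "\<bar>\<sigma>\<bar> = 1" for \<sigma>
    using grid_max_tail[OF u eta _ _ that, of "2 ^ m" "real i / l" "2 * l"] False l
    by (simp add: power_mult_distrib mult_ac)
  have "{\<omega> \<in> space M. real i \<le> l * grid_dev u \<eta> m \<omega>} \<subseteq> ?A 1 \<union> ?A (-1)"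
  proof
    fix \<omega> assume "\<omega> \<in> {\<omega> \<in> space M. real i \<le> l * grid_dev u \<eta> m \<omega>}"
    then have \<omega>: "\<omega> \<in> space M" and "real i \<le> l * grid_dev u \<eta> m \<omega>" by auto
    then have le: "real i / l \<le> grid_dev u \<eta> m \<omega>" using l by (simp add: field_simps)
    have "grid_dev u \<eta> m \<omega> \<in> (\<lambda>j. \<bar>W (u + real j * \<eta> / 2 ^ m) \<omega> - W u \<omega>\<bar>) ` {..2 ^ m}"
      unfolding grid_dev_def by (rule Max_in) auto
    then obtain j where j: "j \<le> 2 ^ m" "grid_dev u \<eta> m \<omega> = \<bar>W (u + real j * \<eta> / 2 ^ m) \<omega> - W u \<omega>\<bar>" by auto
    let ?d = "W (u + real j * \<eta> / real (2 ^ m)) \<omega> - W u \<omega>"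
    have "real i / l \<le> 1 * ?d \<or> real i / l \<le> -1 * ?d" using le j by (auto simp: abs_if split: if_splits)
    then show "\<omega> \<in> ?A 1 \<union> ?A (-1)" using \<omega> j(1) by blast
  qed
  then have "emeasure M {\<omega> \<in> space M. real i \<le> l * grid_dev u \<eta> m \<omega>} \<le> emeasure M (?A 1 \<union> ?A (-1))"
    using A by (intro emeasure_mono sets.Un)
  also have "\<dots> \<le> emeasure M (?A 1) + emeasure M (?A (-1))"
    using A by (intro emeasure_subadditive)
  also have "\<dots> \<le> ennreal (exp (2 * l\<^sup>2 * \<eta> - 2 * real i)) + ennreal (exp (2 * l\<^sup>2 * \<eta> - 2 * real i))"
    by (intro add_mono tail) auto
  also have "\<dots> = ennreal (2 * exp (2 * l\<^sup>2 * \<eta> - 2 * real i))" by (simp flip: ennreal_plus)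
  finally show ?thesis .
qed

text \<open>Summation of the tail bound over the unit levels of the exponent: the tail, taken with \<open>\<mu> = 2 * l\<close>,
decays like \<open>exp (- 2 * i)\<close>, which leaves a geometric series.\<close>

lemma grid_dev_exp_moment:
  assumes u: "0 \<le> u" and eta: "0 < \<eta>" and l: "0 < l"
  shows "(\<integral>\<^sup>+\<omega>. ennreal (exp (l * grid_dev u \<eta> m \<omega>)) \<partial>M) \<le> ennreal (12 * exp (2 * l\<^sup>2 * \<eta>))"
proof -
  let ?A = "\<lambda>i. {\<omega> \<in> space M. real i \<le> l * grid_dev u \<eta> m \<omega>}"
  have A[measurable]: "?A i \<in> sets M" for i
    using grid_dev_measurable[OF u eta, of m] by measurable
  have "(\<integral>\<^sup>+\<omega>. ennreal (exp (l * grid_dev u \<eta> m \<omega>)) \<partial>M)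
      \<le> (\<integral>\<^sup>+\<omega>. (\<Sum>i. ennreal (exp (real i + 1)) * indicator (?A i) \<omega>) \<partial>M)"
  proof (rule nn_integral_mono)
    fix \<omega> assume \<omega>: "\<omega> \<in> space M"
    define y where "y = l * grid_dev u \<eta> m \<omega>"
    have y: "0 \<le> y" using l grid_dev_nonneg by (simp add: y_def)
    define i where "i = nat \<lfloor>y\<rfloor>"
    have i: "real i \<le> y" "y \<le> real i + 1" using y unfolding i_def by linarith+
    then have "\<omega> \<in> ?A i" using \<omega> by (simp add: y_def)
    have "ennreal (exp y) \<le> ennreal (exp (real i + 1)) * indicator (?A i) \<omega>"
      using i \<open>\<omega> \<in> ?A i\<close> by (simp add: indicator_def ennreal_leI)
    also have "\<dots> \<le> (\<Sum>i. ennreal (exp (real i + 1)) * indicator (?A i) \<omega>)"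
      using sum_le_suminf[OF summableI, of "{i}" "\<lambda>i. ennreal (exp (real i + 1)) * indicator (?A i) \<omega>"]
      by (simp only: finite.emptyI finite.insertI sum.insert sum.empty empty_iff not_False_eq_True add_0_right True_implies_equals zero_le simp_thms)
    finally show "ennreal (exp (l * grid_dev u \<eta> m \<omega>)) \<le> (\<Sum>i. ennreal (exp (real i + 1)) * indicator (?A i) \<omega>)"
      unfolding y_def .
  qed
  also have "\<dots> = (\<Sum>i. (\<integral>\<^sup>+\<omega>. ennreal (exp (real i + 1)) * indicator (?A i) \<omega> \<partial>M))"
    by (intro nn_integral_suminf) measurable
  also have "\<dots> = (\<Sum>i. ennreal (exp (real i + 1)) * emeasure M (?A i))"
    by (intro suminf_cong nn_integral_cmult_indicator A)
  also have "\<dots> \<le> (\<Sum>i. ennreal (2 * exp 1 * exp (2 * l\<^sup>2 * \<eta>) * (exp (-1)) ^ i))"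
  proof (intro suminf_le summableI)
    fix i
    have "ennreal (exp (real i + 1)) * emeasure M (?A i)
       \<le> ennreal (exp (real i + 1)) * ennreal (2 * exp (2 * l\<^sup>2 * \<eta> - 2 * real i))"
      by (intro mult_left_mono grid_dev_tail[OF u eta l]) auto
    also have "\<dots> = ennreal (exp (real i + 1) * (2 * exp (2 * l\<^sup>2 * \<eta> - 2 * real i)))"
      by (rule ennreal_mult[symmetric]) auto
    also have "exp (real i + 1) * (2 * exp (2 * l\<^sup>2 * \<eta> - 2 * real i))
       = 2 * exp 1 * exp (2 * l\<^sup>2 * \<eta>) * (exp (-1)) ^ i"
    proof -
      have "exp (-1) ^ i = exp (- real i)" by (simp add: exp_of_nat_mult[symmetric])
      moreover have "exp (real i + 1) * exp (2 * l\<^sup>2 * \<eta> - 2 * real i) = exp 1 * exp (2 * l\<^sup>2 * \<eta>) * exp (- real i)"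
        by (simp add: exp_add[symmetric] algebra_simps)
      ultimately show ?thesis by simp
    qed
    finally show "ennreal (exp (real i + 1)) * emeasure M (?A i) \<le> ennreal (2 * exp 1 * exp (2 * l\<^sup>2 * \<eta>) * (exp (-1)) ^ i)" .
  qed
  also have "\<dots> = ennreal (\<Sum>i. 2 * exp 1 * exp (2 * l\<^sup>2 * \<eta>) * (exp (-1)) ^ i)"
    by (intro suminf_ennreal2 summable_mult summable_geometric) auto
  also have "(\<Sum>i. 2 * exp 1 * exp (2 * l\<^sup>2 * \<eta>) * (exp (-1 :: real)) ^ i) = 2 * exp 1 * exp (2 * l\<^sup>2 * \<eta>) * (1 / (1 - exp (-1)))"
    by (subst suminf_mult) (auto intro: summable_geometric simp: suminf_geometric)
  also have "ennreal \<dots> \<le> ennreal (12 * exp (2 * l\<^sup>2 * \<eta>))"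
  proof (rule ennreal_leI)
    have e2: "(2::real) \<le> exp 1" using exp_ge_add_one_self[of 1] by simp
    have "exp (-1::real) = 1 / exp 1" by (simp add: exp_minus inverse_eq_divide)
    also have "\<dots> \<le> 1 / 2" using e2 by (simp add: field_simps)
    finally have "1 / (1 - exp (-1)) \<le> (2::real)" by (simp add: field_simps)
    moreover have "exp (1::real) \<le> 3" by (rule exp_le)
    ultimately have "exp 1 * (1 / (1 - exp (-1))) \<le> 3 * (2::real)"
      by (intro mult_mono) auto
    then have "exp 1 * (1 / (1 - exp (-1))) * (2 * exp (2 * l\<^sup>2 * \<eta>)) \<le> 3 * 2 * (2 * exp (2 * l\<^sup>2 * \<eta>))"
      by (intro mult_right_mono) auto
    then show "2 * exp 1 * exp (2 * l\<^sup>2 * \<eta>) * (1 / (1 - exp (-1))) \<le> 12 * exp (2 * l\<^sup>2 * \<eta>)"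
      by (simp add: mult_ac)
  qed
  finally show ?thesis .
qed

lemma abs_incr_bdd:
  assumes "\<omega> \<in> space M" "0 \<le> u"
  shows "bdd_above ((\<lambda>s. \<bar>W s \<omega> - W u \<omega>\<bar>) ` {u..u + \<eta>})"
proof -
  have "continuous_on {u..u + \<eta>} (\<lambda>s. \<bar>W s \<omega> - W u \<omega>\<bar>)"
    using assms by (intro continuous_intros continuous_on_subset[OF W_cont]) auto
  then have "compact ((\<lambda>s. \<bar>W s \<omega> - W u \<omega>\<bar>) ` {u..u + \<eta>})"
    by (intro compact_continuous_image) auto
  then show ?thesis by (intro bounded_imp_bdd_above compact_imp_bounded)
qed

lemma max_dev_ge:
  assumes "\<omega> \<in> space M" "0 \<le> u" "s \<in> {u..u + \<eta>}"
  shows "\<bar>W s \<omega> - W u \<omega>\<bar> \<le> max_dev u \<eta> \<omega>"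
  unfolding max_dev_def using assms by (intro cSUP_upper abs_incr_bdd) auto

lemma grid_dev_tendsto_max_dev:
  assumes \<omega>: "\<omega> \<in> space M" and u: "0 \<le> u" and eta: "0 < \<eta>"
  shows "(\<lambda>m. grid_dev u \<eta> m \<omega>) \<longlonglongrightarrow> max_dev u \<eta> \<omega>"
  unfolding grid_dev_def max_dev_def using assms
  by (intro grid_max_tendsto_SUP continuous_intros continuous_on_subset[OF W_cont]) auto

lemma max_dev_measurable: "0 \<le> u \<Longrightarrow> 0 < \<eta> \<Longrightarrow> max_dev u \<eta> \<in> borel_measurable M"
  by (rule borel_measurable_LIMSEQ_real[OF grid_dev_tendsto_max_dev grid_dev_measurable])

lemma max_dev_exp_moment:
  assumes u: "0 \<le> u" and eta: "0 < \<eta>" and l: "0 < l"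
  shows "(\<integral>\<^sup>+\<omega>. ennreal (exp (l * max_dev u \<eta> \<omega>)) \<partial>M) \<le> ennreal (12 * exp (2 * l\<^sup>2 * \<eta>))"
proof -
  have "(\<integral>\<^sup>+\<omega>. ennreal (exp (l * max_dev u \<eta> \<omega>)) \<partial>M)
     = (\<integral>\<^sup>+\<omega>. liminf (\<lambda>m. ennreal (exp (l * grid_dev u \<eta> m \<omega>))) \<partial>M)"
  proof (rule nn_integral_cong)
    fix \<omega> assume "\<omega> \<in> space M"
    then have "(\<lambda>m. ennreal (exp (l * grid_dev u \<eta> m \<omega>))) \<longlonglongrightarrow> ennreal (exp (l * max_dev u \<eta> \<omega>))"
      by (intro tendsto_ennrealI tendsto_intros grid_dev_tendsto_max_dev u eta)
    from lim_imp_Liminf[OF _ this] show "ennreal (exp (l * max_dev u \<eta> \<omega>)) = liminf (\<lambda>m. ennreal (exp (l * grid_dev u \<eta> m \<omega>)))"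
      by simp
  qed
  also have "\<dots> \<le> liminf (\<lambda>m. \<integral>\<^sup>+\<omega>. ennreal (exp (l * grid_dev u \<eta> m \<omega>)) \<partial>M)"
    using grid_dev_measurable[OF u eta] by (intro nn_integral_liminf) measurable
  also have "\<dots> \<le> liminf (\<lambda>m. ennreal (12 * exp (2 * l\<^sup>2 * \<eta>)))"
    by (intro Liminf_mono always_eventually allI grid_dev_exp_moment u eta l)
  also have "\<dots> = ennreal (12 * exp (2 * l\<^sup>2 * \<eta>))" by (simp add: Liminf_const)
  finally show ?thesis .
qed

end

section \<open>Successive hitting times of a continuous path\<close>


lemma capped_simps [simp]: "capped t (ereal u) = min t u" "capped t \<infinity> = t"
  by (simp_all add: capped_def min_def)

text \<open>The infimum that defines a hitting time is attained, because the path is continuous; before it the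
path stays strictly within distance \<open>h\<close> by the intermediate value theorem.\<close>

lemma hitting_step:
  fixes b :: "real \<Rightarrow> real"
  assumes cont: "continuous_on {0..} b" and h: "0 < h"
    and u: "hitting_times h b k = ereal u" "0 \<le> u"
  shows "(\<exists>v>u. hitting_times h b (Suc k) = ereal v \<and> \<bar>b v - b u\<bar> = h \<and> (\<forall>t\<in>{u..<v}. \<bar>b t - b u\<bar> < h))
    \<or> (hitting_times h b (Suc k) = \<infinity> \<and> (\<forall>t\<ge>u. \<bar>b t - b u\<bar> < h))"
proof -
  \<comment> \<open>The distance from \<open>b u\<close> vanishes at \<open>u\<close>, so \<open>u\<close> itself may be admitted, which makes the set closed.\<close>
  define A where "A = {t \<in> {u..}. \<bar>b t - b u\<bar> = h}"
  have cu: "continuous_on {u..} (\<lambda>t. \<bar>b t - b u\<bar>)"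
    using u by (intro continuous_intros continuous_on_subset[OF cont]) auto
  have A: "A = {t. hitting_times h b k < ereal t \<and> \<bar>b t - b (real_of_ereal (hitting_times h b k))\<bar> = h}"
    using u h unfolding A_def by (auto simp: less_le)
  then have eq: "hitting_times h b (Suc k) = (INF t\<in>A. ereal t)" by simp
  have closed: "closed A" unfolding A_def
    by (rule continuous_closed_preimage_constant[OF cu]) auto
  have ivt: "\<exists>s\<in>A. s \<le> t" if "t \<ge> u" "\<bar>b t - b u\<bar> \<ge> h" for t
    using IVT'[of "\<lambda>t. \<bar>b t - b u\<bar>" u h t] that h continuous_on_subset[OF cu, of "{u..t}"]
    unfolding A_def by auto
  show ?thesis
  proof (cases "A = {}")
    case True
    then have "hitting_times h b (Suc k) = \<infinity>" using eq by (simp add: top_ereal_def)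
    moreover have "\<forall>t\<ge>u. \<bar>b t - b u\<bar> < h" using ivt True by (meson empty_iff not_le)
    ultimately show ?thesis by simp
  next
    case False
    have bdd: "bdd_below A" unfolding A_def by (rule bdd_belowI[of _ u]) auto
    define v where "v = Inf A"
    have v: "v \<in> A" unfolding v_def by (rule closed_contains_Inf[OF False bdd closed])
    have low: "v \<le> t" if "t \<in> A" for t unfolding v_def by (rule cInf_lower[OF that bdd])
    have "hitting_times h b (Suc k) = ereal v" unfolding eq
      by (rule antisym) (use v low in \<open>auto intro: INF_lower INF_greatest\<close>)
    moreover have "v \<noteq> u" "v \<ge> u" "\<bar>b v - b u\<bar> = h" using v h unfolding A_def by auto
    moreover have "\<forall>t\<in>{u..<v}. \<bar>b t - b u\<bar> < h" using ivt low by (meson atLeastLessThan_iff not_le order_trans)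
    ultimately show ?thesis by (intro disjI1 exI[of _ v]) auto
  qed
qed

lemma hitting_infinite: "hitting_times h b k = \<infinity> \<Longrightarrow> hitting_times h b (Suc k) = \<infinity>"
  by (simp add: top_ereal_def)

context
  fixes b :: "real \<Rightarrow> real" and h :: real
  assumes cont: "continuous_on {0..} b" and h: "0 < h"
begin

lemma hitting_cases:
  obtains (fin) u where "hitting_times h b k = ereal u" "0 \<le> u" | (inf) "hitting_times h b k = \<infinity>"
proof -
  have "(\<exists>u\<ge>0. hitting_times h b k = ereal u) \<or> hitting_times h b k = \<infinity>"
  proof (induction k)
    case (Suc k)
    then show ?case
    proof (elim disjE exE conjE)
      fix u assume "0 \<le> u" "hitting_times h b k = ereal u"
      then show ?thesis using hitting_step[OF cont h, of k u] by fastforce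
    qed (use hitting_infinite in blast)
  qed (simp add: zero_ereal_def)
  then show ?thesis using fin inf by blast
qed

lemma hitting_Suc: "hitting_times h b k \<le> hitting_times h b (Suc k)"
proof (cases k rule: hitting_cases)
  case (fin u) then show ?thesis using hitting_step[OF cont h fin] by auto
next
  case inf then show ?thesis by (simp only: hitting_infinite)
qed

lemma hitting_mono: "i \<le> j \<Longrightarrow> hitting_times h b i \<le> hitting_times h b j"
  by (rule lift_Suc_mono_le[of "hitting_times h b"]) (use hitting_Suc in auto)

lemma hitting_nonneg: "0 \<le> hitting_times h b k"
  by (cases k rule: hitting_cases) auto

lemma capped_mono: "x \<le> y \<Longrightarrow> capped t x \<le> capped t y" if "0 \<le> x" for x y :: ereal
  using that by (cases x; cases y) auto

lemma capped_hitting_mono: "i \<le> j \<Longrightarrow> capped t (hitting_times h b i) \<le> capped t (hitting_times h b j)"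
  by (intro capped_mono hitting_mono hitting_nonneg)

lemma capped_hitting_range: "0 \<le> t \<Longrightarrow> 0 \<le> capped t (hitting_times h b i) \<and> capped t (hitting_times h b i) \<le> t"
  by (cases i rule: hitting_cases) auto

lemma incr_before_hitting:
  assumes "hitting_times h b k \<le> ereal t" "ereal t \<le> hitting_times h b (Suc k)"
  shows "\<bar>b t - b (real_of_ereal (hitting_times h b k))\<bar> \<le> h"
proof (cases k rule: hitting_cases)
  case (fin u)
  show ?thesis using hitting_step[OF cont h fin] assms fin
    by (auto simp: less_le)
next
  case inf then show ?thesis using assms by simp
qed

lemma capped_hitting_incr:
  assumes "0 \<le> t"
  shows "\<bar>b (capped t (hitting_times h b (Suc k))) - b (capped t (hitting_times h b k))\<bar> \<le> h"
    and "hitting_times h b (Suc k) \<le> ereal t \<Longrightarrow>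
      \<bar>b (capped t (hitting_times h b (Suc k))) - b (capped t (hitting_times h b k))\<bar> = h"
proof -
  have "\<bar>b (capped t (hitting_times h b (Suc k))) - b (capped t (hitting_times h b k))\<bar> \<le> h \<and>
     (hitting_times h b (Suc k) \<le> ereal t \<longrightarrow>
      \<bar>b (capped t (hitting_times h b (Suc k))) - b (capped t (hitting_times h b k))\<bar> = h)"
  proof (cases k rule: hitting_cases)
    case inf
    then show ?thesis using hitting_infinite[OF inf] h by (simp del: hitting_times.simps)
  next
    case (fin u)
    show ?thesis
      using hitting_step[OF cont h fin]
    proof (elim disjE exE conjE)
      fix v assume v: "u < v" "hitting_times h b (Suc k) = ereal v" "\<bar>b v - b u\<bar> = h" "\<forall>t\<in>{u..<v}. \<bar>b t - b u\<bar> < h"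
      show ?thesis
      proof (cases "v \<le> t")
        case True then show ?thesis using v fin by (simp del: hitting_times.simps add: min_absorb2)
      next
        case False
        then have "\<bar>b t - b (min t u)\<bar> \<le> h"
          using v(4) h by (cases "u \<le> t") (auto simp: min_absorb1 min_absorb2 intro: less_imp_le)
        then show ?thesis using False v fin by (simp del: hitting_times.simps add: min_absorb1)
      qed
    next
      assume v: "hitting_times h b (Suc k) = \<infinity>" "\<forall>t\<ge>u. \<bar>b t - b u\<bar> < h"
      have "\<bar>b t - b (min t u)\<bar> \<le> h"
        using v(2) h by (cases "u \<le> t") (auto simp: min_absorb1 min_absorb2 intro: less_imp_le)
      then show ?thesis using v fin by (simp del: hitting_times.simps)
    qed
  qed
  then show "\<bar>b (capped t (hitting_times h b (Suc k))) - b (capped t (hitting_times h b k))\<bar> \<le> h"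
    and "hitting_times h b (Suc k) \<le> ereal t \<Longrightarrow>
      \<bar>b (capped t (hitting_times h b (Suc k))) - b (capped t (hitting_times h b k))\<bar> = h" by auto
qed

text \<open>A path that never again moves by \<open>h\<close> stays within distance \<open>h\<close> of its last hitting level, and is
therefore bounded.\<close>

lemma hitting_finite_if_unbounded:
  assumes unb: "\<And>R. \<exists>t\<ge>0. R < \<bar>b t\<bar>"
  shows "\<exists>u\<ge>0. hitting_times h b k = ereal u"
proof (induction k)
  case (Suc k)
  then obtain u where u: "hitting_times h b k = ereal u" "0 \<le> u" by auto
  have "compact (b ` {0..u})"
    by (intro compact_continuous_image continuous_on_subset[OF cont]) auto
  then obtain R where R: "\<forall>x\<in>b ` {0..u}. \<bar>x\<bar> \<le> R"
    by (meson compact_imp_bounded bounded_real)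
  obtain t where t: "t \<ge> 0" "R + h + \<bar>b u\<bar> < \<bar>b t\<bar>" using unb by blast
  have R0: "0 \<le> R" using R u by (meson abs_ge_zero atLeastAtMost_iff image_eqI order.refl order.trans)
  have tu: "u \<le> t"
  proof (rule ccontr)
    assume "\<not> u \<le> t"
    then have "b t \<in> b ` {0..u}" using t by auto
    then have "\<bar>b t\<bar> \<le> R" using R by blast
    then show False using t h by linarith
  qed
  have "\<not> (\<forall>t\<ge>u. \<bar>b t - b u\<bar> < h)"
  proof
    assume "\<forall>t\<ge>u. \<bar>b t - b u\<bar> < h"
    then have "\<bar>b t - b u\<bar> < h" using tu by blast
    then show False using t R0 by linarith
  qed
  then show ?case using hitting_step[OF cont h u] u(2) by fastforce
qed (simp add: zero_ereal_def)

text \<open>Whether the next hit occurs by time \<open>s\<close> can be read off a supremum over fixed times, once the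
path is considered from the previous hit on. This is the induction step for the measurability of
hitting times; the interval is written \<open>{0..0 + s}\<close> to match \<open>grid_max_tendsto_SUP\<close>.\<close>

lemma hitting_Suc_le_iff:
  fixes k :: nat assumes s: "0 \<le> s"
  defines "\<psi> \<equiv> capped s (hitting_times h b k)"
  shows "hitting_times h b (Suc k) \<le> ereal s \<longleftrightarrow>
    hitting_times h b k \<le> ereal s \<and> h \<le> (SUP u\<in>{0..0 + s}. \<bar>b (max u \<psi>) - b \<psi>\<bar>)"
proof -
  let ?g = "\<lambda>u. \<bar>b (max u \<psi>) - b \<psi>\<bar>"
  have psi: "0 \<le> \<psi>" "\<psi> \<le> s" unfolding \<psi>_def using capped_hitting_range[OF s] by auto
  have cg: "continuous_on {0..0 + s} ?g"
    using psi by (intro continuous_intros continuous_on_compose2[OF cont]) auto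
  obtain w where w: "w \<in> {0..0 + s}" "\<And>u. u \<in> {0..0 + s} \<Longrightarrow> ?g u \<le> ?g w"
    using continuous_attains_sup[OF compact_Icc _ cg] s by auto
  have sup: "(SUP u\<in>{0..0 + s}. ?g u) = ?g w" using w by (intro cSup_eq_maximum) auto
  show ?thesis
  proof (cases k rule: hitting_cases)
    case inf
    then show ?thesis using hitting_infinite[OF inf] by (simp del: hitting_times.simps)
  next
    case (fin u)
    show ?thesis
    proof (cases "u \<le> s")
      case False
      then have "\<not> hitting_times h b (Suc k) \<le> ereal s" using hitting_Suc[of k] fin
        by (metis ereal_less_eq(3) order_trans)
      then show ?thesis using False fin by simp
    next
      case True
      then have [simp]: "\<psi> = u" unfolding \<psi>_def using fin by simp
      show ?thesis
        using hitting_step[OF cont h fin]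
      proof (elim disjE exE conjE)
        fix v assume v: "u < v" "hitting_times h b (Suc k) = ereal v" "\<bar>b v - b u\<bar> = h" "\<forall>t\<in>{u..<v}. \<bar>b t - b u\<bar> < h"
        show ?thesis
        proof (cases "v \<le> s")
          case True
          then have "h \<le> ?g w" using w(2)[of v] v fin by simp
          then show ?thesis using sup True v fin by (simp del: hitting_times.simps)
        next
          case False
          then have "?g w < h" using v(4) w(1) \<open>u \<le> s\<close> by simp
          then show ?thesis using sup False v fin by (simp del: hitting_times.simps)
        qed
      next
        assume v: "hitting_times h b (Suc k) = \<infinity>" "\<forall>t\<ge>u. \<bar>b t - b u\<bar> < h"
        then have "?g w < h" by simp
        then show ?thesis using sup v(1) fin by (simp add: not_le del: hitting_times.simps)
      qed
    qed
  qed
qed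

end

text \<open>The value at a random time is the limit of the values at its dyadic approximations, which take
finitely many values each.\<close>

lemma eval_at_measurable:
  fixes b :: "real \<Rightarrow> 'a \<Rightarrow> real"
  assumes m: "\<And>s. 0 \<le> s \<Longrightarrow> s \<le> t \<Longrightarrow> b s \<in> borel_measurable N"
    and cont: "\<And>\<omega>. \<omega> \<in> space N \<Longrightarrow> continuous_on {0..} (\<lambda>s. b s \<omega>)"
    and tau: "\<tau> \<in> borel_measurable N" "\<And>\<omega>. \<omega> \<in> space N \<Longrightarrow> 0 \<le> \<tau> \<omega> \<and> \<tau> \<omega> \<le> t" and t: "0 \<le> t"
  shows "(\<lambda>\<omega>. b (\<tau> \<omega>) \<omega>) \<in> borel_measurable N"
proof (rule borel_measurable_LIMSEQ_real)
  fix q :: nat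
  let ?i = "\<lambda>\<omega>. nat \<lfloor>\<tau> \<omega> * 2 ^ q / t\<rfloor>"
  show "(\<lambda>\<omega>. b (real (?i \<omega>) * t / 2 ^ q) \<omega>) \<in> borel_measurable N"
  proof (rule measurable_compose_countable'[where I = "{..2 ^ q}" and g = ?i and f = "\<lambda>i \<omega>. b (real i * t / 2 ^ q) \<omega>"])
    fix i :: nat assume "i \<in> {..2 ^ q}"
    then have "real i \<le> real (2 ^ q)" by (intro of_nat_mono) simp
    then have "real i * t / 2 ^ q \<le> 2 ^ q * t / 2 ^ q"
      using t by (intro divide_right_mono mult_right_mono) auto
    then show "b (real i * t / 2 ^ q) \<in> borel_measurable N"
      using t by (intro m) auto
  next
    have "?i \<in> measurable N (count_space UNIV)" using tau(1) by measurable
    moreover have "?i \<omega> \<in> {..2 ^ q}" if "\<omega> \<in> space N" for \<omega>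
      using dyadic_floor_tendsto(2)[of "\<tau> \<omega>" t q] tau(2)[OF that] by auto
    ultimately show "?i \<in> measurable N (count_space {..2 ^ q})"
      by (subst measurable_count_space_eq2) (auto simp: measurable_count_space_eq2_countable measurable_def)
  qed auto
next
  fix \<omega> assume \<omega>: "\<omega> \<in> space N"
  then have r: "0 \<le> \<tau> \<omega>" "\<tau> \<omega> \<le> t" using tau(2) by auto
  show "(\<lambda>q. b (real (nat \<lfloor>\<tau> \<omega> * 2 ^ q / t\<rfloor>) * t / 2 ^ q) \<omega>) \<longlonglongrightarrow> b (\<tau> \<omega>) \<omega>"
    by (rule continuous_on_tendsto_compose[OF cont[OF \<omega>] dyadic_floor_tendsto(1)[OF r]]) (use r t in auto)
qed

text \<open>Induction on the number of hits. The measure space \<open>N\<close> will be the history up to \<open>t\<close>, so this says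
that hitting times are stopping times and that their truncations at \<open>s\<close> are known at time \<open>s\<close>.\<close>

lemma hitting_event_measurable:
  fixes b :: "real \<Rightarrow> 'a \<Rightarrow> real"
  assumes m: "\<And>s. 0 \<le> s \<Longrightarrow> s \<le> t \<Longrightarrow> b s \<in> borel_measurable N"
    and cont: "\<And>\<omega>. \<omega> \<in> space N \<Longrightarrow> continuous_on {0..} (\<lambda>s. b s \<omega>)" and h: "0 < h"
  shows "0 \<le> s \<Longrightarrow> s \<le> t \<Longrightarrow> {\<omega> \<in> space N. hitting_times h (\<lambda>u. b u \<omega>) k \<le> ereal s} \<in> sets N"
    and "0 \<le> s \<Longrightarrow> s \<le> t \<Longrightarrow> (\<lambda>\<omega>. capped s (hitting_times h (\<lambda>u. b u \<omega>) k)) \<in> borel_measurable N"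
proof -
  let ?H = "\<lambda>k \<omega>. hitting_times h (\<lambda>u. b u \<omega>) k"
  have cap: "(\<lambda>\<omega>. capped s (?H k \<omega>)) \<in> borel_measurable N"
    if s: "0 \<le> s" "s \<le> t" and ev: "\<And>s. 0 \<le> s \<Longrightarrow> s \<le> t \<Longrightarrow> {\<omega> \<in> space N. ?H k \<omega> \<le> ereal s} \<in> sets N" for s k
  proof (rule borel_measurableI_le)
    fix y
    show "{\<omega> \<in> space N. capped s (?H k \<omega>) \<le> y} \<in> sets N"
    proof (cases "0 \<le> y \<and> y < s")
      case True
      have "{\<omega> \<in> space N. capped s (?H k \<omega>) \<le> y} = {\<omega> \<in> space N. ?H k \<omega> \<le> ereal y}"
      proof (intro Collect_cong conj_cong refl)
        fix \<omega> assume "\<omega> \<in> space N"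
        show "capped s (?H k \<omega>) \<le> y \<longleftrightarrow> ?H k \<omega> \<le> ereal y"
          using True by (cases k rule: hitting_cases[OF cont[OF \<open>\<omega> \<in> space N\<close>] h]) auto
      qed
      then show ?thesis using ev[of y] True s by simp
    next
      case False
      then have "{\<omega> \<in> space N. capped s (?H k \<omega>) \<le> y} = {} \<or> {\<omega> \<in> space N. capped s (?H k \<omega>) \<le> y} = space N"
        using capped_hitting_range[OF cont h s(1), of _ k] by fastforce
      then show ?thesis
      proof
        assume e: "{\<omega> \<in> space N. capped s (?H k \<omega>) \<le> y} = {}"
        show ?thesis unfolding e by (rule sets.empty_sets)
      next
        assume e: "{\<omega> \<in> space N. capped s (?H k \<omega>) \<le> y} = space N"
        show ?thesis unfolding e by (rule sets.top)
      qed
    qed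
  qed
  have ev: "0 \<le> s \<Longrightarrow> s \<le> t \<Longrightarrow> {\<omega> \<in> space N. ?H k \<omega> \<le> ereal s} \<in> sets N" for s k
  proof (induction k arbitrary: s)
    case 0
    then have "{\<omega> \<in> space N. ?H 0 \<omega> \<le> ereal s} = space N" by (auto simp: zero_ereal_def)
    then show ?case by simp
  next
    case (Suc k)
    note s = Suc.prems
    have capm: "(\<lambda>\<omega>. capped s (?H k \<omega>)) \<in> borel_measurable N" by (rule cap[OF s Suc.IH])
    let ?\<psi> = "\<lambda>\<omega>. capped s (?H k \<omega>)"
    have r: "0 \<le> ?\<psi> \<omega> \<and> ?\<psi> \<omega> \<le> s" if "\<omega> \<in> space N" for \<omega>
      using capped_hitting_range[OF cont[OF that] h s(1), of k] .
    let ?S = "\<lambda>\<omega>. SUP u\<in>{0..0 + s}. \<bar>b (max u (?\<psi> \<omega>)) \<omega> - b (?\<psi> \<omega>) \<omega>\<bar>"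
    have Sm: "?S \<in> borel_measurable N"
    proof (rule borel_measurable_LIMSEQ_real)
      fix \<omega> assume \<omega>: "\<omega> \<in> space N"
      have "continuous_on {0..0 + s} (\<lambda>u. \<bar>b (max u (?\<psi> \<omega>)) \<omega> - b (?\<psi> \<omega>) \<omega>\<bar>)"
        using r[OF \<omega>] by (intro continuous_intros continuous_on_compose2[OF cont[OF \<omega>]]) auto
      from grid_max_tendsto_SUP[OF this s(1)]
      show "(\<lambda>m. MAX i\<in>{..2 ^ m}. \<bar>b (max (0 + real i * s / 2 ^ m) (?\<psi> \<omega>)) \<omega> - b (?\<psi> \<omega>) \<omega>\<bar>) \<longlonglongrightarrow> ?S \<omega>" .
    next
      fix m' :: nat
      show "(\<lambda>\<omega>. MAX i\<in>{..2 ^ m'}. \<bar>b (max (0 + real i * s / 2 ^ m') (?\<psi> \<omega>)) \<omega> - b (?\<psi> \<omega>) \<omega>\<bar>) \<in> borel_measurable N"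
      proof (rule borel_measurable_Max)
        fix i :: nat assume "i \<in> {..2 ^ m'}"
        then have "real i \<le> real (2 ^ m')" by (intro of_nat_mono) simp
        then have "real i * s / 2 ^ m' \<le> 2 ^ m' * s / 2 ^ m'"
          using s by (intro divide_right_mono mult_right_mono) auto
        then have i: "0 + real i * s / 2 ^ m' \<le> s" by simp
        have 1: "(\<lambda>\<omega>. b (max (0 + real i * s / 2 ^ m') (?\<psi> \<omega>)) \<omega>) \<in> borel_measurable N"
        proof (rule eval_at_measurable[where t = s and b = b and \<tau> = "\<lambda>\<omega>. max (0 + real i * s / 2 ^ m') (?\<psi> \<omega>)"])
          show "(\<lambda>\<omega>. max (0 + real i * s / 2 ^ m') (?\<psi> \<omega>)) \<in> borel_measurable N"
            by (intro borel_measurable_max borel_measurable_const capm)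
        qed (use m cont s i r in \<open>auto simp: le_max_iff_disj\<close>)
        have 2: "(\<lambda>\<omega>. b (?\<psi> \<omega>) \<omega>) \<in> borel_measurable N"
          by (rule eval_at_measurable[where t = s and b = b and \<tau> = ?\<psi>]) (use m cont s r capm in auto)
        show "(\<lambda>\<omega>. \<bar>b (max (0 + real i * s / 2 ^ m') (?\<psi> \<omega>)) \<omega> - b (?\<psi> \<omega>) \<omega>\<bar>) \<in> borel_measurable N"
          by (intro borel_measurable_abs borel_measurable_diff 1 2)
      qed auto
    qed
    have "{\<omega> \<in> space N. ?H (Suc k) \<omega> \<le> ereal s} = {\<omega> \<in> space N. ?H k \<omega> \<le> ereal s} \<inter> {\<omega> \<in> space N. h \<le> ?S \<omega>}"
      using hitting_Suc_le_iff[OF cont h s(1)] by blast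
    also have "\<dots> \<in> sets N"
      by (intro sets.Int Suc.IH s borel_measurable_le borel_measurable_const Sm)
    finally show ?case .
  qed
  show "0 \<le> s \<Longrightarrow> s \<le> t \<Longrightarrow> {\<omega> \<in> space N. ?H k \<omega> \<le> ereal s} \<in> sets N" by (rule ev)
  show "0 \<le> s \<Longrightarrow> s \<le> t \<Longrightarrow> (\<lambda>\<omega>. capped s (?H k \<omega>)) \<in> borel_measurable N" by (rule cap[OF _ _ ev])
qed

section \<open>Hitting times and quadratic variation\<close>

text \<open>The three quantities in terms of which the shortfall along a path is bounded: \<open>R\<close> for the size of the
driving path, \<open>d\<close> for the distance of the hitting times from the grid, including one grid step,
and \<open>w\<close> for the oscillation of the path at scale \<open>d\<close>.\<close>

definition path_control ::
  "real \<Rightarrow> real \<Rightarrow> (real \<Rightarrow> 'a \<Rightarrow> real) \<Rightarrow> nat \<Rightarrow> 'a \<Rightarrow> real \<Rightarrow> real \<Rightarrow> real \<Rightarrow> bool" where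
  "path_control T \<kappa> B n \<omega> R d w \<longleftrightarrow> 0 \<le> R \<and> 0 \<le> d \<and> 0 \<le> w \<and>
     (\<forall>t\<in>{0..T}. \<bar>bstar \<kappa> B \<omega> t\<bar> \<le> R) \<and>
     (\<forall>k\<le>n. \<bar>capped T (embed_time T \<kappa> B n k \<omega>) - real k * T / n\<bar> + T / n \<le> d) \<and>
     (\<forall>s\<in>{0..T}. \<forall>t\<in>{0..T}. \<bar>s - t\<bar> \<le> d \<longrightarrow> \<bar>bstar \<kappa> B \<omega> s - bstar \<kappa> B \<omega> t\<bar> \<le> w)"


lemma grid_ceiling:
  fixes u T :: real
  assumes u: "0 \<le> u" "u \<le> T" and T: "0 < T"
  defines "c \<equiv> \<lambda>m::nat. nat \<lceil>u * 2 ^ m / T\<rceil>"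
  shows "c m \<le> 2 ^ m" and "u \<le> real j * T / 2 ^ m \<longleftrightarrow> c m \<le> j"
    and "(\<lambda>m. real (c m) * T / 2 ^ m) \<longlonglongrightarrow> u"
proof -
  have nn: "0 \<le> u * 2 ^ m / T" for m using u T by simp
  have iff: "u \<le> real j * T / 2 ^ m \<longleftrightarrow> c m \<le> j" for m j
  proof -
    have "u \<le> real j * T / 2 ^ m \<longleftrightarrow> u * 2 ^ m / T \<le> real j" using T by (simp add: field_simps)
    also have "\<dots> \<longleftrightarrow> \<lceil>u * 2 ^ m / T\<rceil> \<le> int j" by (simp add: ceiling_le_iff)
    also have "\<dots> \<longleftrightarrow> c m \<le> j" unfolding c_def by (simp add: nat_le_iff)
    finally show ?thesis .
  qed
  show "u \<le> real j * T / 2 ^ m \<longleftrightarrow> c m \<le> j" by (rule iff)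
  have "u \<le> real (2 ^ m) * T / 2 ^ m" using u by simp
  then show "c m \<le> 2 ^ m" unfolding iff .
  have lo: "u \<le> real (c m) * T / 2 ^ m" for m unfolding iff by simp
  have up: "real (c m) * T / 2 ^ m \<le> u + T / 2 ^ m" for m
  proof -
    have "real (c m) \<le> u * 2 ^ m / T + 1"
      using nn[of m] unfolding c_def by linarith
    then have "real (c m) * (T / 2 ^ m) \<le> (u * 2 ^ m / T + 1) * (T / 2 ^ m)"
      using T by (intro mult_right_mono) auto
    also have "\<dots> = u + T / 2 ^ m" using T by (simp add: field_simps)
    finally show ?thesis by simp
  qed
  have "(\<lambda>m. u + T * (1/2) ^ m) \<longlonglongrightarrow> u + T * 0"
    by (intro tendsto_intros LIMSEQ_power_zero) auto
  then have l: "(\<lambda>m. u + T / 2 ^ m) \<longlonglongrightarrow> u" by (simp add: power_one_over)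
  show "(\<lambda>m. real (c m) * T / 2 ^ m) \<longlonglongrightarrow> u"
    by (rule tendsto_sandwich[OF _ _ tendsto_const l]) (use lo up in auto)
qed

text \<open>On a grid, the increments between two times telescope to the difference of the values at their
upward roundings.\<close>

lemma grid_telescope_tendsto:
  fixes f :: "real \<Rightarrow> real"
  assumes f: "continuous_on {0..} f" and T: "0 < T" and uv: "0 \<le> u" "u \<le> v" "v \<le> T"
  shows "(\<lambda>m. \<Sum>j<2 ^ m. if u \<le> real j * T / 2 ^ m \<and> real j * T / 2 ^ m < v
      then f (real (Suc j) * T / 2 ^ m) - f (real j * T / 2 ^ m) else 0) \<longlonglongrightarrow> f v - f u"
proof -
  define c where "c w m = nat \<lceil>w * 2 ^ m / T\<rceil>" for w and m :: nat
  have u: "0 \<le> u" "u \<le> T" and v: "0 \<le> v" "v \<le> T" using uv by auto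
  note cu = grid_ceiling[OF u T, folded c_def] and cv = grid_ceiling[OF v T, folded c_def]
  have eq: "(\<Sum>j<2 ^ m. if u \<le> real j * T / 2 ^ m \<and> real j * T / 2 ^ m < v
      then f (real (Suc j) * T / 2 ^ m) - f (real j * T / 2 ^ m) else 0)
    = f (real (c v m) * T / 2 ^ m) - f (real (c u m) * T / 2 ^ m)" for m
  proof -
    have le: "c u m \<le> c v m"
    proof -
      have "v \<le> real (c v m) * T / 2 ^ m" using cv(2)[of "c v m" m] by simp
      then have "u \<le> real (c v m) * T / 2 ^ m" using uv by linarith
      then show ?thesis using cu(2) by simp
    qed
    have "(\<Sum>j<2 ^ m. if u \<le> real j * T / 2 ^ m \<and> real j * T / 2 ^ m < v
      then f (real (Suc j) * T / 2 ^ m) - f (real j * T / 2 ^ m) else 0)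
     = (\<Sum>j\<in>{c u m..<c v m}. f (real (Suc j) * T / 2 ^ m) - f (real j * T / 2 ^ m))"
    proof (rule sum.mono_neutral_cong_right)
      show "{c u m..<c v m} \<subseteq> {..<2 ^ m}" using cv(1)[of m] by auto
      have iff: "(u \<le> real j * T / 2 ^ m \<and> real j * T / 2 ^ m < v) \<longleftrightarrow> j \<in> {c u m..<c v m}" for j
        using cu(2)[of j m] cv(2)[of j m] by auto
      show "\<forall>j\<in>{..<2 ^ m} - {c u m..<c v m}.
          (if u \<le> real j * T / 2 ^ m \<and> real j * T / 2 ^ m < v
           then f (real (Suc j) * T / 2 ^ m) - f (real j * T / 2 ^ m) else 0) = 0"
        unfolding iff by auto
      show "(if u \<le> real j * T / 2 ^ m \<and> real j * T / 2 ^ m < v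
           then f (real (Suc j) * T / 2 ^ m) - f (real j * T / 2 ^ m) else 0)
           = f (real (Suc j) * T / 2 ^ m) - f (real j * T / 2 ^ m)" if "j \<in> {c u m..<c v m}" for j
        unfolding iff using that by simp
    qed auto
    also have "\<dots> = f (real (c v m) * T / 2 ^ m) - f (real (c u m) * T / 2 ^ m)"
      using sum_Suc_diff'[OF le, of "\<lambda>j. f (real j * T / 2 ^ m)"] .
    finally show ?thesis .
  qed
  have "(\<lambda>m. f (real (c w m) * T / 2 ^ m)) \<longlonglongrightarrow> f w" if w: "0 \<le> w" "w \<le> T" for w
    by (rule continuous_on_tendsto_compose[OF f grid_ceiling(3)[OF w T, folded c_def]]) (use w T in auto)
  then show ?thesis unfolding eq using u v by (intro tendsto_diff) auto
qed

lemma (in prob_space) nn_integral_exp_fatou: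
  fixes f :: "nat \<Rightarrow> 'a \<Rightarrow> real" and c :: "nat \<Rightarrow> real"
  assumes f: "\<And>m. f m \<in> borel_measurable M"
    and lim: "\<And>\<omega>. \<omega> \<in> space M \<Longrightarrow> (\<lambda>m. f m \<omega>) \<longlonglongrightarrow> g \<omega>"
    and bd: "eventually (\<lambda>m. (\<integral>\<^sup>+\<omega>. ennreal (exp (f m \<omega>)) \<partial>M) \<le> ennreal (exp (c m))) sequentially"
    and c: "c \<longlonglongrightarrow> d"
  shows "(\<integral>\<^sup>+\<omega>. ennreal (exp (g \<omega>)) \<partial>M) \<le> ennreal (exp d)"
proof -
  have "(\<integral>\<^sup>+\<omega>. ennreal (exp (g \<omega>)) \<partial>M) = (\<integral>\<^sup>+\<omega>. liminf (\<lambda>m. ennreal (exp (f m \<omega>))) \<partial>M)"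
  proof (rule nn_integral_cong)
    fix \<omega> assume "\<omega> \<in> space M"
    then have "(\<lambda>m. ennreal (exp (f m \<omega>))) \<longlonglongrightarrow> ennreal (exp (g \<omega>))"
      by (intro tendsto_ennrealI tendsto_intros lim)
    from lim_imp_Liminf[OF _ this] show "ennreal (exp (g \<omega>)) = liminf (\<lambda>m. ennreal (exp (f m \<omega>)))" by simp
  qed
  also have "\<dots> \<le> liminf (\<lambda>m. \<integral>\<^sup>+\<omega>. ennreal (exp (f m \<omega>)) \<partial>M)"
    using f by (intro nn_integral_liminf) measurable
  also have "\<dots> \<le> liminf (\<lambda>m. ennreal (exp (c m)))" by (rule Liminf_mono[OF bd])
  also have "\<dots> = ennreal (exp d)"
    by (intro lim_imp_Liminf tendsto_ennrealI tendsto_intros c) simp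
  finally show ?thesis .
qed

context continuous_bm begin

lemma bstar_cont: "\<omega> \<in> space M \<Longrightarrow> continuous_on {0..} (bstar \<kappa> W \<omega>)"
  unfolding bstar_def by (intro continuous_intros W_cont)

lemma bstar_history: "0 \<le> s \<Longrightarrow> s \<le> t \<Longrightarrow> (\<lambda>\<omega>. bstar \<kappa> W \<omega> s) \<in> borel_measurable (history t)"
  unfolding bstar_def by (intro borel_measurable_diff borel_measurable_const W_history)

definition capped_hit :: "real \<Rightarrow> real \<Rightarrow> nat \<Rightarrow> real \<Rightarrow> 'a \<Rightarrow> real" where
  "capped_hit \<kappa> h k t \<omega> = capped t (hitting_times h (bstar \<kappa> W \<omega>) k)"

text \<open>The difference between the sum of squared increments up to the \<open>K\<close>-th hitting time and that time
itself, everything being stopped at \<open>T\<close>.\<close>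

definition qv_error :: "real \<Rightarrow> real \<Rightarrow> real \<Rightarrow> nat \<Rightarrow> 'a \<Rightarrow> real" where
  "qv_error \<kappa> h T K \<omega> =
     (\<Sum>k<K. (bstar \<kappa> W \<omega> (capped_hit \<kappa> h (Suc k) T \<omega>) - bstar \<kappa> W \<omega> (capped_hit \<kappa> h k T \<omega>))\<^sup>2) - capped_hit \<kappa> h K T \<omega>"

lemma capped_hit_history:
  assumes "0 < h" "0 \<le> t"
  shows "capped_hit \<kappa> h k t \<in> borel_measurable (history t)"
    and "(\<lambda>\<omega>. bstar \<kappa> W \<omega> (capped_hit \<kappa> h k t \<omega>)) \<in> borel_measurable (history t)"
    and "{\<omega> \<in> space M. hitting_times h (bstar \<kappa> W \<omega>) k \<le> ereal t} \<in> sets (history t)"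
proof -
  have c: "continuous_on {0..} (\<lambda>s. bstar \<kappa> W \<omega> s)" if "\<omega> \<in> space (history t)" for \<omega>
    using bstar_cont that by simp
  note ev = hitting_event_measurable[where t = t and N = "history t" and b = "\<lambda>s \<omega>. bstar \<kappa> W \<omega> s",
      OF bstar_history c assms(1), of t k]
  show 1: "capped_hit \<kappa> h k t \<in> borel_measurable (history t)"
    using ev(2) assms unfolding capped_hit_def by simp
  show "{\<omega> \<in> space M. hitting_times h (bstar \<kappa> W \<omega>) k \<le> ereal t} \<in> sets (history t)"
    using ev(1) assms by simp
  show "(\<lambda>\<omega>. bstar \<kappa> W \<omega> (capped_hit \<kappa> h k t \<omega>)) \<in> borel_measurable (history t)"
  proof (rule eval_at_measurable[where b = "\<lambda>s \<omega>. bstar \<kappa> W \<omega> s" and t = t and \<tau> = "capped_hit \<kappa> h k t"])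
    show "0 \<le> capped_hit \<kappa> h k t \<omega> \<and> capped_hit \<kappa> h k t \<omega> \<le> t" if "\<omega> \<in> space (history t)" for \<omega>
      unfolding capped_hit_def using capped_hitting_range[OF c[OF that] assms] .
  qed (use bstar_history c 1 assms in auto)
qed

lemma qv_error_measurable: "0 < h \<Longrightarrow> 0 \<le> T \<Longrightarrow> qv_error \<kappa> h T K \<in> borel_measurable M"
  unfolding qv_error_def
  by (intro borel_measurable_diff borel_measurable_sum borel_measurable_power history_measurable_M[OF capped_hit_history(1)]
      history_measurable_M[OF capped_hit_history(2)])

text \<open>Along a grid, the increments of \<open>(b - b (\<theta>\<^sub>k))\<^sup>2 - t\<close> between \<open>\<theta>\<^sub>k\<close> and \<open>\<theta>\<^sub>k\<^sub>+\<^sub>1\<close> telescope, up to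
rounding, to the \<open>k\<close>-th squared increment minus the time elapsed. Each grid step belongs to at most
one \<open>k\<close>, and there the distance from the last hitting level is at most \<open>h\<close>; so
\<open>exp_sum_bound\<close> applies with the Gaussian bound of a single step, and the remainder terms disappear
in the limit.\<close>

lemma qv_error_exp_moment:
  assumes h: "0 < h" and T: "0 < T" and k: "0 \<le> \<kappa>"
  shows "(\<integral>\<^sup>+\<omega>. ennreal (exp (\<rho> * qv_error \<kappa> h T K \<omega>)) \<partial>M)
    \<le> ennreal (exp (T * (8 * \<rho>\<^sup>2 * h\<^sup>2 + \<bar>\<rho>\<bar> * h * \<kappa>)))"
proof -
  define t where "t m j = real j * T / 2 ^ m" for m j :: nat
  define \<delta> where "\<delta> m = T / 2 ^ m" for m :: nat
  define H where "H k' \<omega> = hitting_times h (bstar \<kappa> W \<omega>) k'" for k' \<omega>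
  define act where "act m j k' \<omega> \<longleftrightarrow> H k' \<omega> \<le> ereal (t m j) \<and> ereal (t m j) < H (Suc k') \<omega>" for m j k' \<omega>
  define c where "c m j k' \<omega> = bstar \<kappa> W \<omega> (t m j) - bstar \<kappa> W \<omega> (capped_hit \<kappa> h k' (t m j) \<omega>)" for m j k' \<omega>
  define v where "v m a x = \<rho> * ((a + (x - \<kappa> / 2 * \<delta> m))\<^sup>2 - a\<^sup>2 - \<delta> m)" for m a x
  define V where "V m j \<omega> x = (\<Sum>k'<K. if act m j k' \<omega> then v m (c m j k' \<omega>) x else 0)" for m j \<omega> x
  define \<beta> where "\<beta> m = \<delta> m * (8 * \<rho>\<^sup>2 * h\<^sup>2 + \<bar>\<rho>\<bar> * h * \<kappa> + \<delta> m * (4 * \<rho>\<^sup>2 + 2 * \<rho>\<^sup>2 * \<kappa>\<^sup>2 * \<delta> m + \<bar>\<rho>\<bar> * \<kappa>\<^sup>2 / 4))" for m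
  have tpos: "0 \<le> t m j" for m j unfolding t_def using T by simp
  have dpos: "0 < \<delta> m" for m unfolding \<delta>_def using T by simp
  have tdiff: "t m (Suc j) - t m j = \<delta> m" for m j
    unfolding t_def \<delta>_def of_nat_Suc distrib_right add_divide_distrib by simp
  have bpos: "0 \<le> \<beta> m" for m
    unfolding \<beta>_def using dpos[of m] h k by (intro mult_nonneg_nonneg add_nonneg_nonneg) auto
  have act_set: "{\<omega> \<in> space M. act m j k' \<omega>} \<in> sets (history (t m j))" for m j k'
  proof -
    have "{\<omega> \<in> space M. act m j k' \<omega>} = {\<omega> \<in> space M. H k' \<omega> \<le> ereal (t m j)} -
        {\<omega> \<in> space M. H (Suc k') \<omega> \<le> ereal (t m j)}"
      unfolding act_def by (auto simp: not_le)
    also have "\<dots> \<in> sets (history (t m j))" unfolding H_def by (intro sets.Diff capped_hit_history(3) h tpos)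
    finally show ?thesis .
  qed
  have V_meas: "(\<lambda>(\<omega>, x). V m j \<omega> x) \<in> borel_measurable (history (t m j) \<Otimes>\<^sub>M borel)" for m j
  proof -
    have cm: "c m j k' \<in> borel_measurable (history (t m j))" for k'
      unfolding c_def using tpos by (intro borel_measurable_diff bstar_history capped_hit_history h) auto
    have "(\<lambda>p. \<Sum>k'<K. indicator {\<omega> \<in> space M. act m j k' \<omega>} (fst p) * v m (c m j k' (fst p)) (snd p) :: real)
        \<in> borel_measurable (history (t m j) \<Otimes>\<^sub>M borel)"
      unfolding v_def
      by (intro borel_measurable_sum borel_measurable_times borel_measurable_diff borel_measurable_add
        borel_measurable_power borel_measurable_const measurable_snd
        measurable_compose[OF measurable_fst cm]
        measurable_compose[OF measurable_fst borel_measurable_indicator[OF act_set]])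
    moreover have "(\<Sum>k'<K. indicator {\<omega> \<in> space M. act m j k' \<omega>} (fst p) * v m (c m j k' (fst p)) (snd p)) = (\<lambda>(\<omega>, x). V m j \<omega> x) p"
      if "p \<in> space (history (t m j) \<Otimes>\<^sub>M borel)" for p
    proof -
      have ind: "indicator {\<omega> \<in> space M. act m j k' \<omega>} (fst p) * y = (if act m j k' (fst p) then y else 0)"
        for k' and y :: real
        using that by (auto simp: space_pair_measure indicator_def)
      show ?thesis unfolding V_def split_beta ind by (rule refl)
    qed
    ultimately show ?thesis by (rule measurable_cong[THEN iffD1, rotated])
  qed
  \<comment> \<open>The intervals between consecutive hits are disjoint.\<close>
  have act_unique: "k1 = k2" if "\<omega> \<in> space M" "act m j k1 \<omega>" "act m j k2 \<omega>" for m j k1 k2 \<omega>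
  proof -
    have no: False if "k1 < k2" "act m j k1 \<omega>" "act m j k2 \<omega>" for k1 k2
    proof -
      have "H (Suc k1) \<omega> \<le> H k2 \<omega>"
        unfolding H_def using that(1) by (intro hitting_mono[OF bstar_cont[OF \<open>\<omega> \<in> space M\<close>] h]) simp
      also have "H k2 \<omega> \<le> ereal (t m j)" using that(3) unfolding act_def by blast
      also have "ereal (t m j) < H (Suc k1) \<omega>" using that(2) unfolding act_def by blast
      finally show False by blast
    qed
    show ?thesis
      by (rule linorder_cases[of k1 k2]) (use no that in blast)+
  qed
  have c_bound: "\<bar>c m j k' \<omega>\<bar> \<le> h" if "\<omega> \<in> space M" "act m j k' \<omega>" for m j k' \<omega>
  proof (cases k' rule: hitting_cases[OF bstar_cont[OF that(1), of \<kappa>] h, case_names fin inf])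
    case (fin u)
    have "\<bar>bstar \<kappa> W \<omega> (t m j) - bstar \<kappa> W \<omega> (real_of_ereal (hitting_times h (bstar \<kappa> W \<omega>) k'))\<bar> \<le> h"
      using that unfolding act_def H_def
      by (intro incr_before_hitting[OF bstar_cont[OF that(1)] h]) auto
    then show ?thesis using fin that unfolding c_def capped_hit_def act_def H_def by (simp add: min_absorb2)
  next
    case inf then show ?thesis using that unfolding act_def H_def by simp
  qed
  have bd: "(\<integral>\<^sup>+x. ennreal (normal_density 0 (sqrt (t m (Suc j) - t m j)) x) * ennreal (exp (V m j \<omega> x)) \<partial>lborel)
        \<le> ennreal (exp (\<beta> m))" if \<omega>: "\<omega> \<in> space M" and m: "\<bar>\<rho>\<bar> * \<delta> m \<le> 1 / 4" for m j \<omega>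
  proof (cases "\<exists>k'<K. act m j k' \<omega>")
    case True
    then obtain k0 where k0: "k0 < K" "act m j k0 \<omega>" by auto
    have "V m j \<omega> x = v m (c m j k0 \<omega>) x" for x
    proof -
      have "V m j \<omega> x = (\<Sum>k'<K. if k' = k0 then v m (c m j k0 \<omega>) x else 0)"
        unfolding V_def
      proof (intro sum.cong refl)
        fix k'
        show "(if act m j k' \<omega> then v m (c m j k' \<omega>) x else 0) = (if k' = k0 then v m (c m j k0 \<omega>) x else 0)"
        proof (cases "k' = k0")
          case True
          then show ?thesis using k0(2) by simp
        next
          case False
          then have "\<not> act m j k' \<omega>" using act_unique[OF \<omega> _ k0(2)] by blast
          then show ?thesis using False by simp
        qed
      qed
      also have "\<dots> = v m (c m j k0 \<omega>) x" using k0(1) by (simp add: sum.delta)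
      finally show ?thesis .
    qed
    then show ?thesis unfolding tdiff v_def \<beta>_def
      using nn_integral_gaussian_exp_square_increment[OF dpos m c_bound[OF \<omega> k0(2)] k] by simp
  next
    case False
    have "V m j \<omega> x = 0 * x" for x
    proof -
      have "V m j \<omega> x = (\<Sum>k'<K. 0)" unfolding V_def
        by (intro sum.cong refl if_not_P) (use False in blast)
      then show ?thesis by simp
    qed
    then have "(\<integral>\<^sup>+x. ennreal (normal_density 0 (sqrt (t m (Suc j) - t m j)) x) * ennreal (exp (V m j \<omega> x)) \<partial>lborel) = 1"
      unfolding tdiff using nn_integral_gaussian_exp_linear[OF dpos, of m 0] by simp
    also have "\<dots> \<le> ennreal (exp (\<beta> m))" using bpos[of m] by simp
    finally show ?thesis .
  qed
  let ?E = "\<lambda>m \<omega>. \<Sum>j<2 ^ m. V m j \<omega> (W (t m (Suc j)) \<omega> - W (t m j) \<omega>)"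
  have d0: "\<delta> \<longlonglongrightarrow> 0"
  proof -
    have "(\<lambda>m. T * (1/2) ^ m) \<longlonglongrightarrow> T * 0" by (intro tendsto_intros LIMSEQ_power_zero) auto
    then show ?thesis unfolding \<delta>_def by (simp add: power_one_over)
  qed
  show ?thesis
  proof (rule nn_integral_exp_fatou)
    show "?E m \<in> borel_measurable M" for m
    proof (rule borel_measurable_sum)
      fix j
      show "(\<lambda>\<omega>. V m j \<omega> (W (t m (Suc j)) \<omega> - W (t m j) \<omega>)) \<in> borel_measurable M"
        using tpos[of m j] tdiff[of m j] dpos[of m] by (intro history_measurable_M[OF incr_measurable[OF _ _ V_meas]]) auto
    qed
    have "(\<lambda>m. \<bar>\<rho>\<bar> * \<delta> m) \<longlonglongrightarrow> \<bar>\<rho>\<bar> * 0" by (intro tendsto_intros d0)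
    then have "eventually (\<lambda>m. \<bar>\<rho>\<bar> * \<delta> m < 1 / 4) sequentially"
      by (rule order_tendstoD) simp
    then show "eventually (\<lambda>m. (\<integral>\<^sup>+\<omega>. ennreal (exp (?E m \<omega>)) \<partial>M) \<le> ennreal (exp (2 ^ m * \<beta> m))) sequentially"
    proof eventually_elim
      case (elim m)
      have "(\<integral>\<^sup>+\<omega>. ennreal (exp (?E m \<omega>)) \<partial>M) \<le> ennreal (exp (\<Sum>j<2 ^ m :: nat. \<beta> m))"
      proof (rule exp_sum_bound, goal_cases)
        case 1 show ?case by (rule tpos)
      next
        case (2 j) show ?case using tdiff[of m j] dpos[of m] by linarith
      next
        case (3 j) show ?case by (rule V_meas)
      next
        case (4 j \<omega>) show ?case using 4 elim by (intro bd) auto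
      qed
      then show ?case by simp
    qed
    have "2 ^ m * \<beta> m = T * (8 * \<rho>\<^sup>2 * h\<^sup>2 + \<bar>\<rho>\<bar> * h * \<kappa> + \<delta> m * (4 * \<rho>\<^sup>2 + 2 * \<rho>\<^sup>2 * \<kappa>\<^sup>2 * \<delta> m + \<bar>\<rho>\<bar> * \<kappa>\<^sup>2 / 4))" for m
      unfolding \<beta>_def \<delta>_def[of m] by simp
    moreover have "(\<lambda>m. T * (8 * \<rho>\<^sup>2 * h\<^sup>2 + \<bar>\<rho>\<bar> * h * \<kappa> + \<delta> m * (4 * \<rho>\<^sup>2 + 2 * \<rho>\<^sup>2 * \<kappa>\<^sup>2 * \<delta> m + \<bar>\<rho>\<bar> * \<kappa>\<^sup>2 / 4)))
      \<longlonglongrightarrow> T * (8 * \<rho>\<^sup>2 * h\<^sup>2 + \<bar>\<rho>\<bar> * h * \<kappa> + 0 * (4 * \<rho>\<^sup>2 + 2 * \<rho>\<^sup>2 * \<kappa>\<^sup>2 * 0 + \<bar>\<rho>\<bar> * \<kappa>\<^sup>2 / 4))"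
      by (intro tendsto_intros d0)
    ultimately show "(\<lambda>m. 2 ^ m * \<beta> m) \<longlonglongrightarrow> T * (8 * \<rho>\<^sup>2 * h\<^sup>2 + \<bar>\<rho>\<bar> * h * \<kappa>)" by simp
  next
    fix \<omega> assume \<omega>: "\<omega> \<in> space M"
    let ?b = "bstar \<kappa> W \<omega>"
    note bc = bstar_cont[OF \<omega>, of \<kappa>]
    let ?\<psi> = "\<lambda>k'. capped_hit \<kappa> h k' T \<omega>"
    define f where "f k' s = (?b s - ?b (?\<psi> k'))\<^sup>2 - s" for k' s
    have psi: "0 \<le> ?\<psi> k'" "?\<psi> k' \<le> ?\<psi> (Suc k')" "?\<psi> k' \<le> T" for k'
      using capped_hitting_range[OF bc h, of T k'] capped_hitting_mono[OF bc h, of k' "Suc k'" T] T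
      unfolding capped_hit_def by (simp_all del: hitting_times.simps)
    have act_iff: "act m j k' \<omega> \<longleftrightarrow> ?\<psi> k' \<le> t m j \<and> t m j < ?\<psi> (Suc k')" if "j < 2 ^ m" for m j k'
    proof -
      have "real j < real (2 ^ m)" using that by (rule of_nat_less_iff[THEN iffD2])
      then have "t m j < T" unfolding t_def using T by (simp add: field_simps)
      then have *: "x \<le> ereal (t m j) \<longleftrightarrow> capped T x \<le> t m j" if "0 \<le> x" for x
        using that by (cases x) auto
      have "H i \<omega> \<le> ereal (t m j) \<longleftrightarrow> ?\<psi> i \<le> t m j" for i
        unfolding H_def capped_hit_def by (rule *[OF hitting_nonneg[OF bc h]])
      then show ?thesis unfolding act_def not_le[symmetric] by (simp only:)
    qed
    have v_eq: "v m (c m j k' \<omega>) (W (t m (Suc j)) \<omega> - W (t m j) \<omega>) = \<rho> * (f k' (t m (Suc j)) - f k' (t m j))"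
      if j: "j < 2 ^ m" and a: "act m j k' \<omega>" for m j k'
    proof -
      have "real j < real (2 ^ m)" using that by (intro of_nat_less_iff[THEN iffD2])
      then have tT: "t m j < T" unfolding t_def using T by (simp add: field_simps)
      have eq: "capped_hit \<kappa> h k' (t m j) \<omega> = ?\<psi> k'"
        using a tT unfolding act_def H_def capped_hit_def
        by (cases k' rule: hitting_cases[OF bc h]) (auto simp: min_absorb2)
      have 1: "c m j k' \<omega> = ?b (t m j) - ?b (?\<psi> k')" unfolding c_def eq ..
      have 2: "c m j k' \<omega> + (W (t m (Suc j)) \<omega> - W (t m j) \<omega> - \<kappa> / 2 * \<delta> m) = ?b (t m (Suc j)) - ?b (?\<psi> k')"
        unfolding 1 tdiff[symmetric, of m j] bstar_def by (simp add: algebra_simps)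
      show ?thesis unfolding v_def 2 unfolding 1 f_def tdiff[symmetric, of m j] by (simp add: algebra_simps)
    qed
    define g where "g m k' j = (if ?\<psi> k' \<le> real j * T / 2 ^ m \<and> real j * T / 2 ^ m < ?\<psi> (Suc k')
        then f k' (real (Suc j) * T / 2 ^ m) - f k' (real j * T / 2 ^ m) else 0)" for m k' j
    have summand: "(if act m j k' \<omega> then v m (c m j k' \<omega>) (W (t m (Suc j)) \<omega> - W (t m j) \<omega>) else 0) = \<rho> * g m k' j"
      if j: "j < 2 ^ m" for m j k'
    proof -
      have "g m k' j = (if act m j k' \<omega> then f k' (t m (Suc j)) - f k' (t m j) else 0)"
        unfolding g_def act_iff[OF j] t_def by (rule refl)
      then show ?thesis using v_eq[OF j, of k'] by simp
    qed
    have E_eq: "?E m \<omega> = \<rho> * (\<Sum>k'<K. \<Sum>j<2 ^ m. g m k' j)" for m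
    proof -
      have "?E m \<omega> = (\<Sum>j<2 ^ m. \<Sum>k'<K. \<rho> * g m k' j)"
        unfolding V_def by (intro sum.cong refl summand) simp
      also have "\<dots> = (\<Sum>k'<K. \<Sum>j<2 ^ m. \<rho> * g m k' j)" by (rule sum.swap)
      finally show ?thesis by (simp only: sum_distrib_left)
    qed
    have "(\<lambda>m. ?E m \<omega>) \<longlonglongrightarrow> \<rho> * (\<Sum>k'<K. f k' (?\<psi> (Suc k')) - f k' (?\<psi> k'))"
      unfolding E_eq g_def
    proof (intro tendsto_mult tendsto_const tendsto_sum grid_telescope_tendsto T psi)
      show "continuous_on {0..} (f k')" for k'
        unfolding f_def by (intro continuous_intros bc)
    qed
    also have "(\<Sum>k'<K. f k' (?\<psi> (Suc k')) - f k' (?\<psi> k'))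
      = (\<Sum>k'<K. (?b (?\<psi> (Suc k')) - ?b (?\<psi> k'))\<^sup>2) - (\<Sum>k'<K. ?\<psi> (Suc k') - ?\<psi> k')"
      unfolding f_def by (simp add: sum_subtractf[symmetric] algebra_simps)
    also have "(\<Sum>k'<K. ?\<psi> (Suc k') - ?\<psi> k') = ?\<psi> K - ?\<psi> 0" by (rule sum_lessThan_telescope)
    also have "?\<psi> 0 = 0" unfolding capped_hit_def using T by (simp add: zero_ereal_def)
    finally show "(\<lambda>m. ?E m \<omega>) \<longlonglongrightarrow> \<rho> * qv_error \<kappa> h T K \<omega>"
      unfolding qv_error_def by simp
  qed
qed

text \<open>If the \<open>K\<close>-th hit occurs by time \<open>T\<close>, all squared increments are equal to \<open>h\<^sup>2\<close>. Otherwise the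
stopped time is \<open>T\<close>, which is at least \<open>K * h\<^sup>2\<close>, while the squared increments add up to at most
\<open>K * h\<^sup>2\<close>; so the error can only be larger.\<close>

lemma capped_hit_dev_le_qv_error:
  assumes h: "0 < h" and T: "0 < T" and \<omega>: "\<omega> \<in> space M" and K: "real K * h\<^sup>2 \<le> T"
  shows "\<bar>capped_hit \<kappa> h K T \<omega> - real K * h\<^sup>2\<bar> \<le> \<bar>qv_error \<kappa> h T K \<omega>\<bar>"
proof -
  let ?b = "bstar \<kappa> W \<omega>"
  note bc = bstar_cont[OF \<omega>, of \<kappa>]
  let ?H = "hitting_times h ?b"
  let ?D = "\<lambda>k. (?b (capped_hit \<kappa> h (Suc k) T \<omega>) - ?b (capped_hit \<kappa> h k T \<omega>))\<^sup>2"
  have T0: "0 \<le> T" using T by simp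
  show ?thesis
  proof (cases "?H K \<le> ereal T")
    case True
    have "?D k = h\<^sup>2" if "k < K" for k
    proof -
      have "?H (Suc k) \<le> ?H K" using that by (intro hitting_mono[OF bc h]) simp
      then have "?H (Suc k) \<le> ereal T" using True by (rule order_trans)
      from capped_hitting_incr(2)[OF bc h T0 this]
      show ?thesis unfolding capped_hit_def using power2_abs by metis
    qed
    then show ?thesis unfolding qv_error_def by simp
  next
    case False
    then have psi: "capped_hit \<kappa> h K T \<omega> = T" unfolding capped_hit_def
      by (cases K rule: hitting_cases[OF bc h]) auto
    have "?D k \<le> h\<^sup>2" for k
      using capped_hitting_incr(1)[OF bc h T0, of k] h unfolding capped_hit_def
      by (metis abs_ge_zero power2_abs power_mono)
    then have "(\<Sum>k<K. ?D k) \<le> (\<Sum>k<K. h\<^sup>2)" by (intro sum_mono)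
    then show ?thesis unfolding qv_error_def psi using K by simp
  qed
qed

end

section \<open>The expected embedding error\<close>


lemma inv_sqrt_tendsto: "(\<lambda>i. c / sqrt (2 * pi * real (Suc i))) \<longlonglongrightarrow> 0"
proof (rule tendsto_divide_0[OF tendsto_const], rule filterlim_at_top_imp_at_infinity)
  show "filterlim (\<lambda>i. sqrt (2 * pi * real (Suc i))) at_top sequentially"
    by (intro filterlim_compose[OF sqrt_at_top] filterlim_tendsto_pos_mult_at_top[OF tendsto_const]
      filterlim_compose[OF filterlim_real_sequentially filterlim_Suc]) auto
qed

context continuous_bm begin

text \<open>Times at distance at most the block length lie in the same block or in adjacent ones.\<close>

lemma modulus_le_block_max_dev:
  assumes \<omega>: "\<omega> \<in> space M" and \<eta>: "0 < \<eta>" and N: "real N * \<eta> = T"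
    and z: "\<And>i. i < N \<Longrightarrow> max_dev (real i * \<eta>) \<eta> \<omega> \<le> z"
    and s: "0 \<le> s" "s \<le> t" "t \<le> T" "t - s \<le> \<eta>" and T: "0 < T"
  shows "\<bar>W s \<omega> - W t \<omega>\<bar> \<le> 3 * z"
proof -
  have N0: "0 < N" using N T by (cases N) auto
  have max_dev_le: "\<bar>W r \<omega> - W (real i * \<eta>) \<omega>\<bar> \<le> z" if "i < N" "real i * \<eta> \<le> r" "r \<le> real (Suc i) * \<eta>" for i r
  proof -
    have "r \<in> {real i * \<eta>..real i * \<eta> + \<eta>}" using that by (simp add: algebra_simps)
    from max_dev_ge[OF \<omega> _ this] z[OF that(1)] show ?thesis using \<eta> by simp
  qed
  define i where "i = min (N - 1) (nat \<lfloor>s / \<eta>\<rfloor>)"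
  have i: "i < N" unfolding i_def using N0 by simp
  have sn: "0 \<le> s / \<eta>" using s \<eta> by simp
  have il: "real i * \<eta> \<le> s"
  proof -
    have "real i \<le> s / \<eta>" using sn unfolding i_def by linarith
    then show ?thesis using \<eta> by (simp add: field_simps)
  qed
  have iu: "s \<le> real (Suc i) * \<eta>"
  proof (cases "nat \<lfloor>s / \<eta>\<rfloor> \<le> N - 1")
    case True
    then have "s / \<eta> \<le> real (Suc i)" using sn unfolding i_def by linarith
    then show ?thesis using \<eta> by (simp add: field_simps)
  next
    case False
    then have "Suc i = N" unfolding i_def using N0 by simp
    then show ?thesis using s N by simp
  qed
  have z0: "0 \<le> z" using max_dev_le[OF i order.refl] \<eta> by (simp add: mult_right_mono)
  have 1: "\<bar>W s \<omega> - W (real i * \<eta>) \<omega>\<bar> \<le> z" by (rule max_dev_le[OF i il iu])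
  show ?thesis
  proof (cases "t \<le> real (Suc i) * \<eta>")
    case True
    have "\<bar>W t \<omega> - W (real i * \<eta>) \<omega>\<bar> \<le> z" by (rule max_dev_le[OF i _ True]) (use il s in simp)
    then show ?thesis using 1 z0 by linarith
  next
    case False
    then have "real (Suc i) * \<eta> < real N * \<eta>" using N s by simp
    then have "Suc i < N" using \<eta> by (simp only: mult_less_cancel_right_disj of_nat_less_iff) simp
    moreover have "t \<le> real (Suc (Suc i)) * \<eta>" using iu s(4) by (simp add: algebra_simps)
    ultimately have "\<bar>W t \<omega> - W (real (Suc i) * \<eta>) \<omega>\<bar> \<le> z" using False by (intro max_dev_le) auto
    moreover have "\<bar>W (real (Suc i) * \<eta>) \<omega> - W (real i * \<eta>) \<omega>\<bar> \<le> z"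
      by (rule max_dev_le[OF i]) (use \<eta> in \<open>auto simp: mult_right_mono\<close>)
    ultimately show ?thesis using 1 by linarith
  qed
qed

text \<open>The bound on the integral, packed with the conditions under which such bounds can be added.\<close>

definition mean_le :: "('a \<Rightarrow> real) \<Rightarrow> real \<Rightarrow> bool" where
  "mean_le f c \<longleftrightarrow> f \<in> borel_measurable M \<and> (\<forall>\<omega>. 0 \<le> f \<omega>) \<and> 0 \<le> c \<and> (\<integral>\<^sup>+\<omega>. ennreal (f \<omega>) \<partial>M) \<le> ennreal c"

lemma mean_le_mono: "mean_le f c \<Longrightarrow> c \<le> c' \<Longrightarrow> mean_le f c'"
  unfolding mean_le_def by (auto intro: order_trans ennreal_leI)

lemma mean_le_const: "0 \<le> c \<Longrightarrow> mean_le (\<lambda>_. c) c"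
  unfolding mean_le_def by (simp add: emeasure_space_1)

lemma mean_le_add: "mean_le f c \<Longrightarrow> mean_le g d \<Longrightarrow> mean_le (\<lambda>\<omega>. f \<omega> + g \<omega>) (c + d)"
  unfolding mean_le_def by (auto simp: nn_integral_add add_mono)

lemma mean_le_cmult: "0 \<le> a \<Longrightarrow> mean_le f c \<Longrightarrow> mean_le (\<lambda>\<omega>. a * f \<omega>) (a * c)"
  unfolding mean_le_def by (auto simp: ennreal_mult nn_integral_cmult mult_left_mono)

lemma mean_le_sum:
  assumes "finite I" "\<And>i. i \<in> I \<Longrightarrow> mean_le (f i) (c i)"
  shows "mean_le (\<lambda>\<omega>. \<Sum>i\<in>I. f i \<omega>) (\<Sum>i\<in>I. c i)"
  using assms
proof (induction I rule: finite_induct)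
  case empty then show ?case using mean_le_const[of 0] by simp
next
  case (insert x I)
  then show ?case using mean_le_add[of "f x" "c x"] by simp
qed

lemma mean_le_exp_max_dev:
  assumes "0 \<le> u" "0 < \<eta>" "0 < l"
  shows "mean_le (\<lambda>\<omega>. exp (l * max_dev u \<eta> \<omega> - a)) (12 * exp (2 * l\<^sup>2 * \<eta> - a))"
proof -
  have "mean_le (\<lambda>\<omega>. exp (l * max_dev u \<eta> \<omega>)) (12 * exp (2 * l\<^sup>2 * \<eta>))"
    unfolding mean_le_def using max_dev_exp_moment[OF assms] max_dev_measurable[OF assms(1,2)] by auto
  from mean_le_cmult[OF _ this, of "exp (- a)"] show ?thesis
    by (simp add: exp_diff exp_minus field_simps)
qed

lemma mean_le_exp_qv:
  assumes "0 < h" "0 < T" "0 \<le> \<kappa>"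
  shows "mean_le (\<lambda>\<omega>. exp (\<rho> * qv_error \<kappa> h T K \<omega> - a)) (exp (T * (8 * \<rho>\<^sup>2 * h\<^sup>2 + \<bar>\<rho>\<bar> * h * \<kappa>) - a))"
proof -
  have "mean_le (\<lambda>\<omega>. exp (\<rho> * qv_error \<kappa> h T K \<omega>)) (exp (T * (8 * \<rho>\<^sup>2 * h\<^sup>2 + \<bar>\<rho>\<bar> * h * \<kappa>)))"
    unfolding mean_le_def using qv_error_exp_moment[OF assms] qv_error_measurable[OF assms(1)] assms(2) by auto
  from mean_le_cmult[OF _ this, of "exp (- a)"] show ?thesis
    by (simp add: exp_diff exp_minus field_simps)
qed

text \<open>Turns exponential moments into second moments with only a logarithmic loss: \<open>a\<close> will be a multiple of
the logarithm of the number of terms.\<close>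

lemma square_le_exp:
  fixes y a :: real
  assumes "0 \<le> y" "0 \<le> a"
  shows "y\<^sup>2 \<le> 2 * a\<^sup>2 + 4 * exp (y - a)"
proof (cases "y \<le> a")
  case True
  then have "y\<^sup>2 \<le> a\<^sup>2" using assms by (intro power_mono)
  then show ?thesis using exp_gt_zero[of "y - a"] zero_le_power2[of a] by linarith
next
  case False
  define u where "u = y - a"
  have u: "0 \<le> u" using False unfolding u_def by simp
  have "1 + u + u\<^sup>2 / 2 \<le> exp u" by (rule exp_lower_Taylor_quadratic[OF u])
  then have "u\<^sup>2 \<le> 2 * exp u" using u by linarith
  moreover have "y\<^sup>2 \<le> 2 * a\<^sup>2 + 2 * u\<^sup>2"
  proof -
    have "0 \<le> (a - u)\<^sup>2" by simp
    then show ?thesis unfolding u_def by (simp add: power2_eq_square algebra_simps)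
  qed
  ultimately show ?thesis unfolding u_def by linarith
qed

text \<open>On the event that all hitting times are within \<open>sqrt (ln n / n)\<close> of the grid, up to a constant, the
oscillation is controlled by the deviations over blocks of that length. On the complement, of
probability of order \<open>1 / n\<close>, crude bounds by \<open>T\<close> and \<open>2 * R\<close> suffice. In both cases Young's
inequality separates the exponential, and \<open>U\<close> collects the resulting terms, each of which has an
explicit mean.\<close>

lemma embedding_error_bound:
  assumes T: "0 < T" and k: "0 < \<kappa>" and q: "0 < q"
  shows "\<exists>C>0. \<forall>n\<ge>2. \<exists>U. mean_le U (C * real n powr (- 1 / 4) * ln (real n) powr (3 / 4)) \<and>
    (\<forall>\<omega>\<in>space M. \<exists>R d w. path_control T \<kappa> W n \<omega> R d w \<and> exp (q * R) * (d + w + sqrt (T / n)) \<le> U \<omega>)"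
proof -
  define A where "A = 8 * T + 2 * T * \<kappa> + 2"
  define Cd where "Cd = A * sqrt T + 2 * T"
  define p where "p = q + 1"
  define C1 where "C1 = 2 * T + 2 + sqrt T"
  define C2 where "C2 = exp (p * \<kappa> * T) * (12 * exp (8 * p\<^sup>2 * T))"
  define C4 where "C4 = ((1 + \<kappa> / 2) * Cd + 2 * sqrt T)"
  define C where "C = C2 / 2 + (2 * C4\<^sup>2 * 2 + 18 * (420 * Cd)) / 2 + C1 / 2 * (3 + C2) * 2"
  have pos: "A > 0" "Cd > 0" "p > 0" "C1 > 0" "C2 > 0" "C4 > 0"
    unfolding A_def Cd_def p_def C1_def C2_def C4_def using T k q by (auto intro!: add_pos_pos mult_pos_pos)
  have "C > 0" unfolding C_def using pos by (intro add_pos_pos add_nonneg_pos mult_pos_pos divide_pos_pos) auto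
  moreover have "\<exists>U. mean_le U (C * real n powr (- 1 / 4) * ln (real n) powr (3 / 4)) \<and>
    (\<forall>\<omega>\<in>space M. \<exists>R d w. path_control T \<kappa> W n \<omega> R d w \<and> exp (q * R) * (d + w + sqrt (T / n)) \<le> U \<omega>)" if n: "n \<ge> 2" for n :: nat
  proof -
    define l where "l = ln (real n)"
    define h where "h = sqrt (T / n)"
    define sn where "sn = sqrt (real n)"
    define sl where "sl = sqrt l"
    define s where "s = sl / sn"
    define g where "g = real n powr (- 1 / 4) * ln (real n) powr (3 / 4)"
    have l2: "1 / 2 \<le> l"
    proof -
      have "ln 2 \<le> l" unfolding l_def using n by simp
      moreover have "1 / 2 \<le> ln (2::real)"
      proof -
        have "exp (1 / 2 :: real) \<le> 2"
        proof -
          have "(exp (1 / 2 :: real))\<^sup>2 = exp 1" by (simp add: exp_double[symmetric])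
          also have "\<dots> \<le> 2\<^sup>2" using exp_le by simp
          finally show ?thesis by (rule power2_le_imp_le) simp
        qed
        then show ?thesis by (subst ln_ge_iff) auto
      qed
      ultimately show ?thesis by linarith
    qed
    have n0: "real n > 0" "real n \<ge> 2" using n by auto
    have sn: "sn > 0" "sn \<ge> 1" "sn\<^sup>2 = real n" unfolding sn_def using n0 by auto
    have sl: "1 / 2 \<le> sl" "sl\<^sup>2 = l"
    proof -
      show "sl\<^sup>2 = l" unfolding sl_def using l2 by simp
      have "sqrt (1 / 4) \<le> sl" unfolding sl_def using l2 by (intro real_sqrt_le_mono) linarith
      then show "1 / 2 \<le> sl" by (simp add: real_sqrt_divide)
    qed
    have sl_l: "sl \<le> 2 * l"
    proof -
      have "sl * 1 \<le> sl * (2 * sl)" using sl by (intro mult_left_mono) auto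
      then show ?thesis using sl(2) by (simp add: power2_eq_square)
    qed
    have s: "s > 0" unfolding s_def using sl sn by simp
    have inv_sn: "1 / sn \<le> 2 * s" unfolding s_def using sl sn by (simp add: field_simps)
    have inv_n: "1 / real n \<le> 1 / sn"
    proof -
      have "sn * 1 \<le> sn * sn" using sn by (intro mult_left_mono) auto
      then have "sn \<le> real n" using sn(3) by (simp add: power2_eq_square)
      then show ?thesis using sn n0 by (simp add: field_simps)
    qed
    have h: "h = sqrt T / sn" "h > 0" "h\<^sup>2 = T / n" unfolding h_def sn_def using T n0 by (auto simp: real_sqrt_divide power_divide)
    have hs: "h \<le> 2 * sqrt T * s"
    proof -
      have "sqrt T * (1 / sn) \<le> sqrt T * (2 * s)" using inv_sn T by (intro mult_left_mono) auto
      then show ?thesis unfolding h(1) by simp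
    qed
    have g0: "g > 0" unfolding g_def using n0 l2 unfolding l_def by (intro mult_pos_pos) auto
    have g2: "g\<^sup>2 = s * l"
    proof -
      have "g\<^sup>2 = (real n powr (- 1 / 4))\<^sup>2 * (ln (real n) powr (3 / 4))\<^sup>2" unfolding g_def by (rule power_mult_distrib)
      also have "(real n powr (- 1 / 4))\<^sup>2 = real n powr (- (1 / 2))" by (simp add: power2_eq_square powr_add[symmetric])
      also have "\<dots> = 1 / sn" unfolding sn_def using n0 by (simp add: powr_minus powr_half_sqrt inverse_eq_divide)
      also have "(ln (real n) powr (3 / 4))\<^sup>2 = l powr (1 + 1 / 2)" unfolding l_def by (simp add: power2_eq_square powr_add[symmetric])
      also have "\<dots> = l * sl" unfolding sl_def using l2 by (subst powr_add) (simp add: powr_half_sqrt)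
      finally show ?thesis unfolding s_def by simp
    qed
    have s2: "s\<^sup>2 \<le> 2 * g\<^sup>2"
    proof -
      have "s \<le> sl" unfolding s_def using sn sl by (simp add: divide_le_eq mult_le_cancel_left1)
      then have "s * s \<le> s * (2 * l)" using sl_l s by (intro mult_left_mono) auto
      then show ?thesis unfolding g2 by (simp add: power2_eq_square)
    qed
    have inv_sn_g: "1 / sn \<le> 2 * g"
    proof -
      have "1 / 4 \<le> sl * l"
        using mult_mono[of "1/2" sl "1/2" l] sl l2 by simp
      then have "(1 / sn) * (1 / 4) \<le> (1 / sn) * (sl * l)" using sn by (intro mult_left_mono) auto
      then have "1 / sn \<le> 4 * g\<^sup>2" unfolding g2 s_def by simp
      moreover have "(1 / sn)\<^sup>2 \<le> 1 / sn" using inv_n sn(3) by (simp add: power_divide)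
      ultimately have "(1 / sn)\<^sup>2 \<le> (2 * g)\<^sup>2" by (simp add: power_mult_distrib)
      then show ?thesis by (rule power2_le_imp_le) (use g0 in simp)
    qed
    \<comment> \<open>The time error allowed, of order \<open>sqrt (ln n / n)\<close>; the summand \<open>2 * T\<close> in \<open>Cd\<close> absorbs one grid step.\<close>
    define dn where "dn = Cd * s"
    have dn: "A * h * sl + T / n \<le> dn"
    proof -
      have "T / n = T * (1 / n)" by simp
      also have "\<dots> \<le> T * (2 * s)" using inv_n inv_sn T by (intro mult_left_mono) auto
      finally show ?thesis unfolding dn_def Cd_def h(1) s_def by (simp add: algebra_simps)
    qed
    have dn0: "dn > 0" unfolding dn_def using pos s by simp
    have dnT: "T / n \<le> dn"
    proof -
      have "0 \<le> A * h * sl" using pos h sl by (intro mult_nonneg_nonneg) auto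
      then show ?thesis using dn by linarith
    qed
    \<comment> \<open>The number of blocks. Their length is at least \<open>dn\<close>, unless a single block covers \<open>[0,T]\<close>, and at most \<open>2 * dn\<close>.\<close>
    define N where "N = max 1 (nat \<lfloor>T / dn\<rfloor>)"
    define \<eta> where "\<eta> = T / N"
    have N0: "0 < N" unfolding N_def by simp
    have \<eta>: "\<eta> > 0" "real N * \<eta> = T" unfolding \<eta>_def using T N0 by auto
    have \<eta>_ge: "dn \<le> \<eta> \<or> \<eta> = T"
    proof (cases "N = 1")
      case True then show ?thesis by (simp add: \<eta>_def)
    next
      case False
      then have "real N \<le> T / dn" unfolding N_def using T dn0 by (auto simp: max_def split: if_splits) 
      then show ?thesis unfolding \<eta>_def using N0 dn0 by (simp add: field_simps)
    qed
    have \<eta>_le: "\<eta> \<le> 2 * dn"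
    proof (cases "T / dn < 1")
      case True
      then have "T < dn" using dn0 by (simp add: field_simps)
      moreover have "\<eta> \<le> T" unfolding \<eta>_def using N0 T by (simp add: divide_le_eq mult_le_cancel_left1)
      ultimately show ?thesis using T by linarith
    next
      case False
      then have "1 \<le> \<lfloor>T / dn\<rfloor>" by simp
      then have "T / dn \<le> 2 * real N" unfolding N_def by linarith
      then show ?thesis unfolding \<eta>_def using N0 dn0 by (simp add: field_simps)
    qed
    have Nn: "real N \<le> real n"
    proof -
      have "T / dn \<le> real n" using dnT dn0 n0 by (simp add: field_simps)
      then show ?thesis unfolding N_def using n0 T dn0 by (auto simp: max_def) linarith
    qed
    define ll where "ll = sqrt (l / \<eta>)"
    have ll: "ll > 0" "ll\<^sup>2 * \<eta> = l" "ll\<^sup>2 = l / \<eta>" unfolding ll_def using l2 \<eta> by auto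
    \<comment> \<open>A bound for all squared block deviations. Replacing their maximum by a sum costs \<open>N \<le> n\<close> terms of mean at most \<open>12 * exp (2 * l - 3 * l) = 12 / n\<close>.\<close>
    define Q where "Q \<omega> = \<eta> / l * (18 * l\<^sup>2 + 4 * (\<Sum>i<N. exp (ll * max_dev (real i * \<eta>) \<eta> \<omega> - 3 * l)))" for \<omega>
    have Q_mean: "mean_le Q (420 * Cd * g\<^sup>2)"
    proof (rule mean_le_mono)
      show "mean_le Q (\<eta> / l * (18 * l\<^sup>2 + 4 * (\<Sum>i<N. 12 * exp (2 * ll\<^sup>2 * \<eta> - 3 * l))))"
        unfolding Q_def
        by (intro mean_le_cmult mean_le_add mean_le_const mean_le_sum mean_le_exp_max_dev)
          (use \<eta> l2 ll in auto)
      have "(\<Sum>i<N. 12 * exp (2 * ll\<^sup>2 * \<eta> - 3 * l)) = real N * (12 * exp (- l))"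
        using ll(2) by (simp add: mult.assoc)
      also have "exp (- l) = 1 / real n" unfolding l_def using n0 by (simp add: exp_minus inverse_eq_divide)
      also have "real N * (12 * (1 / real n)) \<le> 12" using Nn n0 by (simp add: field_simps)
      finally have "\<eta> / l * (18 * l\<^sup>2 + 4 * (\<Sum>i<N. 12 * exp (2 * ll\<^sup>2 * \<eta> - 3 * l))) \<le> \<eta> / l * (18 * l\<^sup>2 + 4 * 12)"
        using \<eta> l2 by (intro mult_left_mono add_left_mono) auto
      also have "\<dots> \<le> \<eta> / l * (18 * l\<^sup>2 + 192 * l\<^sup>2)"
      proof -
        have "(1 / 2)\<^sup>2 \<le> l\<^sup>2" using l2 by (intro power_mono) auto
        then have "4 * 12 \<le> 192 * l\<^sup>2" by (simp add: power2_eq_square)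
        then show ?thesis using \<eta> l2 by (intro mult_left_mono add_left_mono) auto
      qed
      also have "\<dots> = 210 * (\<eta> * l)" using l2 by (simp add: power2_eq_square field_simps)
      also have "\<dots> \<le> 210 * (2 * dn * l)" using \<eta>_le l2 by (intro mult_left_mono mult_right_mono) auto
      also have "\<dots> = 420 * Cd * g\<^sup>2" unfolding g2 dn_def by simp
      finally show "\<eta> / l * (18 * l\<^sup>2 + 4 * (\<Sum>i<N. 12 * exp (2 * ll\<^sup>2 * \<eta> - 3 * l))) \<le> 420 * Cd * g\<^sup>2" .
    qed
    have max_dev_Q: "(max_dev (real i * \<eta>) \<eta> \<omega>)\<^sup>2 \<le> Q \<omega>" if "i < N" "\<omega> \<in> space M" for i \<omega>
    proof -
      have o: "0 \<le> max_dev (real i * \<eta>) \<eta> \<omega>"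
        using max_dev_ge[OF that(2), of "real i * \<eta>" "real i * \<eta>" \<eta>] \<eta> by auto
      have "(ll * max_dev (real i * \<eta>) \<eta> \<omega>)\<^sup>2 \<le> 2 * (3 * l)\<^sup>2 + 4 * exp (ll * max_dev (real i * \<eta>) \<eta> \<omega> - 3 * l)"
        using o ll l2 by (intro square_le_exp) auto
      also have "exp (ll * max_dev (real i * \<eta>) \<eta> \<omega> - 3 * l) \<le> (\<Sum>i<N. exp (ll * max_dev (real i * \<eta>) \<eta> \<omega> - 3 * l))"
        using that by (intro member_le_sum[where f = "\<lambda>i. exp (ll * max_dev (real i * \<eta>) \<eta> \<omega> - 3 * l)"]) auto
      finally have "l / \<eta> * (max_dev (real i * \<eta>) \<eta> \<omega>)\<^sup>2 \<le> 18 * l\<^sup>2 + 4 * (\<Sum>i<N. exp (ll * max_dev (real i * \<eta>) \<eta> \<omega> - 3 * l))"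
        by (simp add: power_mult_distrib ll(3))
      then have "\<eta> / l * (l / \<eta> * (max_dev (real i * \<eta>) \<eta> \<omega>)\<^sup>2) \<le> Q \<omega>"
        unfolding Q_def using \<eta> l2 by (intro mult_left_mono) auto
      then show ?thesis using \<eta> l2 by simp
    qed
    have Q0: "0 \<le> Q \<omega>" for \<omega> using Q_mean unfolding mean_le_def by auto
    define Y where "Y K \<omega> = qv_error \<kappa> h T K \<omega>" for K \<omega>
    \<comment> \<open>At least \<open>1\<close> as soon as some hitting time is off by more than \<open>A * h * sl\<close>; by the choice of \<open>A\<close> and of the exponent \<open>sl / h\<close> each term has mean at most \<open>1 / n\<^sup>2\<close>.\<close>
    define Bd where "Bd \<omega> = (\<Sum>K\<le>n. exp ((sl / h) * Y K \<omega> - A * l) + exp ((- sl / h) * Y K \<omega> - A * l))" for \<omega>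
    have Bd_mean: "mean_le Bd (3 / n)"
    proof (rule mean_le_mono)
      define e where "e \<rho> = exp (T * (8 * \<rho>\<^sup>2 * h\<^sup>2 + \<bar>\<rho>\<bar> * h * \<kappa>) - A * l)" for \<rho>
      show "mean_le Bd (\<Sum>K\<le>n. e (sl / h) + e (- sl / h))"
        unfolding Bd_def Y_def e_def using h T k by (intro mean_le_sum mean_le_add mean_le_exp_qv) auto
      have e: "e \<rho> \<le> 1 / (real n)\<^sup>2" if "\<bar>\<rho>\<bar> = sl / h" for \<rho>
      proof -
        have "\<rho>\<^sup>2 = l / h\<^sup>2" using that sl(2) by (metis power2_abs power_divide)
        then have r2: "\<rho>\<^sup>2 * h\<^sup>2 = l" using h(2) by simp
        have "\<bar>\<rho>\<bar> * h = sl" using that h(2) by simp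
        then have "T * (8 * \<rho>\<^sup>2 * h\<^sup>2 + \<bar>\<rho>\<bar> * h * \<kappa>) = T * (8 * l + sl * \<kappa>)" using r2 by (simp add: mult.assoc)
        also have "\<dots> \<le> T * (8 * l + 2 * l * \<kappa>)" using sl_l T k by (intro mult_left_mono add_left_mono mult_right_mono) auto
        finally have "T * (8 * \<rho>\<^sup>2 * h\<^sup>2 + \<bar>\<rho>\<bar> * h * \<kappa>) - A * l \<le> - (2 * l)"
          unfolding A_def by (simp add: algebra_simps)
        then have "e \<rho> \<le> exp (- (2 * l))" unfolding e_def by simp
        also have "\<dots> = 1 / (real n)\<^sup>2"
        proof -
          have "exp (2 * l) = (exp l)\<^sup>2" by (rule exp_double)
          also have "exp l = real n" unfolding l_def using n0 by simp
          finally show ?thesis by (simp add: exp_minus inverse_eq_divide)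
        qed
        finally show ?thesis .
      qed
      have "e (sl / h) + e (- sl / h) \<le> 2 * (1 / (real n)\<^sup>2)"
      proof -
        have "\<bar>sl / h\<bar> = sl / h" "\<bar>- sl / h\<bar> = sl / h" using sl(1) h(2) by simp_all
        then have "e (sl / h) \<le> 1 / (real n)\<^sup>2" "e (- sl / h) \<le> 1 / (real n)\<^sup>2" by (blast intro: e)+
        then show ?thesis by linarith
      qed
      then have "(\<Sum>K\<le>n. e (sl / h) + e (- sl / h)) \<le> (\<Sum>K\<le>n. 2 * (1 / (real n)\<^sup>2))" by (intro sum_mono)
      also have "\<dots> = 2 * (real n + 1) / (real n)\<^sup>2" by simp
      also have "\<dots> \<le> 3 * real n / (real n)\<^sup>2" using n0 by (intro divide_right_mono) auto
      also have "\<dots> = 3 / n" using n0 by (simp add: power2_eq_square)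
      finally show "(\<Sum>K\<le>n. e (sl / h) + e (- sl / h)) \<le> 3 / n" .
    qed
    have Bd0: "0 \<le> Bd \<omega>" for \<omega> using Bd_mean unfolding mean_le_def by auto
    have Bd1: "1 \<le> Bd \<omega>" if "K \<le> n" "A * h * sl < \<bar>Y K \<omega>\<bar>" for K \<omega>
    proof -
      have "A * l \<le> (sl / h) * \<bar>Y K \<omega>\<bar>"
      proof -
        have "(sl / h) * (A * h * sl) \<le> (sl / h) * \<bar>Y K \<omega>\<bar>" using that sl(1) h(2) by (intro mult_left_mono) auto
        moreover have "(sl / h) * (A * h * sl) = A * l" using h(2) sl(2) by (simp add: power2_eq_square)
        ultimately show ?thesis by simp
      qed
      then have "0 \<le> (sl / h) * Y K \<omega> - A * l \<or> 0 \<le> (- sl / h) * Y K \<omega> - A * l"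
        by (cases "0 \<le> Y K \<omega>") auto
      then have "1 \<le> exp ((sl / h) * Y K \<omega> - A * l) \<or> 1 \<le> exp ((- sl / h) * Y K \<omega> - A * l)"
        by (meson one_le_exp_iff)
      then have "1 \<le> exp ((sl / h) * Y K \<omega> - A * l) + exp ((- sl / h) * Y K \<omega> - A * l)"
        using exp_ge_zero[of "(sl / h) * Y K \<omega> - A * l"] exp_ge_zero[of "(- sl / h) * Y K \<omega> - A * l"] by linarith
      also have "\<dots> \<le> Bd \<omega>" unfolding Bd_def
        using that by (intro member_le_sum[where f = "\<lambda>K. exp ((sl / h) * Y K \<omega> - A * l) + exp ((- sl / h) * Y K \<omega> - A * l)"]) auto
      finally show ?thesis .
    qed
    define R where "R \<omega> = max_dev 0 T \<omega> + \<kappa> / 2 * T" for \<omega>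
    define Ex where "Ex \<omega> = exp (2 * p * max_dev 0 T \<omega> - (- (p * \<kappa> * T)))" for \<omega>
    have Ex: "Ex \<omega> = (exp (p * R \<omega>))\<^sup>2" for \<omega>
      unfolding Ex_def R_def exp_double[symmetric] by (simp add: algebra_simps)
    have Ex_mean: "mean_le Ex C2"
    proof -
      have "mean_le Ex (12 * exp (2 * (2 * p)\<^sup>2 * T - (- (p * \<kappa> * T))))"
        unfolding Ex_def using pos T by (intro mean_le_exp_max_dev) auto
      then show ?thesis unfolding C2_def by (simp add: exp_add power_mult_distrib mult_ac)
    qed
    have Ex0: "0 \<le> Ex \<omega>" for \<omega> unfolding Ex_def by simp
    \<comment> \<open>The first two summands serve the event that all hitting times are near the grid, the last one its complement.\<close>
    define U where "U \<omega> = g / 2 * Ex \<omega> + (1 / (2 * g)) * (2 * (C4 * s)\<^sup>2 + 18 * Q \<omega>) + C1 / 2 * (sn * Bd \<omega> + (1 / sn) * Ex \<omega>)" for \<omega>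
    have U_mean: "mean_le U (C * g)"
    proof (rule mean_le_mono)
      show "mean_le U (g / 2 * C2 + (1 / (2 * g)) * (2 * (C4 * s)\<^sup>2 + 18 * (420 * Cd * g\<^sup>2)) + C1 / 2 * (sn * (3 / n) + (1 / sn) * C2))"
        unfolding U_def
        by (intro mean_le_add mean_le_cmult mean_le_const Ex_mean Q_mean Bd_mean) (use g0 pos sn in auto)
      have a: "(1 / (2 * g)) * (2 * (C4 * s)\<^sup>2 + 18 * (420 * Cd * g\<^sup>2)) \<le> (2 * C4\<^sup>2 * 2 + 18 * (420 * Cd)) / 2 * g"
      proof -
        have "2 * (C4 * s)\<^sup>2 \<le> 2 * (C4\<^sup>2 * (2 * g\<^sup>2))" unfolding power_mult_distrib using s2 by (intro mult_left_mono) auto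
        then have "2 * (C4 * s)\<^sup>2 + 18 * (420 * Cd * g\<^sup>2) \<le> (2 * C4\<^sup>2 * 2 + 18 * (420 * Cd)) * g\<^sup>2" by (simp add: algebra_simps)
        then have "(1 / (2 * g)) * (2 * (C4 * s)\<^sup>2 + 18 * (420 * Cd * g\<^sup>2)) \<le> (1 / (2 * g)) * ((2 * C4\<^sup>2 * 2 + 18 * (420 * Cd)) * g\<^sup>2)"
          using g0 by (intro mult_left_mono) auto
        also have "\<dots> = (2 * C4\<^sup>2 * 2 + 18 * (420 * Cd)) / 2 * g" using g0 by (simp add: power2_eq_square)
        finally show ?thesis .
      qed
      have nn: "real n = sn * sn" using sn(3) by (simp add: power2_eq_square)
      have "sn * (3 / n) = 3 * (1 / sn)" unfolding nn using sn(1) by simp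
      then have "sn * (3 / n) + (1 / sn) * C2 = (3 + C2) * (1 / sn)" by (simp add: algebra_simps)
      also have "\<dots> \<le> (3 + C2) * (2 * g)" using inv_sn_g pos by (intro mult_left_mono) auto
      finally have "C1 / 2 * (sn * (3 / n) + (1 / sn) * C2) \<le> C1 / 2 * ((3 + C2) * (2 * g))"
        using pos by (intro mult_left_mono) auto
      then have "g / 2 * C2 + (1 / (2 * g)) * (2 * (C4 * s)\<^sup>2 + 18 * (420 * Cd * g\<^sup>2)) + C1 / 2 * (sn * (3 / n) + (1 / sn) * C2)
          \<le> g / 2 * C2 + (2 * C4\<^sup>2 * 2 + 18 * (420 * Cd)) / 2 * g + C1 / 2 * ((3 + C2) * (2 * g))"
        by (intro add_mono a order.refl)
      also have "\<dots> = C * g" unfolding C_def by (simp add: algebra_simps)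
      finally show "g / 2 * C2 + (1 / (2 * g)) * (2 * (C4 * s)\<^sup>2 + 18 * (420 * Cd * g\<^sup>2)) + C1 / 2 * (sn * (3 / n) + (1 / sn) * C2) \<le> C * g" .
    qed
    have "\<exists>R d w. path_control T \<kappa> W n \<omega> R d w \<and> exp (q * R) * (d + w + sqrt (T / n)) \<le> U \<omega>" if \<omega>: "\<omega> \<in> space M" for \<omega>
    proof -
      have amgm: "x * y \<le> a / 2 * x\<^sup>2 + (1 / (2 * a)) * y\<^sup>2" if "a > 0" for x y a :: real
      proof -
        have "0 \<le> (a * x - y)\<^sup>2 / (2 * a)" using that by simp
        also have "\<dots> = a / 2 * x\<^sup>2 + (1 / (2 * a)) * y\<^sup>2 - x * y"
          using that by (simp add: power2_eq_square field_simps)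
        finally show ?thesis by simp
      qed
      have R0: "0 \<le> R \<omega>" unfolding R_def
        using max_dev_ge[OF \<omega>, of 0 0 T] T k by (auto intro!: add_nonneg_nonneg)
      have bR: "\<bar>bstar \<kappa> W \<omega> t\<bar> \<le> R \<omega>" if "t \<in> {0..T}" for t
      proof -
        have "\<bar>W t \<omega>\<bar> \<le> max_dev 0 T \<omega>" using max_dev_ge[OF \<omega>, of 0 t T] that W_0[OF \<omega>] by simp
        moreover have "\<kappa> / 2 * t \<le> \<kappa> / 2 * T" "0 \<le> \<kappa> / 2 * t" using that k by (auto intro!: mult_left_mono)
        ultimately show ?thesis unfolding R_def bstar_def by linarith
      qed
      have eqp: "exp (q * R \<omega>) \<le> exp (p * R \<omega>)" unfolding p_def using R0 by (simp add: algebra_simps)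
      have emb: "capped T (embed_time T \<kappa> W n k \<omega>) = capped_hit \<kappa> h k T \<omega>" for k
        unfolding embed_time_def capped_hit_def h_def ..
      have T0: "0 \<le> T" using T by simp
      have tot: "0 \<le> g / 2 * Ex \<omega> + (1 / (2 * g)) * (2 * (C4 * s)\<^sup>2 + 18 * Q \<omega>)"
          "0 \<le> C1 / 2 * (sn * Bd \<omega> + (1 / sn) * Ex \<omega>)"
        using g0 Ex0[of \<omega>] Q0[of \<omega>] pos sn Bd0[of \<omega>] by (auto intro!: add_nonneg_nonneg mult_nonneg_nonneg)
      show ?thesis
      proof (cases "\<forall>K\<le>n. \<bar>Y K \<omega>\<bar> \<le> A * h * sl")
        case True
        define w where "w = 3 * sqrt (Q \<omega>) + \<kappa> / 2 * dn"
        have w0: "0 \<le> w" unfolding w_def using Q0[of \<omega>] k dn0 by simp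
        have dev: "\<bar>capped T (embed_time T \<kappa> W n K \<omega>) - real K * T / n\<bar> + T / n \<le> dn" if "K \<le> n" for K
        proof -
          have "real K * h\<^sup>2 \<le> real n * h\<^sup>2" using that by (intro mult_right_mono) auto
          then have "real K * h\<^sup>2 \<le> T" using h(3) n0 by simp
          from capped_hit_dev_le_qv_error[OF h(2) T \<omega> this, of \<kappa>]
          have "\<bar>capped_hit \<kappa> h K T \<omega> - real K * T / n\<bar> \<le> \<bar>Y K \<omega>\<bar>" unfolding Y_def h(3) by simp
          then show ?thesis unfolding emb using True that dn by fastforce
        qed
        have mod1: "\<bar>bstar \<kappa> W \<omega> a - bstar \<kappa> W \<omega> b\<bar> \<le> w" if ab: "0 \<le> a" "a \<le> b" "b \<le> T" "b - a \<le> dn" for a b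
        proof -
          have le: "b - a \<le> \<eta>" using \<eta>_ge ab by auto
          have "\<bar>W a \<omega> - W b \<omega>\<bar> \<le> 3 * sqrt (Q \<omega>)"
          proof (rule modulus_le_block_max_dev[OF \<omega> \<eta>(1,2) _ ab(1-3) le T])
            fix i assume "i < N"
            then show "max_dev (real i * \<eta>) \<eta> \<omega> \<le> sqrt (Q \<omega>)" using max_dev_Q[OF _ \<omega>] by (intro real_le_rsqrt) auto
          qed
          moreover have "\<kappa> / 2 * (b - a) \<le> \<kappa> / 2 * dn" "0 \<le> \<kappa> / 2 * (b - a)" using ab k by (auto intro!: mult_left_mono)
          ultimately show ?thesis unfolding bstar_def w_def right_diff_distrib by linarith
        qed
        have mod: "\<bar>bstar \<kappa> W \<omega> a - bstar \<kappa> W \<omega> b\<bar> \<le> w" if "a \<in> {0..T}" "b \<in> {0..T}" "\<bar>a - b\<bar> \<le> dn" for a b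
          using mod1[of a b] mod1[of b a] that by (cases "a \<le> b") (auto simp: abs_minus_commute)
        have "exp (q * R \<omega>) * (dn + w + h) \<le> exp (p * R \<omega>) * (C4 * s + 3 * sqrt (Q \<omega>))"
        proof (intro mult_mono eqp)
          have "C4 * s = dn + \<kappa> / 2 * dn + 2 * sqrt T * s" unfolding C4_def dn_def by (simp add: algebra_simps)
          then show "dn + w + h \<le> C4 * s + 3 * sqrt (Q \<omega>)" unfolding w_def using hs by linarith
          show "0 \<le> dn + w + h" using dn0 w0 h by simp
        qed auto
        also have "\<dots> \<le> g / 2 * (exp (p * R \<omega>))\<^sup>2 + (1 / (2 * g)) * (C4 * s + 3 * sqrt (Q \<omega>))\<^sup>2"
          by (rule amgm[OF g0])
        also have "\<dots> \<le> g / 2 * Ex \<omega> + (1 / (2 * g)) * (2 * (C4 * s)\<^sup>2 + 18 * Q \<omega>)"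
        proof (intro add_mono mult_left_mono)
          have sq: "(a + b)\<^sup>2 \<le> 2 * a\<^sup>2 + 2 * b\<^sup>2" for a b :: real
          proof -
            have "0 \<le> (a - b)\<^sup>2" by simp
            then show ?thesis by (simp add: power2_eq_square algebra_simps)
          qed
          have "(C4 * s + 3 * sqrt (Q \<omega>))\<^sup>2 \<le> 2 * (C4 * s)\<^sup>2 + 2 * (3 * sqrt (Q \<omega>))\<^sup>2" by (rule sq)
          also have "(3 * sqrt (Q \<omega>))\<^sup>2 = 9 * Q \<omega>" using Q0[of \<omega>] by (simp add: power_mult_distrib)
          finally show "(C4 * s + 3 * sqrt (Q \<omega>))\<^sup>2 \<le> 2 * (C4 * s)\<^sup>2 + 18 * Q \<omega>" by simp
        qed (use g0 Ex in auto)
        also have "\<dots> \<le> U \<omega>" unfolding U_def using tot(2) by linarith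
        finally have "exp (q * R \<omega>) * (dn + w + h) \<le> U \<omega>" .
        then show ?thesis
          using R0 w0 dn0 bR dev mod unfolding h_def path_control_def
          by (intro exI[of _ "R \<omega>"] exI[of _ dn] exI[of _ w] conjI ballI allI impI) auto
      next
        case False
        then obtain K where "K \<le> n" "A * h * sl < \<bar>Y K \<omega>\<bar>" by (auto simp: not_le)
        then have B1: "1 \<le> Bd \<omega>" by (rule Bd1)
        define d where "d = T + T / n"
        have dev: "\<bar>capped T (embed_time T \<kappa> W n K \<omega>) - real K * T / n\<bar> + T / n \<le> d" if "K \<le> n" for K
        proof -
          have "0 \<le> capped_hit \<kappa> h K T \<omega>" "capped_hit \<kappa> h K T \<omega> \<le> T"
            unfolding capped_hit_def using capped_hitting_range[OF bstar_cont[OF \<omega>] h(2) T0] by auto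
          moreover have "real K * T \<le> real n * T" using that T by (intro mult_right_mono) auto
          then have "real K * T / n \<le> T" using n0 by (simp add: field_simps)
          moreover have "0 \<le> real K * T / n" using T by simp
          ultimately show ?thesis unfolding emb d_def by linarith
        qed
        have mod: "\<bar>bstar \<kappa> W \<omega> a - bstar \<kappa> W \<omega> b\<bar> \<le> 2 * R \<omega>" if "a \<in> {0..T}" "b \<in> {0..T}" for a b
          using bR[OF that(1)] bR[OF that(2)] by linarith
        have "d + 2 * R \<omega> + h \<le> C1 * exp (R \<omega>)"
        proof -
          have "T / n \<le> T" using T n0 by (simp add: divide_le_eq mult_le_cancel_left1)
          moreover have "h \<le> sqrt T" unfolding h(1) using sn T by (simp add: divide_le_eq mult_le_cancel_left1)
          moreover have "1 + R \<omega> \<le> exp (R \<omega>)" by (rule exp_ge_add_one_self)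
          ultimately have "d + 2 * R \<omega> + h \<le> 2 * T * 1 + 2 * exp (R \<omega>) + sqrt T * 1" unfolding d_def by linarith
          also have "\<dots> \<le> 2 * T * exp (R \<omega>) + 2 * exp (R \<omega>) + sqrt T * exp (R \<omega>)"
            using T R0 by (intro add_mono mult_left_mono) auto
          finally show ?thesis unfolding C1_def by (simp add: algebra_simps)
        qed
        then have "exp (q * R \<omega>) * (d + 2 * R \<omega> + h) \<le> exp (q * R \<omega>) * (C1 * exp (R \<omega>))" by (intro mult_left_mono) auto
        also have "\<dots> = C1 * (exp (p * R \<omega>) * 1)" unfolding p_def by (simp add: distrib_right exp_add)
        also have "\<dots> \<le> C1 * ((1 / sn) / 2 * (exp (p * R \<omega>))\<^sup>2 + (1 / (2 * (1 / sn))) * 1\<^sup>2)"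
          using pos sn by (intro mult_left_mono amgm) auto
        also have "\<dots> = C1 / 2 * (sn * 1 + (1 / sn) * Ex \<omega>)" unfolding Ex by (simp add: algebra_simps)
        also have "\<dots> \<le> C1 / 2 * (sn * Bd \<omega> + (1 / sn) * Ex \<omega>)"
          using pos sn B1 by (intro mult_left_mono add_right_mono) auto
        also have "\<dots> \<le> U \<omega>" unfolding U_def using tot(1) by linarith
        finally have "exp (q * R \<omega>) * (d + 2 * R \<omega> + h) \<le> U \<omega>" .
        moreover have "0 \<le> d" unfolding d_def using T by simp
        ultimately show ?thesis
          using R0 bR dev mod unfolding h_def path_control_def
          by (intro exI[of _ "R \<omega>"] exI[of _ d] exI[of _ "2 * R \<omega>"] conjI ballI allI impI) auto
      qed
    qed
    then show ?thesis using U_mean unfolding g_def by (intro exI[of _ U]) (auto simp: mult.assoc)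
  qed
  ultimately show ?thesis by blast
qed

text \<open>The density of the path at time \<open>t\<close> is at most \<open>1 / sqrt (2 * pi * t)\<close>, so the probability of
remaining in a bounded interval at all integer times vanishes.\<close>

lemma hitting_finite_AE:
  assumes k: "0 < \<kappa>" and h: "0 < h"
  shows "AE \<omega> in M. \<forall>k. \<exists>u\<ge>0. hitting_times h (bstar \<kappa> W \<omega>) k = ereal u"
proof -
  have small: "emeasure M {\<omega> \<in> space M. \<forall>i::nat. \<bar>bstar \<kappa> W \<omega> (real i)\<bar> \<le> real R} = 0" for R :: nat
  proof -
    let ?S = "{\<omega> \<in> space M. \<forall>i::nat. \<bar>bstar \<kappa> W \<omega> (real i)\<bar> \<le> real R}"
    have bm: "(\<lambda>\<omega>. bstar \<kappa> W \<omega> (real i)) \<in> borel_measurable M" for i :: nat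
      unfolding bstar_def by (intro borel_measurable_diff borel_measurable_const W_meas) auto
    have le: "emeasure M ?S \<le> ennreal (2 * real R / sqrt (2 * pi * real (Suc i)))" for i
    proof -
      let ?t = "real (Suc i)"
      let ?c = "\<kappa> / 2 * ?t"
      have X: "distributed M lborel (\<lambda>\<omega>. W ?t \<omega> - W 0 \<omega>) (\<lambda>x. ennreal (normal_density 0 (sqrt (?t - 0)) x))"
        by (rule W_gauss) auto
      have "emeasure M ?S \<le> emeasure M ((\<lambda>\<omega>. W ?t \<omega> - W 0 \<omega>) -` {?c - R..?c + R} \<inter> space M)"
      proof (rule emeasure_mono)
        show "(\<lambda>\<omega>. W ?t \<omega> - W 0 \<omega>) -` {?c - R..?c + R} \<inter> space M \<in> sets M"
          using distributed_measurable[OF X] by (rule measurable_sets) auto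
        have "\<bar>bstar \<kappa> W \<omega> ?t\<bar> \<le> R" if "\<omega> \<in> ?S" for \<omega> using that by blast
        then show "?S \<subseteq> (\<lambda>\<omega>. W ?t \<omega> - W 0 \<omega>) -` {?c - R..?c + R} \<inter> space M"
          using W_0 unfolding bstar_def by fastforce
      qed
      also have "\<dots> = (\<integral>\<^sup>+x. ennreal (normal_density 0 (sqrt ?t) x) * indicator {?c - R..?c + R} x \<partial>lborel)"
        using distributed_emeasure[OF X, of "{?c - R..?c + R}"] by simp
      also have "\<dots> \<le> (\<integral>\<^sup>+x. ennreal (1 / sqrt (2 * pi * ?t)) * indicator {?c - R..?c + R} x \<partial>lborel)"
      proof (intro nn_integral_mono mult_right_mono ennreal_leI)
        fix x
        have "normal_density 0 (sqrt ?t) x = 1 / sqrt (2 * pi * ?t) * exp (- x\<^sup>2 / (2 * ?t))"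
          by (simp add: normal_density_def)
        also have "\<dots> \<le> 1 / sqrt (2 * pi * ?t) * 1" by (intro mult_left_mono) auto
        finally show "normal_density 0 (sqrt ?t) x \<le> 1 / sqrt (2 * pi * ?t)" by simp
      qed simp
      also have "\<dots> = ennreal (1 / sqrt (2 * pi * ?t)) * emeasure lborel {?c - R..?c + R}"
        by (rule nn_integral_cmult_indicator) simp
      also have "\<dots> = ennreal (2 * real R / sqrt (2 * pi * ?t))"
        by (simp add: ennreal_mult[symmetric])
      finally show ?thesis .
    qed
    have "(\<lambda>i. 2 * real R / sqrt (2 * pi * real (Suc i))) \<longlonglongrightarrow> 0"
      by (rule inv_sqrt_tendsto)
    then have "(\<lambda>i. ennreal (2 * real R / sqrt (2 * pi * real (Suc i)))) \<longlonglongrightarrow> ennreal 0"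
      by (rule tendsto_ennrealI)
    then have "emeasure M ?S \<le> ennreal 0"
      by (rule LIMSEQ_le_const) (use le in auto)
    then show ?thesis by simp
  qed
  have "AE \<omega> in M. \<forall>R::nat. \<exists>i::nat. real R < \<bar>bstar \<kappa> W \<omega> (real i)\<bar>"
  proof (subst AE_all_countable, intro allI AE_I)
    fix R :: nat
    let ?S = "{\<omega> \<in> space M. \<forall>i::nat. \<bar>bstar \<kappa> W \<omega> (real i)\<bar> \<le> real R}"
    show "{\<omega> \<in> space M. \<not> (\<exists>i::nat. real R < \<bar>bstar \<kappa> W \<omega> (real i)\<bar>)} \<subseteq> ?S" by (auto simp: not_less)
    show "emeasure M ?S = 0" by (rule small)
    have bm: "(\<lambda>\<omega>. bstar \<kappa> W \<omega> (real i)) \<in> borel_measurable M" for i :: nat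
      unfolding bstar_def by (intro borel_measurable_diff borel_measurable_const W_meas) auto
    note bm[measurable]
    show "?S \<in> sets M" by measurable
  qed
  then show ?thesis
  proof (rule AE_mp, intro AE_I2 impI allI)
    fix \<omega> k assume \<omega>: "\<omega> \<in> space M" and unb: "\<forall>R::nat. \<exists>i::nat. real R < \<bar>bstar \<kappa> W \<omega> (real i)\<bar>"
    have "\<exists>t\<ge>0. R < \<bar>bstar \<kappa> W \<omega> t\<bar>" for R :: real
    proof -
      obtain i where "real (nat \<lceil>R\<rceil>) < \<bar>bstar \<kappa> W \<omega> (real i)\<bar>" using unb by blast
      then have "R < \<bar>bstar \<kappa> W \<omega> (real i)\<bar>" by linarith
      then show ?thesis by (intro exI[of _ "real i"]) simp
    qed
    then show "\<exists>u\<ge>0. hitting_times h (bstar \<kappa> W \<omega>) k = ereal u"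
      by (rule hitting_finite_if_unbounded[OF bstar_cont[OF \<omega>] h])
  qed
qed

end

section \<open>Payoff functionals and hedges\<close>


text \<open>The hypotheses on \<open>F\<close> and \<open>\<Delta>\<close> with the extended suprema replaced by real bounds. Both
\<open>F\<close> and \<open>F + \<Delta>\<close> satisfy them with the same constant, because the original bounds are on
the sum of the two differences; so exercise and cancellation are treated together.\<close>

definition regular_payoff :: "(real \<Rightarrow> (real \<Rightarrow> real) \<Rightarrow> real) \<Rightarrow> real \<Rightarrow> real \<Rightarrow> bool" where
  "regular_payoff H L T \<longleftrightarrow>
     (\<forall>t v. 0 \<le> t \<longrightarrow> v \<in> path_space t \<longrightarrow> 0 \<le> H t v) \<and>
     (\<forall>s v w e. 0 \<le> s \<longrightarrow> s \<le> T \<longrightarrow> v \<in> path_space s \<longrightarrow> w \<in> path_space s \<longrightarrow> 0 \<le> e \<longrightarrow>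
        (\<forall>u\<in>{0..s}. \<bar>v u - w u\<bar> \<le> e) \<longrightarrow> \<bar>H s v - H s w\<bar> \<le> L * (T + 1) * e) \<and>
     (\<forall>s t v Q e. 0 \<le> s \<longrightarrow> s \<le> t \<longrightarrow> v \<in> path_space t \<longrightarrow> 0 \<le> Q \<longrightarrow> 0 \<le> e \<longrightarrow>
        (\<forall>u\<in>{0..t}. \<bar>v u\<bar> \<le> Q) \<longrightarrow> (\<forall>u\<in>{s..t}. \<bar>v u - v s\<bar> \<le> e) \<longrightarrow>
        \<bar>H t v - H s v\<bar> \<le> L * ((t - s) * (1 + Q) + e))"

lemma payoff_functionals_Lipschitz:
  assumes pf: "payoff_functionals F \<Delta> L" and s: "0 \<le> s" "s \<le> T"
    and v: "v \<in> path_space s" "w \<in> path_space s" and e: "0 \<le> e" "\<forall>u\<in>{0..s}. \<bar>v u - w u\<bar> \<le> e"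
  shows "\<bar>F s v - F s w\<bar> + \<bar>\<Delta> s v - \<Delta> s w\<bar> \<le> L * (T + 1) * e"
proof -
  have L: "1 \<le> L" using pf[unfolded payoff_functionals_def] by (rule conjunct1)
  have "sup_dist s v w \<le> ennreal e"
    unfolding sup_dist_def using e by (intro SUP_least ennreal_leI) auto
  then have "ennreal (L * (s + 1)) * sup_dist s v w \<le> ennreal (L * (s + 1)) * ennreal e" by (rule mult_left_mono) simp
  moreover have "ennreal (\<bar>F s v - F s w\<bar> + \<bar>\<Delta> s v - \<Delta> s w\<bar>) \<le> ennreal (L * (s + 1)) * sup_dist s v w"
    using pf[unfolded payoff_functionals_def, THEN conjunct2, THEN conjunct2, THEN conjunct2, THEN conjunct1,
        rule_format, OF s(1) order.refl v] .
  ultimately have "ennreal (\<bar>F s v - F s w\<bar> + \<bar>\<Delta> s v - \<Delta> s w\<bar>) \<le> ennreal (L * (s + 1) * e)"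
    using L s e by (simp add: ennreal_mult)
  then have "\<bar>F s v - F s w\<bar> + \<bar>\<Delta> s v - \<Delta> s w\<bar> \<le> L * (s + 1) * e"
    using L s e by (subst (asm) ennreal_le_iff) auto
  also have "\<dots> \<le> L * (T + 1) * e" using L s e by (intro mult_right_mono mult_left_mono) auto
  finally show ?thesis .
qed

lemma payoff_functionals_time:
  assumes pf: "payoff_functionals F \<Delta> L" and s: "0 \<le> s" "s \<le> t"
    and v: "v \<in> path_space t" and Q: "0 \<le> Q" "\<forall>u\<in>{0..t}. \<bar>v u\<bar> \<le> Q"
    and e: "0 \<le> e" "\<forall>u\<in>{s..t}. \<bar>v u - v s\<bar> \<le> e"
  shows "\<bar>F t v - F s v\<bar> + \<bar>\<Delta> t v - \<Delta> s v\<bar> \<le> L * ((t - s) * (1 + Q) + e)"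
proof -
  have L: "1 \<le> L" using pf[unfolded payoff_functionals_def] by (rule conjunct1)
  have "ennreal (\<bar>F t v - F s v\<bar> + \<bar>\<Delta> t v - \<Delta> s v\<bar>)
          \<le> ennreal L * (ennreal \<bar>t - s\<bar> * (1 + (SUP u\<in>{0..t}. ennreal \<bar>v u\<bar>))
                          + (SUP u\<in>{s..t}. ennreal \<bar>v u - v s\<bar>))"
    using pf[unfolded payoff_functionals_def, THEN conjunct2, THEN conjunct2, THEN conjunct2, THEN conjunct2,
        rule_format, OF s v] .
  also have "\<dots> \<le> ennreal L * (ennreal \<bar>t - s\<bar> * (1 + ennreal Q) + ennreal e)"
    using Q e by (intro mult_left_mono add_mono SUP_least ennreal_leI) auto
  also have "\<dots> = ennreal (L * ((t - s) * (1 + Q) + e))"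
  proof -
    have "1 + ennreal Q = ennreal (1 + Q)" using Q by simp
    then show ?thesis using L s Q e by (simp add: ennreal_mult[symmetric] ennreal_plus[symmetric] del: ennreal_plus)
  qed
  finally show ?thesis
    using L s Q e by (subst (asm) ennreal_le_iff) auto
qed

lemma payoff_functionals_nonneg:
  assumes "payoff_functionals F \<Delta> L" "0 \<le> t" "v \<in> path_space t"
  shows "0 \<le> F t v" "0 \<le> \<Delta> t v"
  using assms(1)[unfolded payoff_functionals_def, THEN conjunct2, THEN conjunct1, rule_format, OF assms(2,3)] by auto

lemma regular_payoff_F:
  assumes pf: "payoff_functionals F \<Delta> L"
  shows "regular_payoff F L T"
  unfolding regular_payoff_def
proof (intro conjI allI impI)
  show "0 \<le> F t v" if "0 \<le> t" "v \<in> path_space t" for t v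
    using payoff_functionals_nonneg[OF pf that] by simp
  show "\<bar>F s v - F s w\<bar> \<le> L * (T + 1) * e" if "0 \<le> s" "s \<le> T" "v \<in> path_space s" "w \<in> path_space s" "0 \<le> e"
    "\<forall>u\<in>{0..s}. \<bar>v u - w u\<bar> \<le> e" for s v w e
    using payoff_functionals_Lipschitz[OF pf that] by linarith
  show "\<bar>F t v - F s v\<bar> \<le> L * ((t - s) * (1 + Q) + e)" if "0 \<le> s" "s \<le> t" "v \<in> path_space t" "0 \<le> Q" "0 \<le> e"
    "\<forall>u\<in>{0..t}. \<bar>v u\<bar> \<le> Q" "\<forall>u\<in>{s..t}. \<bar>v u - v s\<bar> \<le> e" for s t v Q e
    using payoff_functionals_time[OF pf that(1-4,6,5,7)] by linarith
qed

lemma regular_payoff_G: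
  assumes pf: "payoff_functionals F \<Delta> L"
  shows "regular_payoff (\<lambda>t v. F t v + \<Delta> t v) L T"
  unfolding regular_payoff_def
proof (intro conjI allI impI)
  show "0 \<le> F t v + \<Delta> t v" if "0 \<le> t" "v \<in> path_space t" for t v
    using payoff_functionals_nonneg[OF pf that] by simp
  show "\<bar>F s v + \<Delta> s v - (F s w + \<Delta> s w)\<bar> \<le> L * (T + 1) * e"
    if "0 \<le> s" "s \<le> T" "v \<in> path_space s" "w \<in> path_space s" "0 \<le> e"
    "\<forall>u\<in>{0..s}. \<bar>v u - w u\<bar> \<le> e" for s v w e
    using payoff_functionals_Lipschitz[OF pf that] by linarith
  show "\<bar>F t v + \<Delta> t v - (F s v + \<Delta> s v)\<bar> \<le> L * ((t - s) * (1 + Q) + e)"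
    if "0 \<le> s" "s \<le> t" "v \<in> path_space t" "0 \<le> Q" "0 \<le> e"
    "\<forall>u\<in>{0..t}. \<bar>v u\<bar> \<le> Q" "\<forall>u\<in>{s..t}. \<bar>v u - v s\<bar> \<le> e" for s t v Q e
    using payoff_functionals_time[OF pf that(1-4,6,5,7)] by linarith
qed

text \<open>The difference is split at \<open>H \<tau> v\<close> and \<open>H \<tau> y\<close>: a change of the time, a change of the path, and the
discount factor. The last one multiplies a payoff, which is why the payoff at time \<open>0\<close> enters.\<close>

lemma discounted_payoff_comparison:
  assumes H: "regular_payoff H L T" and L: "0 \<le> L" and r: "0 \<le> r"
    and v: "\<And>s. v \<in> path_space s" and y: "\<And>s. y \<in> path_space s"
    and t: "0 \<le> t" "t \<le> T" and \<tau>: "0 \<le> \<tau>" "\<tau> \<le> T" and d: "\<bar>t - \<tau>\<bar> \<le> d"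
    and Q: "0 \<le> Q" "\<And>s. 0 \<le> s \<Longrightarrow> s \<le> T \<Longrightarrow> \<bar>v s\<bar> \<le> Q" "\<And>s. 0 \<le> s \<Longrightarrow> s \<le> \<tau> \<Longrightarrow> \<bar>y s\<bar> \<le> Q"
    and e: "0 \<le> e" "\<And>s s'. 0 \<le> s \<Longrightarrow> s \<le> T \<Longrightarrow> 0 \<le> s' \<Longrightarrow> s' \<le> T \<Longrightarrow> \<bar>s - s'\<bar> \<le> d \<Longrightarrow> \<bar>v s - v s'\<bar> \<le> e"
      "\<And>s. 0 \<le> s \<Longrightarrow> s \<le> \<tau> \<Longrightarrow> \<bar>v s - y s\<bar> \<le> e"
    and z: "y 0 = z"
  shows "H t v - exp (r * (t - \<tau>)) * H \<tau> y
    \<le> L * (d * (1 + Q) + e) + L * (T + 1) * e + r * d * (H 0 (\<lambda>_. z) + L * (T * (1 + Q) + 2 * Q))"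
proof -
  have d0: "0 \<le> d" using d by linarith
  have Hn: "0 \<le> H s x" if "0 \<le> s" "x \<in> path_space s" for s x
    using H[unfolded regular_payoff_def, THEN conjunct1] that by blast
  have Hl: "\<bar>H s x - H s w\<bar> \<le> L * (T + 1) * e" if "0 \<le> s" "s \<le> T" "x \<in> path_space s" "w \<in> path_space s" "0 \<le> e"
    "\<forall>u\<in>{0..s}. \<bar>x u - w u\<bar> \<le> e" for s x w e
    using H[unfolded regular_payoff_def, THEN conjunct2, THEN conjunct1, rule_format, OF that(1-5)] that(6) by blast
  have Ht: "\<bar>H t x - H s x\<bar> \<le> L * ((t - s) * (1 + Q) + e)" if "0 \<le> s" "s \<le> t" "x \<in> path_space t" "0 \<le> Q" "0 \<le> e"
    "\<forall>u\<in>{0..t}. \<bar>x u\<bar> \<le> Q" "\<forall>u\<in>{s..t}. \<bar>x u - x s\<bar> \<le> e" for s t x Q e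
    using H[unfolded regular_payoff_def, THEN conjunct2, THEN conjunct2, rule_format, OF that(1-5)] that(6,7) by blast
  have 1: "\<bar>H t v - H \<tau> v\<bar> \<le> L * (d * (1 + Q) + e)"
  proof (cases "\<tau> \<le> t")
    case True
    have "\<bar>H t v - H \<tau> v\<bar> \<le> L * ((t - \<tau>) * (1 + Q) + e)"
      using True t \<tau> d Q e v by (intro Ht ballI) auto
    also have "\<dots> \<le> L * (d * (1 + Q) + e)" using L Q d by (intro mult_left_mono add_right_mono mult_right_mono) auto
    finally show ?thesis .
  next
    case False
    have "\<bar>H \<tau> v - H t v\<bar> \<le> L * ((\<tau> - t) * (1 + Q) + e)"
      using False t \<tau> d Q e v by (intro Ht ballI) auto
    also have "\<dots> \<le> L * (d * (1 + Q) + e)" using L Q d by (intro mult_left_mono add_right_mono mult_right_mono) auto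
    finally show ?thesis by (simp add: abs_minus_commute)
  qed
  have 2: "\<bar>H \<tau> v - H \<tau> y\<bar> \<le> L * (T + 1) * e"
    using \<tau> v y e by (intro Hl ballI) auto
  have 3: "H \<tau> y \<le> H 0 (\<lambda>_. z) + L * (T * (1 + Q) + 2 * Q)"
  proof -
    have "\<bar>H 0 y - H 0 (\<lambda>_. z)\<bar> \<le> L * (T + 1) * 0"
    proof (rule Hl)
      show "(\<lambda>_. z) \<in> path_space 0" unfolding path_space_def by simp
    qed (use t z y in auto)
    moreover have "\<bar>H \<tau> y - H 0 y\<bar> \<le> L * ((\<tau> - 0) * (1 + Q) + 2 * Q)"
    proof (intro Ht ballI)
      fix u assume "u \<in> {0..\<tau>}"
      then show "\<bar>y u\<bar> \<le> Q" "\<bar>y u - y 0\<bar> \<le> 2 * Q" using Q(3)[of u] Q(3)[of 0] \<tau> by auto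
    qed (use \<tau> y Q in auto)
    moreover have "L * ((\<tau> - 0) * (1 + Q) + 2 * Q) \<le> L * (T * (1 + Q) + 2 * Q)"
      using L Q \<tau> by (intro mult_left_mono add_right_mono mult_right_mono) auto
    ultimately show ?thesis by linarith
  qed
  have Hy: "0 \<le> H \<tau> y" using \<tau> y by (intro Hn)
  have "1 - exp (r * (t - \<tau>)) \<le> r * d"
  proof -
    have "1 + r * (t - \<tau>) \<le> exp (r * (t - \<tau>))" by (rule exp_ge_add_one_self)
    moreover have "r * (\<tau> - t) \<le> r * d" using r d by (intro mult_left_mono) auto
    ultimately show ?thesis by (simp add: algebra_simps)
  qed
  then have "(1 - exp (r * (t - \<tau>))) * H \<tau> y \<le> r * d * H \<tau> y" using Hy by (rule mult_right_mono)
  also have "\<dots> \<le> r * d * (H 0 (\<lambda>_. z) + L * (T * (1 + Q) + 2 * Q))" using 3 r d0 by (intro mult_left_mono) auto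
  finally have "H \<tau> y - exp (r * (t - \<tau>)) * H \<tau> y \<le> r * d * (H 0 (\<lambda>_. z) + L * (T * (1 + Q) + 2 * Q))"
    by (simp add: algebra_simps)
  then show ?thesis using 1 2 by linarith
qed

text \<open>By independence every sign vector has probability a product of the factors \<open>p\<close> and \<open>1 - p\<close>, so a
property that holds almost surely holds for each of them.\<close>

lemma hedge_holds_everywhere:
  assumes iid: "iid_signs N \<xi> p" and p: "0 < p" "p < 1"
    and AE: "AE \<omega> in N. P (sample_signs \<xi> n \<omega>)" and x: "x \<in> sign_vectors n"
  shows "P x"
proof -
  interpret prob_space N using iid unfolding iid_signs_def by blast
  have ind: "indep_vars (\<lambda>_. borel) \<xi> {1..}" using iid unfolding iid_signs_def by blast
  have m: "measure N {\<omega> \<in> space N. \<xi> k \<omega> = 1} = p" "measure N {\<omega> \<in> space N. \<xi> k \<omega> = -1} = 1 - p" if "k \<ge> 1" for k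
    using iid that unfolding iid_signs_def by blast+
  have rv: "\<xi> k \<in> borel_measurable N" if "k \<ge> 1" for k
    using ind that unfolding indep_vars_def by auto
  let ?E = "\<lambda>k. \<xi> k -` {x k} \<inter> space N"
  let ?A = "{\<omega> \<in> space N. \<forall>k\<in>{1..n}. \<xi> k \<omega> = x k}"
  have Em: "?E k \<in> sets N" if "k \<ge> 1" for k
    using rv[OF that] by (rule measurable_sets) simp
  have A_eq: "?A = (\<Inter>k\<in>{1..n}. ?E k)" if "n \<noteq> 0" using that by auto
  have Am: "?A \<in> sets N"
  proof (cases "n = 0")
    case True then show ?thesis by simp
  next
    case False
    have "(\<Inter>k\<in>{1..n}. ?E k) \<in> sets N"
      using False by (intro sets.finite_INT Em) auto
    then show ?thesis unfolding A_eq[OF False] .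
  qed
  have pos: "0 < prob ?A"
  proof (cases "n = 0")
    case True then show ?thesis by (simp add: prob_space)
  next
    case False
    have "prob ?A = prob (\<Inter>k\<in>{1..n}. ?E k)" unfolding A_eq[OF False] ..
    also have "\<dots> = (\<Prod>k\<in>{1..n}. prob (?E k))"
      by (rule indep_varsD[OF ind]) (use False in auto)
    also have "\<dots> > 0"
    proof (rule prod_pos)
      fix k assume k: "k \<in> {1..n}"
      then have "x k = 1 \<or> x k = -1" using x unfolding sign_vectors_def by (auto simp: PiE_iff)
      moreover have "?E k = {\<omega> \<in> space N. \<xi> k \<omega> = x k}" by auto
      ultimately show "0 < prob (?E k)" using m[of k] k p by auto
    qed
    finally show ?thesis .
  qed
  have "\<exists>\<omega>\<in>?A. P (sample_signs \<xi> n \<omega>)"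
  proof (rule ccontr)
    assume none: "\<not> (\<exists>\<omega>\<in>?A. P (sample_signs \<xi> n \<omega>))"
    obtain Z where Z: "{\<omega> \<in> space N. \<not> P (sample_signs \<xi> n \<omega>)} \<subseteq> Z" "emeasure N Z = 0" "Z \<in> sets N"
      using AE by (rule AE_E)
    have "?A \<subseteq> Z" using none Z(1) by blast
    then have "emeasure N ?A \<le> emeasure N Z" using Z(3) by (rule emeasure_mono)
    then show False using pos Z(2) by (simp add: emeasure_eq_measure)
  qed
  then obtain \<omega> where \<omega>: "\<omega> \<in> ?A" "P (sample_signs \<xi> n \<omega>)" by blast
  have "sample_signs \<xi> n \<omega> = x"
    using \<omega>(1) x unfolding sample_signs_def sign_vectors_def
    by (auto simp: fun_eq_iff PiE_iff extensional_def)
  then show ?thesis using \<omega>(2) by simp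
qed

section \<open>The transferred hedge along a single path\<close>


lemma abs_exp_diff_le:
  fixes p q c :: real
  assumes "p \<le> c" "q \<le> c"
  shows "\<bar>exp p - exp q\<bar> \<le> exp c * \<bar>p - q\<bar>"
proof -
  have up: "exp p - exp q \<le> exp c * \<bar>p - q\<bar>" if "q \<le> p" "p \<le> c" for p q :: real
  proof -
    have "1 - exp (q - p) \<le> p - q" using exp_ge_add_one_self[of "q - p"] by linarith
    then have "exp p * (1 - exp (q - p)) \<le> exp c * (p - q)" using that by (intro mult_mono) auto
    moreover have "exp p * (1 - exp (q - p)) = exp p - exp q" by (simp add: right_diff_distrib exp_add[symmetric])
    ultimately show ?thesis using that by simp
  qed
  show ?thesis
  proof (cases "q \<le> p")
    case True then show ?thesis using up[OF True assms(1)] by simp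
  next
    case False
    then show ?thesis using up[of p q, OF _ assms(2)] by (simp add: abs_minus_commute)
  qed
qed

text \<open>The next three facts become linear once the products of the market quantities are variables.\<close>

lemma abs_le_add: "\<bar>p\<bar> \<le> a \<Longrightarrow> \<bar>q\<bar> \<le> b \<Longrightarrow> x = p + q \<Longrightarrow> \<bar>x\<bar> \<le> a + (b :: real)"
  by linarith

lemma near_grid_point:
  "\<bar>a - p'\<bar> + \<delta> \<le> d \<Longrightarrow> p' = p - \<delta> \<Longrightarrow> s = p \<Longrightarrow> 0 \<le> \<delta> \<Longrightarrow> \<bar>s - a\<bar> \<le> (d :: real)"
  by linarith

lemma near_grid_interval:
  "\<bar>a - p'\<bar> + \<delta> \<le> d \<Longrightarrow> p' = p - \<delta> \<Longrightarrow> \<bar>m - p\<bar> + \<delta> \<le> d \<Longrightarrow> t \<le> m \<Longrightarrow> 0 \<le> \<delta> \<Longrightarrow> a < t \<Longrightarrow>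
    \<bar>t - p\<bar> \<le> (d :: real)"
  by linarith

text \<open>The sum of the coefficients of \<open>1\<close>, \<open>z\<close> and the initial payoff in \<open>payoff_gap\<close>; \<open>K\<close> bounds the
price growth apart from \<open>exp (\<kappa> * R)\<close>.\<close>

definition payoff_const :: "real \<Rightarrow> real \<Rightarrow> real \<Rightarrow> real \<Rightarrow> real" where
  "payoff_const T r \<kappa> L = (let K = exp (r * T + \<kappa> * sqrt T) in
     L + L * K + L * (T + 2) * K * (r + \<kappa>) + r + r * L * T + r * L * (T + 2) * K)"

text \<open>One path on which all hitting times \<open>u k\<close> are finite.\<close>

locale embedded_path =
  fixes T r \<kappa> :: real and n :: nat and z :: real and B :: "real \<Rightarrow> 'a \<Rightarrow> real" and \<omega> :: 'a and u :: "nat \<Rightarrow> real"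
  assumes T: "0 < T" and r: "0 < r" and kap: "0 < \<kappa>" and n: "0 < n" and z: "0 < z"
    and cont: "continuous_on {0..} (bstar \<kappa> B \<omega>)" and b0: "bstar \<kappa> B \<omega> 0 = 0"
    and u: "\<And>k. 0 \<le> u k" "\<And>k. embed_time T \<kappa> B n k \<omega> = ereal (u k)"
begin

abbreviation b where "b \<equiv> bstar \<kappa> B \<omega>"
abbreviation x where "x \<equiv> embed_signs T \<kappa> B n \<omega>"

definition h where "h = sqrt (T / n)"

lemma h: "0 < h" "h * sqrt (n / T) = 1"
  unfolding h_def using T n by (auto simp: real_sqrt_divide power_divide)

lemma hit: "hitting_times h b k = ereal (u k)"
  using u(2)[of k] unfolding embed_time_def h_def .

lemma u_mono: "i \<le> j \<Longrightarrow> u i \<le> u j"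
  using hitting_mono[OF cont h(1), of i j] unfolding hit by simp

lemma u_0: "u 0 = 0" using hit[of 0] by simp

lemma u_step: "\<bar>b (u (Suc k)) - b (u k)\<bar> = h"
  and u_between: "u k \<le> t \<Longrightarrow> t \<le> u (Suc k) \<Longrightarrow> \<bar>b t - b (u k)\<bar> \<le> h"
proof -
  show "\<bar>b (u (Suc k)) - b (u k)\<bar> = h"
    using hitting_step[OF cont h(1) hit u(1), of k] hit[of "Suc k"] by auto
  show "u k \<le> t \<Longrightarrow> t \<le> u (Suc k) \<Longrightarrow> \<bar>b t - b (u k)\<bar> \<le> h"
    using incr_before_hitting[OF cont h(1), of k t] unfolding hit by simp
qed

lemma x_incr: "1 \<le> k \<Longrightarrow> k \<le> n \<Longrightarrow> h * x k = b (u k) - b (u (k - 1))"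
proof -
  assume k: "1 \<le> k" "k \<le> n"
  then have "h * x k = (h * sqrt (n / T)) * (b (u k) - b (u (k - 1)))"
    unfolding embed_signs_def u(2) by simp
  then show ?thesis unfolding h by simp
qed

lemma x_sign: "x \<in> sign_vectors n"
proof -
  have "x k = 1 \<or> x k = -1" if k: "k \<in> {1..n}" for k
  proof -
    have "\<bar>h * x k\<bar> = h" using x_incr[of k] u_step[of "k - 1"] k by simp
    then have "\<bar>x k\<bar> = 1" using h(1) by (simp add: abs_mult)
    then show ?thesis by linarith
  qed
  moreover have "x \<in> extensional {1..n}" unfolding embed_signs_def by simp
  ultimately show ?thesis unfolding sign_vectors_def by (intro PiE_I) (auto simp: extensional_def)
qed

lemma x_sum: "i \<le> n \<Longrightarrow> h * (\<Sum>k=1..i. x k) = b (u i)"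
proof (induction i)
  case 0 then show ?case by (simp add: u_0 b0)
next
  case (Suc i)
  then show ?case using x_incr[of "Suc i"] by (simp add: distrib_left)
qed

text \<open>The discounted prices in the two markets: the interest rate cancels.\<close>

definition disc_binomial where "disc_binomial y j = z * exp (\<kappa> * (h * (\<Sum>k=1..j. y k)))"

definition disc_bs where "disc_bs t = z * exp (\<kappa> * b t)"

lemma floor_grid: "nat \<lfloor>real n * (real j * T / n) / T\<rfloor> = j"
  using T n by simp

lemma binomial_stock_grid: "exp (- r * real j * T / n) * binomial_stock T r \<kappa> n z y (real j * T / n) = disc_binomial y j"
proof -
  have "(\<Sum>k=1..j. r * T / n + \<kappa> * sqrt (T / n) * y k) = r * real j * T / n + \<kappa> * (h * (\<Sum>k=1..j. y k))"
    by (simp add: sum.distrib h_def sum_distrib_left mult_ac)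
  then show ?thesis unfolding binomial_stock_def floor_grid disc_binomial_def
    by (simp add: exp_add[symmetric] mult.left_commute[of _ z])
qed

lemma binomial_value_eq: "binomial_value T r \<kappa> n z Z0 \<gamma> y k =
   exp (r * real k * T / n) * (Z0 + (\<Sum>j=1..k. \<gamma> j y * (disc_binomial y j - disc_binomial y (j - 1))))"
proof -
  have "exp (- r * (real j - 1) * T / n) * binomial_stock T r \<kappa> n z y ((real j - 1) * T / n) = disc_binomial y (j - 1)"
    if "j \<in> {1..k}" for j
    using binomial_stock_grid[of "j - 1" y] that by (simp add: of_nat_diff)
  then show ?thesis unfolding binomial_value_def binomial_stock_grid
    by (intro arg_cong2[where f = "(*)"] arg_cong2[where f = "(+)"] sum.cong refl) auto
qed

lemma disc_stock: "bs_discounted_stock r \<kappa> B z \<omega> t = disc_bs t"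
  unfolding bs_discounted_stock_def bs_stock_def disc_bs_def
  by (simp add: exp_add[symmetric] mult.left_commute[of _ z])

lemma bs_value_eq: "bs_value T r \<kappa> B n z Z0 \<gamma> \<omega> t =
   exp (r * t) * (Z0 + (\<Sum>k=1..n. \<gamma> k x * (disc_bs (min t (u k)) - disc_bs (min t (u (k - 1))))))"
  unfolding bs_value_def disc_stock u(2) by simp

text \<open>The embedded signs reproduce the path at the hitting times; this is what makes the two markets
comparable.\<close>

lemma disc_binomial_signs: "j \<le> n \<Longrightarrow> disc_binomial x j = disc_bs (u j)"
  unfolding disc_binomial_def disc_bs_def using x_sum[of j] by simp

lemma sum_split_le:
  fixes f :: "nat \<Rightarrow> real"
  assumes "j \<le> n" "\<And>k. j < k \<Longrightarrow> k \<le> n \<Longrightarrow> f k = 0"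
  shows "(\<Sum>k=1..n. f k) = (\<Sum>k=1..j. f k)"
  using assms by (intro sum.mono_neutral_right) auto

lemma exp_split: "exp (r * (t - real j * T / n)) * exp (r * real j * T / n) = exp (r * t)"
proof -
  have "r * t = r * (t - real j * T / n) + r * real j * T / n" by (simp add: right_diff_distrib)
  then show ?thesis by (simp only: exp_add)
qed

text \<open>The second alternative is the time after the last hit, when the portfolio consists of bonds.\<close>

lemma bs_value_at_hit:
  assumes j: "j \<le> n" and t: "t = u j \<or> (j = n \<and> u n \<le> t)"
  shows "bs_value T r \<kappa> B n z Z0 \<gamma> \<omega> t = exp (r * (t - real j * T / n)) * binomial_value T r \<kappa> n z Z0 \<gamma> x j"
proof -
  have tj: "u j \<le> t" using t by auto
  have "(\<Sum>k=1..n. \<gamma> k x * (disc_bs (min t (u k)) - disc_bs (min t (u (k - 1)))))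
    = (\<Sum>k=1..j. \<gamma> k x * (disc_bs (min t (u k)) - disc_bs (min t (u (k - 1)))))"
  proof (rule sum_split_le[OF j])
    fix k assume k: "j < k" "k \<le> n"
    then have tu: "t = u j" using t by auto
    have "j \<le> k" "j \<le> k - 1" using k by auto
    note m = min_absorb1[OF u_mono[OF \<open>j \<le> k\<close>]] min_absorb1[OF u_mono[OF \<open>j \<le> k - 1\<close>]]
    show "\<gamma> k x * (disc_bs (min t (u k)) - disc_bs (min t (u (k - 1)))) = 0" unfolding tu m by simp
  qed
  also have "\<dots> = (\<Sum>k=1..j. \<gamma> k x * (disc_binomial x k - disc_binomial x (k - 1)))"
  proof (rule sum.cong[OF refl])
    fix k assume k: "k \<in> {1..j}"
    then have "k \<le> j" "k - 1 \<le> j" by auto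
    note m = min_absorb2[OF order_trans[OF u_mono[OF \<open>k \<le> j\<close>] tj]]
      min_absorb2[OF order_trans[OF u_mono[OF \<open>k - 1 \<le> j\<close>] tj]]
    show "\<gamma> k x * (disc_bs (min t (u k)) - disc_bs (min t (u (k - 1)))) = \<gamma> k x * (disc_binomial x k - disc_binomial x (k - 1))"
      unfolding m disc_binomial_signs[OF order_trans[OF \<open>k \<le> j\<close> j]] disc_binomial_signs[OF order_trans[OF \<open>k - 1 \<le> j\<close> j]] ..
  qed
  finally show ?thesis unfolding bs_value_eq binomial_value_eq
    unfolding mult.assoc[symmetric, of "exp (r * (t - real j * T / n))"] exp_split by simp
qed

text \<open>Before the \<open>j\<close>-th hit the price lies between its two possible values at that hit, and the holding
\<open>\<gamma> j\<close> is already fixed. So one of the two successors, chosen according to the sign of the holding,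
is at least as bad for the portfolio as the present price.\<close>

lemma bs_value_between_hits:
  assumes pred: "predictable_holdings n \<gamma>" and j: "1 \<le> j" "j \<le> n" and t: "u (j - 1) \<le> t" "t \<le> u j"
  obtains y where "y \<in> sign_vectors n" "\<And>k. k \<in> {1..<j} \<Longrightarrow> y k = x k"
    "bs_value T r \<kappa> B n z Z0 \<gamma> \<omega> t \<ge> exp (r * (t - real j * T / n)) * binomial_value T r \<kappa> n z Z0 \<gamma> y j"
proof -
  \<comment> \<open>For a nonnegative holding the lower price is the worse one, otherwise the upper one.\<close>
  define \<epsilon> :: real where "\<epsilon> = (if \<gamma> j x \<ge> 0 then -1 else 1)"
  define y where "y = x(j := \<epsilon>)"
  have y: "y \<in> sign_vectors n"
    using x_sign j unfolding y_def sign_vectors_def \<epsilon>_def by (auto simp: PiE_iff extensional_def)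
  have yx: "y k = x k" if "k \<in> {1..<j}" for k using that unfolding y_def by simp
  have \<gamma>: "\<gamma> k y = \<gamma> k x" if "k \<in> {1..j}" for k
    using pred[unfolded predictable_holdings_def, rule_format, of k y x] that j y x_sign yx by auto
  have Py: "disc_binomial y k = disc_binomial x k" if "k < j" for k
  proof -
    have "(\<Sum>k=1..k. y k) = (\<Sum>k=1..k. x k)" using that yx by (intro sum.cong) auto
    then show ?thesis unfolding disc_binomial_def by simp
  qed
  have Pyj: "disc_binomial y j = z * exp (\<kappa> * (b (u (j - 1)) + h * \<epsilon>))"
  proof -
    have "(\<Sum>k=1..j. y k) = (\<Sum>k=1..j - 1. y k) + y j"
      using j by (cases j) auto
    also have "(\<Sum>k=1..j - 1. y k) = (\<Sum>k=1..j - 1. x k)" using yx j by (intro sum.cong) auto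
    finally have "h * (\<Sum>k=1..j. y k) = b (u (j - 1)) + h * \<epsilon>"
      using x_sum[of "j - 1"] j by (simp add: y_def distrib_left)
    then show ?thesis unfolding disc_binomial_def by simp
  qed
  have bt: "\<bar>b t - b (u (j - 1))\<bar> \<le> h" using u_between[of "j - 1" t] t j by simp
  have key: "\<gamma> j x * (disc_binomial y j - disc_bs (u (j - 1))) \<le> \<gamma> j x * (disc_bs t - disc_bs (u (j - 1)))"
  proof (cases "\<gamma> j x \<ge> 0")
    case True
    have "disc_binomial y j \<le> disc_bs t" unfolding Pyj disc_bs_def using True bt z kap by (auto simp: \<epsilon>_def)
    then show ?thesis using True by (intro mult_left_mono) auto
  next
    case False
    have "disc_bs t \<le> disc_binomial y j" unfolding Pyj disc_bs_def using False bt z kap by (auto simp: \<epsilon>_def)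
    then show ?thesis using False by (intro mult_left_mono_neg) auto
  qed
  have sB: "(\<Sum>k=1..n. \<gamma> k x * (disc_bs (min t (u k)) - disc_bs (min t (u (k - 1)))))
     = (\<Sum>k=1..j - 1. \<gamma> k x * (disc_bs (u k) - disc_bs (u (k - 1)))) + \<gamma> j x * (disc_bs t - disc_bs (u (j - 1)))"
  proof -
    have "(\<Sum>k=1..n. \<gamma> k x * (disc_bs (min t (u k)) - disc_bs (min t (u (k - 1)))))
      = (\<Sum>k=1..j. \<gamma> k x * (disc_bs (min t (u k)) - disc_bs (min t (u (k - 1)))))"
    proof (rule sum_split_le[OF j(2)])
      fix k assume k: "j < k" "k \<le> n"
      then have "j \<le> k" "j \<le> k - 1" by auto
      note m = min_absorb1[OF order_trans[OF t(2) u_mono[OF \<open>j \<le> k\<close>]]]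
        min_absorb1[OF order_trans[OF t(2) u_mono[OF \<open>j \<le> k - 1\<close>]]]
      show "\<gamma> k x * (disc_bs (min t (u k)) - disc_bs (min t (u (k - 1)))) = 0" unfolding m by simp
    qed
    also have "\<dots> = (\<Sum>k=1..j - 1. \<gamma> k x * (disc_bs (min t (u k)) - disc_bs (min t (u (k - 1)))))
       + \<gamma> j x * (disc_bs (min t (u j)) - disc_bs (min t (u (j - 1))))"
      using j by (cases j) auto
    also have "(\<Sum>k=1..j - 1. \<gamma> k x * (disc_bs (min t (u k)) - disc_bs (min t (u (k - 1)))))
      = (\<Sum>k=1..j - 1. \<gamma> k x * (disc_bs (u k) - disc_bs (u (k - 1))))"
    proof (rule sum.cong[OF refl])
      fix k assume k: "k \<in> {1..j - 1}"
      then have "k \<le> j - 1" "k - 1 \<le> j - 1" by auto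
      note m = min_absorb2[OF order_trans[OF u_mono[OF \<open>k \<le> j - 1\<close>] t(1)]]
        min_absorb2[OF order_trans[OF u_mono[OF \<open>k - 1 \<le> j - 1\<close>] t(1)]]
      show "\<gamma> k x * (disc_bs (min t (u k)) - disc_bs (min t (u (k - 1)))) = \<gamma> k x * (disc_bs (u k) - disc_bs (u (k - 1)))" unfolding m ..
    qed
    also have "min t (u j) = t" using t by simp
    also have "min t (u (j - 1)) = u (j - 1)" using t by simp
    finally show ?thesis .
  qed
  have sP: "(\<Sum>k=1..j. \<gamma> k y * (disc_binomial y k - disc_binomial y (k - 1)))
     = (\<Sum>k=1..j - 1. \<gamma> k x * (disc_bs (u k) - disc_bs (u (k - 1)))) + \<gamma> j x * (disc_binomial y j - disc_bs (u (j - 1)))"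
  proof -
    have "(\<Sum>k=1..j. \<gamma> k y * (disc_binomial y k - disc_binomial y (k - 1)))
      = (\<Sum>k=1..j - 1. \<gamma> k y * (disc_binomial y k - disc_binomial y (k - 1))) + \<gamma> j y * (disc_binomial y j - disc_binomial y (j - 1))"
      using j by (cases j) auto
    also have "(\<Sum>k=1..j - 1. \<gamma> k y * (disc_binomial y k - disc_binomial y (k - 1))) = (\<Sum>k=1..j - 1. \<gamma> k x * (disc_bs (u k) - disc_bs (u (k - 1))))"
      using \<gamma> Py disc_binomial_signs j by (intro sum.cong) auto
    also have "disc_binomial y (j - 1) = disc_bs (u (j - 1))" using Py[of "j - 1"] disc_binomial_signs[of "j - 1"] j by simp
    also have "\<gamma> j y = \<gamma> j x" using \<gamma> j by simp
    finally show ?thesis .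
  qed
  have "exp (r * (t - real j * T / n)) * binomial_value T r \<kappa> n z Z0 \<gamma> y j
     = exp (r * t) * (Z0 + (\<Sum>k=1..j. \<gamma> k y * (disc_binomial y k - disc_binomial y (k - 1))))"
    unfolding binomial_value_eq mult.assoc[symmetric, of "exp (r * (t - real j * T / n))"] exp_split ..
  also have "\<dots> \<le> bs_value T r \<kappa> B n z Z0 \<gamma> \<omega> t"
    unfolding bs_value_eq sB sP
    by (intro mult_left_mono[OF add_left_mono[OF add_left_mono[OF key]]] exp_ge_zero)
  finally show ?thesis using that y yx by blast
qed

lemma bs_stock_path: "bs_stock r \<kappa> B z \<omega> \<in> path_space s"
proof -
  have "continuous_on {0..s} (\<lambda>t. bs_stock r \<kappa> B z \<omega> t)"
    unfolding bs_stock_def by (intro continuous_intros continuous_on_subset[OF cont]) auto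
  then show ?thesis unfolding path_space_def by (rule borel_measurable_continuous_on_restrict)
qed

lemma binomial_stock_path: "binomial_stock T r \<kappa> n z y \<in> path_space s"
proof -
  have "(\<lambda>t. nat \<lfloor>real n * t / T\<rfloor>) \<in> measurable borel (count_space UNIV)" by measurable
  then have "(\<lambda>t. (\<lambda>i. z * exp (\<Sum>k=1..i. r * T / n + \<kappa> * sqrt (T / n) * y k)) (nat \<lfloor>real n * t / T\<rfloor>)) \<in> borel_measurable borel"
    by (rule measurable_compose) simp
  then have "binomial_stock T r \<kappa> n z y \<in> borel_measurable borel"
    unfolding binomial_stock_def .
  then show ?thesis unfolding path_space_def by (rule measurable_restrict_space1)
qed

lemma prev_grid: "0 < j \<Longrightarrow> real (j - 1) * T / n = real j * T / n - T / n"
proof -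
  assume "0 < j"
  then have "real (j - 1) = real j - 1" by (simp add: of_nat_diff)
  then show ?thesis by (simp only: left_diff_distrib diff_divide_distrib mult_1)
qed

text \<open>Grid times before \<open>j * T / n\<close> correspond to hitting times before \<open>T\<close>, where the binomial price is read
off the path itself. At the grid time \<open>j * T / n\<close> the sign \<open>y j\<close> may be arbitrary, which costs
one step \<open>h\<close>; in this way only the path up to \<open>T\<close> is used.\<close>

lemma stock_comparison:
  assumes y: "y \<in> sign_vectors n" "\<And>k. k \<in> {1..<j} \<Longrightarrow> y k = x k" and j: "j \<le> n" and uj: "j = 0 \<or> u (j - 1) \<le> T"
    and R: "0 \<le> R" "\<And>t. 0 \<le> t \<Longrightarrow> t \<le> T \<Longrightarrow> \<bar>b t\<bar> \<le> R"
    and w: "0 \<le> w" "\<And>s t. 0 \<le> s \<Longrightarrow> s \<le> T \<Longrightarrow> 0 \<le> t \<Longrightarrow> t \<le> T \<Longrightarrow> \<bar>s - t\<bar> \<le> d \<Longrightarrow> \<bar>b s - b t\<bar> \<le> w"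
    and d: "\<And>k. k \<le> n \<Longrightarrow> \<bar>min T (u k) - real k * T / n\<bar> + T / n \<le> d"
    and s: "0 \<le> s" "s \<le> real j * T / n"
  defines "Q \<equiv> z * exp (r * T + \<kappa> * (R + h))"
  shows "\<bar>binomial_stock T r \<kappa> n z y s\<bar> \<le> Q"
    and "\<bar>bs_stock r \<kappa> B z \<omega> s - binomial_stock T r \<kappa> n z y s\<bar> \<le> Q * (r * d + \<kappa> * (w + h))"
proof -
  have jT: "real j * T / n \<le> T"
  proof -
    have "real j * T \<le> real n * T" using j T by (intro mult_right_mono) auto
    then show ?thesis using n by (simp add: field_simps)
  qed
  then have sT: "s \<le> T" using s by simp
  define i where "i = nat \<lfloor>real n * s / T\<rfloor>"
  have ns: "0 \<le> real n * s / T" using s T by simp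
  have i1: "real i \<le> real n * s / T" "real n * s / T < real i + 1" unfolding i_def using ns by linarith+
  have i2: "real i * T / n \<le> s" "s \<le> real i * T / n + T / n"
    using i1 T n by (simp_all add: field_simps)
  have ij: "i \<le> j"
  proof -
    have "real n * s / T \<le> real j" using s(2) T n by (simp add: field_simps)
    then have "real i \<le> real j" using i1(1) by linarith
    then show ?thesis by simp
  qed
  define \<Sigma> where "\<Sigma> = h * (\<Sum>k=1..i. y k)"
  have bin: "binomial_stock T r \<kappa> n z y s = z * exp (r * (real i * T / n) + \<kappa> * \<Sigma>)"
  proof -
    have "(\<Sum>k=1..i. r * T / n + \<kappa> * sqrt (T / n) * y k) = r * (real i * T / n) + \<kappa> * \<Sigma>"
      unfolding \<Sigma>_def by (simp add: sum.distrib h_def sum_distrib_left mult_ac)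
    then show ?thesis unfolding binomial_stock_def i_def[symmetric] by simp
  qed
  have main: "\<bar>\<Sigma>\<bar> \<le> R + h \<and> \<bar>b s - \<Sigma>\<bar> \<le> w + h"
  proof (cases "i < j")
    case True
    have "(\<Sum>k=1..i. y k) = (\<Sum>k=1..i. x k)" using True y(2) by (intro sum.cong) auto
    then have \<Sigma>: "\<Sigma> = b (u i)" unfolding \<Sigma>_def using x_sum[of i] ij j by simp
    have "i \<le> j - 1" using True by simp
    from u_mono[OF this] have ui: "u i \<le> T" using True uj by auto
    have "\<bar>u i - real i * T / n\<bar> + T / n \<le> d" using d[of i] ui ij j by (simp add: min_absorb2)
    then have "\<bar>s - u i\<bar> \<le> d" using i2 by linarith
    then have "\<bar>b s - b (u i)\<bar> \<le> w" using s sT u(1)[of i] ui by (intro w(2)) auto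
    then show ?thesis unfolding \<Sigma> using R(2)[OF u(1) ui] h(1) by linarith
  next
    case False
    then have i: "i = j" using ij by simp
    show ?thesis
    proof (cases "j = 0")
      case True
      then have "s = 0" using s by simp
      then show ?thesis unfolding \<Sigma>_def i True using R w h(1) b0 by simp
    next
      case False
      then have u': "u (j - 1) \<le> T" using uj by simp
      have "(\<Sum>k=1..j. y k) = (\<Sum>k=1..j - 1. y k) + y j" using False by (cases j) auto
      also have "(\<Sum>k=1..j - 1. y k) = (\<Sum>k=1..j - 1. x k)" using y(2) by (intro sum.cong) auto
      finally have \<Sigma>: "\<Sigma> = b (u (j - 1)) + h * y j"
        unfolding \<Sigma>_def i using x_sum[of "j - 1"] j by (simp add: distrib_left)
      have "y j = 1 \<or> y j = -1" using y(1) False j unfolding sign_vectors_def by (auto simp: PiE_iff)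
      then have yj: "\<bar>h * y j\<bar> = h" using h(1) by auto
      have "\<bar>u (j - 1) - real (j - 1) * T / n\<bar> + T / n \<le> d" using d[of "j - 1"] u' j by (simp add: min_absorb2)
      moreover have "real (j - 1) * T / n = real j * T / n - T / n" by (rule prev_grid) (use False in simp)
      moreover have "s = real j * T / n" using i2(1) s(2) i by simp
      moreover have "0 \<le> T / n" using T by simp
      ultimately have "\<bar>s - u (j - 1)\<bar> \<le> d" by (intro near_grid_point)
      then have "\<bar>b s - b (u (j - 1))\<bar> \<le> w" using s sT u(1) u' by (intro w(2)) auto
      then show ?thesis unfolding \<Sigma> using R(2)[OF u(1) u'] yj by linarith
    qed
  qed
  define a where "a = r * (real i * T / n) + \<kappa> * \<Sigma>"
  define a' where "a' = r * s + \<kappa> * b s"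
  have riT: "r * (real i * T / n) \<le> r * T" using i2(1) sT r by (intro mult_left_mono) auto
  have rsT: "r * s \<le> r * T" using sT r by (intro mult_left_mono) auto
  have aQ: "a \<le> r * T + \<kappa> * (R + h)"
  proof -
    have "\<kappa> * \<Sigma> \<le> \<kappa> * (R + h)" using main kap by (intro mult_left_mono) auto
    then show ?thesis unfolding a_def using riT by linarith
  qed
  have a'Q: "a' \<le> r * T + \<kappa> * (R + h)"
  proof -
    have "\<kappa> * b s \<le> \<kappa> * (R + h)" using R(2)[OF s(1) sT] kap h(1) by (intro mult_left_mono) auto
    then show ?thesis unfolding a'_def using rsT by linarith
  qed
  have "z * exp a \<le> Q" unfolding Q_def using aQ z by simp
  then show "\<bar>binomial_stock T r \<kappa> n z y s\<bar> \<le> Q" unfolding bin a_def using z by simp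
  have diff: "\<bar>a' - a\<bar> \<le> r * d + \<kappa> * (w + h)"
  proof -
    have dT: "T / n \<le> d" using d[of 0] abs_ge_zero[of "min T (u 0) - real 0 * T / n"] by linarith
    have "\<bar>s - real i * T / n\<bar> \<le> d" using i2 dT by linarith
    then have "\<bar>r * (s - real i * T / n)\<bar> \<le> r * d" using r by (simp add: abs_mult)
    moreover have "\<bar>\<kappa> * (b s - \<Sigma>)\<bar> \<le> \<kappa> * (w + h)" using main kap by (simp add: abs_mult)
    moreover have "a' - a = r * (s - real i * T / n) + \<kappa> * (b s - \<Sigma>)" unfolding a_def a'_def by (simp add: algebra_simps)
    ultimately show ?thesis by (rule abs_le_add)
  qed
  have expd: "\<bar>exp a' - exp a\<bar> \<le> exp (r * T + \<kappa> * (R + h)) * \<bar>a' - a\<bar>"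
    by (rule abs_exp_diff_le[OF a'Q aQ])
  have "\<bar>bs_stock r \<kappa> B z \<omega> s - binomial_stock T r \<kappa> n z y s\<bar> = z * \<bar>exp a' - exp a\<bar>"
    unfolding bin bs_stock_def a_def a'_def using z by (simp add: right_diff_distrib[symmetric] abs_mult)
  also have "\<dots> \<le> z * (exp (r * T + \<kappa> * (R + h)) * \<bar>a' - a\<bar>)" using expd z by (intro mult_left_mono) auto
  also have "\<dots> = Q * \<bar>a' - a\<bar>" unfolding Q_def by simp
  also have "\<dots> \<le> Q * (r * d + \<kappa> * (w + h))" using diff z unfolding Q_def by (intro mult_left_mono) auto
  finally show "\<bar>bs_stock r \<kappa> B z \<omega> s - binomial_stock T r \<kappa> n z y s\<bar> \<le> Q * (r * d + \<kappa> * (w + h))" .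
qed


text \<open>\<open>discounted_payoff_comparison\<close> for the two price paths, with all terms collected in powers of
\<open>exp (\<kappa> * R)\<close> and \<open>d + w + h\<close>.\<close>

lemma payoff_gap:
  assumes H: "regular_payoff H L T" and L: "0 \<le> L"
    and y: "y \<in> sign_vectors n" "\<And>k. k \<in> {1..<j} \<Longrightarrow> y k = x k" and j: "j \<le> n" and uj: "j = 0 \<or> u (j - 1) \<le> T"
    and R: "0 \<le> R" "\<And>t. 0 \<le> t \<Longrightarrow> t \<le> T \<Longrightarrow> \<bar>b t\<bar> \<le> R"
    and w: "0 \<le> w" "\<And>s t. 0 \<le> s \<Longrightarrow> s \<le> T \<Longrightarrow> 0 \<le> t \<Longrightarrow> t \<le> T \<Longrightarrow> \<bar>s - t\<bar> \<le> d \<Longrightarrow> \<bar>b s - b t\<bar> \<le> w"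
    and d: "\<And>k. k \<le> n \<Longrightarrow> \<bar>min T (u k) - real k * T / n\<bar> + T / n \<le> d"
    and t: "0 \<le> t" "t \<le> T" "\<bar>t - real j * T / n\<bar> \<le> d"
  shows "H t (bs_stock r \<kappa> B z \<omega>) - exp (r * (t - real j * T / n)) * H (real j * T / n) (binomial_stock T r \<kappa> n z y)
    \<le> payoff_const T r \<kappa> L * (H 0 (\<lambda>_. z) + z + 1) * (exp (\<kappa> * R) * (d + w + h))"
proof -
  define Q where "Q = z * exp (r * T + \<kappa> * (R + h))"
  define e where "e = Q * (r * d + \<kappa> * (w + h))"
  define K where "K = exp (r * T + \<kappa> * sqrt T)"
  define m where "m = exp (\<kappa> * R)"
  define E where "E = d + w + h"
  note sc = stock_comparison[OF y j uj R w d, folded Q_def, folded e_def]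
  have jT: "0 \<le> real j * T / n" "real j * T / n \<le> T"
  proof -
    have "real j * T \<le> real n * T" using j T by (intro mult_right_mono) auto
    then show "real j * T / n \<le> T" using n by (simp add: field_simps)
  qed (use T in simp)
  have dT: "T / n \<le> d" using d[of 0] abs_ge_zero[of "min T (u 0) - real 0 * T / n"] by linarith
  have d0: "0 \<le> d" using t(3) by linarith
  have Q0: "0 \<le> Q" unfolding Q_def using z by simp
  have e0: "0 \<le> e" unfolding e_def using Q0 r kap d0 w h(1) by (intro mult_nonneg_nonneg add_nonneg_nonneg) auto
  have expo: "r * s + \<kappa> * b s \<le> r * T + \<kappa> * (R + h)" if s: "0 \<le> s" "s \<le> T" for s
  proof -
    have "r * s \<le> r * T" using s r by (intro mult_left_mono) auto
    moreover have "\<kappa> * b s \<le> \<kappa> * (R + h)" using R(2)[OF s] kap h(1) by (intro mult_left_mono) auto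
    ultimately show ?thesis by linarith
  qed
  have vQ: "\<bar>bs_stock r \<kappa> B z \<omega> s\<bar> \<le> Q" if s: "0 \<le> s" "s \<le> T" for s
    unfolding bs_stock_def Q_def using expo[OF s] z by simp
  have vmod: "\<bar>bs_stock r \<kappa> B z \<omega> s - bs_stock r \<kappa> B z \<omega> s'\<bar> \<le> e"
    if s: "0 \<le> s" "s \<le> T" "0 \<le> s'" "s' \<le> T" "\<bar>s - s'\<bar> \<le> d" for s s'
  proof -
    let ?a = "r * s + \<kappa> * b s" and ?a' = "r * s' + \<kappa> * b s'"
    have "\<bar>bs_stock r \<kappa> B z \<omega> s - bs_stock r \<kappa> B z \<omega> s'\<bar> = z * \<bar>exp ?a - exp ?a'\<bar>"
      unfolding bs_stock_def using z by (simp add: right_diff_distrib[symmetric] abs_mult)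
    also have "\<dots> \<le> z * (exp (r * T + \<kappa> * (R + h)) * \<bar>?a - ?a'\<bar>)"
      using z by (intro mult_left_mono abs_exp_diff_le expo s) auto
    also have "\<dots> = Q * \<bar>?a - ?a'\<bar>" unfolding Q_def by simp
    also have "\<dots> \<le> e" unfolding e_def
    proof (intro mult_left_mono Q0)
      have "\<bar>r * (s - s')\<bar> \<le> r * d" using r s by (simp add: abs_mult)
      moreover have "\<bar>\<kappa> * (b s - b s')\<bar> \<le> \<kappa> * (w + h)" using kap w(2)[OF s] h(1) by (simp add: abs_mult)
      moreover have "?a - ?a' = r * (s - s') + \<kappa> * (b s - b s')" by (simp add: algebra_simps)
      ultimately show "\<bar>?a - ?a'\<bar> \<le> r * d + \<kappa> * (w + h)" by (rule abs_le_add)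
    qed
    finally show ?thesis .
  qed
  have main: "H t (bs_stock r \<kappa> B z \<omega>) - exp (r * (t - real j * T / n)) * H (real j * T / n) (binomial_stock T r \<kappa> n z y)
    \<le> L * (d * (1 + Q) + e) + L * (T + 1) * e + r * d * (H 0 (\<lambda>_. z) + L * (T * (1 + Q) + 2 * Q))"
  proof (rule discounted_payoff_comparison[OF H L])
    show "binomial_stock T r \<kappa> n z y 0 = z" unfolding binomial_stock_def by simp
  qed (use r bs_stock_path binomial_stock_path t jT Q0 e0 vQ vmod sc in auto)
  have H0: "0 \<le> H 0 (\<lambda>_. z)"
    using H[unfolded regular_payoff_def, THEN conjunct1, rule_format, of 0 "\<lambda>_. z"] by (simp add: path_space_def)
  have m1: "1 \<le> m" unfolding m_def using R kap by simp
  have K0: "0 \<le> K" unfolding K_def by simp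
  have E0: "0 \<le> E" unfolding E_def using d0 w h by simp
  have hT: "h \<le> sqrt T"
  proof -
    have "T / n \<le> T" using T n by (simp add: field_simps)
    then show ?thesis unfolding h_def by (rule real_sqrt_le_mono)
  qed
  have QK: "Q \<le> z * K * m"
  proof -
    have "\<kappa> * h \<le> \<kappa> * sqrt T" using hT kap by (intro mult_left_mono) auto
    then have "exp (r * T + \<kappa> * (R + h)) \<le> exp ((r * T + \<kappa> * sqrt T) + \<kappa> * R)" by (simp add: algebra_simps)
    then show ?thesis unfolding Q_def K_def m_def exp_add[of "r * T + \<kappa> * sqrt T"] using z by (simp add: mult.assoc)
  qed
  have eK: "e \<le> z * K * m * ((r + \<kappa>) * E)"
  proof -
    have "r * d \<le> r * E" "\<kappa> * (w + h) \<le> \<kappa> * E" unfolding E_def using r kap w h(1) d0 by (auto intro!: mult_left_mono)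
    then have "r * d + \<kappa> * (w + h) \<le> (r + \<kappa>) * E" by (simp add: distrib_right)
    then show ?thesis unfolding e_def using QK Q0 d0 w h(1) r kap z K0 m1
      by (intro mult_mono) auto
  qed
  have dE: "d \<le> E" unfolding E_def using w h(1) by simp
  have zK: "0 \<le> z * K" using z K0 by simp
  have 1: "L * (d * (1 + Q)) \<le> (L + L * K * z) * (m * E)"
  proof -
    have "1 + Q \<le> m * (1 + z * K)" using m1 QK by (simp add: algebra_simps)
    then have "d * (1 + Q) \<le> E * (m * (1 + z * K))" using dE d0 Q0 E0 by (intro mult_mono) auto
    then have "L * (d * (1 + Q)) \<le> L * (E * (m * (1 + z * K)))" using L by (intro mult_left_mono)
    then show ?thesis by (simp add: algebra_simps)
  qed
  have 2: "L * e + L * (T + 1) * e \<le> L * (T + 2) * K * (r + \<kappa>) * z * (m * E)"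
  proof -
    have "L * e + L * (T + 1) * e = L * (T + 2) * e" by (simp add: algebra_simps)
    also have "\<dots> \<le> L * (T + 2) * (z * K * m * ((r + \<kappa>) * E))" using eK L T by (intro mult_left_mono) auto
    finally show ?thesis by (simp add: mult_ac)
  qed
  have 3: "r * d * (H 0 (\<lambda>_. z) + L * (T * (1 + Q) + 2 * Q))
    \<le> (r * H 0 (\<lambda>_. z) + r * L * T + r * L * (T + 2) * K * z) * (m * E)"
  proof -
    have "T * (1 + Q) + 2 * Q = T + (T + 2) * Q" by (simp add: algebra_simps)
    also have "\<dots> \<le> T * m + (T + 2) * (z * K * m)" using QK T m1 by (intro add_mono mult_left_mono) auto
    finally have "L * (T * (1 + Q) + 2 * Q) \<le> L * (T * m + (T + 2) * (z * K * m))" using L by (intro mult_left_mono)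
    moreover have "H 0 (\<lambda>_. z) \<le> H 0 (\<lambda>_. z) * m" using H0 m1 by (simp add: mult_le_cancel_left1)
    ultimately have "H 0 (\<lambda>_. z) + L * (T * (1 + Q) + 2 * Q) \<le> m * (H 0 (\<lambda>_. z) + L * T + L * (T + 2) * K * z)"
      by (simp add: algebra_simps)
    moreover have "r * d \<le> r * E" using dE r by simp
    ultimately have "r * d * (H 0 (\<lambda>_. z) + L * (T * (1 + Q) + 2 * Q)) \<le> r * E * (m * (H 0 (\<lambda>_. z) + L * T + L * (T + 2) * K * z))"
      using r d0 E0 L T Q0 H0 by (intro mult_mono) auto
    then show ?thesis by (simp add: algebra_simps)
  qed
  define c where "c = payoff_const T r \<kappa> L"
  have c: "c = L + L * K + L * (T + 2) * K * (r + \<kappa>) + r + r * L * T + r * L * (T + 2) * K"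
    unfolding c_def payoff_const_def K_def Let_def ..
  have nn: "0 \<le> L * K" "0 \<le> L * (T + 2) * K * (r + \<kappa>)" "0 \<le> r * L * T" "0 \<le> r * L * (T + 2) * K"
    using L K0 T r kap by auto
  have c1: "L + r * L * T \<le> c" "L * K + L * (T + 2) * K * (r + \<kappa>) + r * L * (T + 2) * K \<le> c" "r \<le> c"
    unfolding c using nn L r by linarith+
  have "(L * K + L * (T + 2) * K * (r + \<kappa>) + r * L * (T + 2) * K) * z \<le> c * z" "r * H 0 (\<lambda>_. z) \<le> c * H 0 (\<lambda>_. z)"
    using c1 z H0 by (auto intro!: mult_right_mono)
  then have "(L + L * K * z) + L * (T + 2) * K * (r + \<kappa>) * z + (r * H 0 (\<lambda>_. z) + r * L * T + r * L * (T + 2) * K * z)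
      \<le> c * (H 0 (\<lambda>_. z) + z + 1)"
    using c1(1) by (simp add: algebra_simps)
  then have "((L + L * K * z) + L * (T + 2) * K * (r + \<kappa>) * z + (r * H 0 (\<lambda>_. z) + r * L * T + r * L * (T + 2) * K * z)) * (m * E)
      \<le> c * (H 0 (\<lambda>_. z) + z + 1) * (m * E)"
    using m1 E0 by (intro mult_right_mono) auto
  then have "L * (d * (1 + Q)) + (L * e + L * (T + 1) * e) + r * d * (H 0 (\<lambda>_. z) + L * (T * (1 + Q) + 2 * Q))
      \<le> c * (H 0 (\<lambda>_. z) + z + 1) * (m * E)"
    using 1 2 3 unfolding distrib_right[of _ _ "m * E"] by linarith
  then show ?thesis using main unfolding c_def m_def E_def distrib_left[of L] by linarith
qed

text \<open>If the buyer exercises first, the relevant grid time is that of the first hit at or after \<open>t\<close>, or the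
last one if there is none before the horizon. If the seller cancels first, this happens at a hitting
time, where the portfolio values of both markets agree.\<close>

lemma shortfall_le:
  assumes pf: "payoff_functionals F \<Delta> L" and pred: "predictable_holdings n \<gamma>" and mu: "\<mu> \<in> discrete_stopping n"
    and hedge: "\<And>y k. y \<in> sign_vectors n \<Longrightarrow> k \<le> n \<Longrightarrow>
      game_payoff F \<Delta> (binomial_stock T r \<kappa> n z y) (real (\<mu> y) * T / n) (real k * T / n)
        \<le> binomial_value T r \<kappa> n z Z0 \<gamma> y (min (\<mu> y) k)"
    and R: "0 \<le> R" "\<And>t. 0 \<le> t \<Longrightarrow> t \<le> T \<Longrightarrow> \<bar>b t\<bar> \<le> R"
    and w: "0 \<le> w" "\<And>s t. 0 \<le> s \<Longrightarrow> s \<le> T \<Longrightarrow> 0 \<le> t \<Longrightarrow> t \<le> T \<Longrightarrow> \<bar>s - t\<bar> \<le> d \<Longrightarrow> \<bar>b s - b t\<bar> \<le> w"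
    and d: "\<And>k. k \<le> n \<Longrightarrow> \<bar>min T (u k) - real k * T / n\<bar> + T / n \<le> d"
    and t: "0 \<le> t" "t \<le> T"
  shows "shortfall T r \<kappa> F \<Delta> B n z Z0 \<gamma> \<omega> (cancel_time T \<kappa> B n \<mu> \<omega>) t
    \<le> payoff_const T r \<kappa> L * (F 0 (\<lambda>_. z) + \<Delta> 0 (\<lambda>_. z) + z + 1) * (exp (\<kappa> * R) * (d + w + h))"
proof -
  let ?v = "bs_stock r \<kappa> B z \<omega>"
  let ?V = "bs_value T r \<kappa> B n z Z0 \<gamma> \<omega>"
  let ?X = "exp (\<kappa> * R) * (d + w + h)"
  let ?bound = "payoff_const T r \<kappa> L * (F 0 (\<lambda>_. z) + \<Delta> 0 (\<lambda>_. z) + z + 1) * ?X"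
  define \<phi> where "\<phi> = \<mu> x"
  define \<sigma> where "\<sigma> = cancel_time T \<kappa> B n \<mu> \<omega>"
  have L: "0 \<le> L" using pf[unfolded payoff_functionals_def, THEN conjunct1] by simp
  have dT: "T / n \<le> d" using d[of 0] abs_ge_zero[of "min T (u 0) - real 0 * T / n"] by linarith
  have X0: "0 \<le> ?X" using dT w h(1) T by (intro mult_nonneg_nonneg add_nonneg_nonneg) (auto intro: order_trans[of 0 "T / n"])
  have c0: "0 \<le> payoff_const T r \<kappa> L"
    unfolding payoff_const_def Let_def using L T r kap by (intro add_nonneg_nonneg mult_nonneg_nonneg) auto
  have path0: "(\<lambda>_. z) \<in> path_space 0" by (simp add: path_space_def)
  have FD: "0 \<le> F 0 (\<lambda>_. z)" "0 \<le> \<Delta> 0 (\<lambda>_. z)" using payoff_functionals_nonneg[OF pf order.refl path0] .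
  have bound0: "0 \<le> ?bound" 
  proof (rule mult_nonneg_nonneg[OF mult_nonneg_nonneg[OF c0] X0])
    show "0 \<le> F 0 (\<lambda>_. z) + \<Delta> 0 (\<lambda>_. z) + z + 1" using FD z by linarith
  qed
  have "\<mu> x \<in> {0..n}" using mu x_sign unfolding discrete_stopping_def by blast
  then have phi: "\<phi> \<le> n" unfolding \<phi>_def by simp
  have sigma: "\<sigma> = (if \<phi> < n then min T (u \<phi>) else T)"
  proof (cases "\<phi> < n")
    case True
    then show ?thesis unfolding \<sigma>_def cancel_time_def Let_def \<phi>_def[symmetric] u(2) by simp
  next
    case False
    then have "\<phi> = n" using phi by simp
    then show ?thesis unfolding \<sigma>_def cancel_time_def Let_def \<phi>_def[symmetric] by simp
  qed
  have Fb: "payoff_const T r \<kappa> L * (F 0 (\<lambda>_. z) + z + 1) * ?X \<le> ?bound"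
    using c0 FD X0 by (intro mult_right_mono mult_left_mono) auto
  have gapF: "F s ?v - ?V s \<le> ?bound"
    if j: "j \<le> n" "j = 0 \<or> u (j - 1) \<le> T" and y: "y \<in> sign_vectors n" "\<And>k. k \<in> {1..<j} \<Longrightarrow> y k = x k" and jmu: "j \<le> \<mu> y"
      and V: "?V s \<ge> exp (r * (s - real j * T / n)) * binomial_value T r \<kappa> n z Z0 \<gamma> y j"
      and s: "0 \<le> s" "s \<le> T" "\<bar>s - real j * T / n\<bar> \<le> d" for j y s
  proof -
    have le: "real j * T / n \<le> real (\<mu> y) * T / n" using jmu T n by (intro divide_right_mono mult_right_mono) auto
    have "F (real j * T / n) (binomial_stock T r \<kappa> n z y) \<le> binomial_value T r \<kappa> n z Z0 \<gamma> y j"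
      using hedge[OF y(1) j(1)] le jmu unfolding game_payoff_def by (simp add: min_absorb2)
    then have "exp (r * (s - real j * T / n)) * F (real j * T / n) (binomial_stock T r \<kappa> n z y)
      \<le> exp (r * (s - real j * T / n)) * binomial_value T r \<kappa> n z Z0 \<gamma> y j" by (rule mult_left_mono) simp
    moreover have "F s ?v - exp (r * (s - real j * T / n)) * F (real j * T / n) (binomial_stock T r \<kappa> n z y)
      \<le> payoff_const T r \<kappa> L * (F 0 (\<lambda>_. z) + z + 1) * ?X"
      by (rule payoff_gap[OF regular_payoff_F[OF pf] L y j R w d s])
    ultimately show ?thesis using V Fb by linarith
  qed
  have "game_payoff F \<Delta> ?v \<sigma> t - ?V (min \<sigma> t) \<le> ?bound"
  proof (cases "t \<le> \<sigma>")
    case True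
    then have pay: "game_payoff F \<Delta> ?v \<sigma> t - ?V (min \<sigma> t) = F t ?v - ?V t"
      unfolding game_payoff_def by (simp add: min_absorb2)
    show ?thesis unfolding pay
    proof (cases "t \<le> u \<phi>")
      case tu: True
      \<comment> \<open>The next hit after the exercise time.\<close>
      define j where "j = (LEAST j. t \<le> u j)"
      have j1: "t \<le> u j" unfolding j_def using tu by (rule LeastI)
      have j2: "j \<le> \<phi>" unfolding j_def using tu by (rule Least_le)
      have jn: "j \<le> n" using j2 phi by simp
      show "F t ?v - ?V t \<le> ?bound"
      proof (cases "j = 0")
        case True
        then have t0: "t = u 0" using j1 u_0 t by simp
        show ?thesis
        proof (rule gapF[of 0 x])
          show "?V t \<ge> exp (r * (t - real 0 * T / n)) * binomial_value T r \<kappa> n z Z0 \<gamma> x 0"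
            using bs_value_at_hit[of 0 t] t0 by simp
          show "\<bar>t - real 0 * T / n\<bar> \<le> d" using t0 u_0 dT T by (simp add: order_trans[of 0 "T / n"])
        qed (use t x_sign in auto)
      next
        case False
        have tj: "u (j - 1) < t"
        proof (rule ccontr)
          assume "\<not> u (j - 1) < t"
          then have "j \<le> j - 1" unfolding j_def[of] by (intro Least_le) (simp add: j_def)
          then show False using False by simp
        qed
        have dev: "\<bar>t - real j * T / n\<bar> \<le> d"
        proof -
          have "min T (u (j - 1)) = u (j - 1)" using tj t by simp
          then have "\<bar>u (j - 1) - real (j - 1) * T / n\<bar> + T / n \<le> d" using d[of "j - 1"] jn by simp
          moreover have "real (j - 1) * T / n = real j * T / n - T / n" by (rule prev_grid) (use False in simp)
          moreover have "\<bar>min T (u j) - real j * T / n\<bar> + T / n \<le> d" by (rule d[OF jn])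
          moreover have "t \<le> min T (u j)" using j1 t by simp
          moreover have "0 \<le> T / n" using T by simp
          ultimately show ?thesis using tj by (intro near_grid_interval)
        qed
        have "1 \<le> j" using False by simp
        then obtain y where y: "y \<in> sign_vectors n" "\<And>k. k \<in> {1..<j} \<Longrightarrow> y k = x k"
          "?V t \<ge> exp (r * (t - real j * T / n)) * binomial_value T r \<kappa> n z Z0 \<gamma> y j"
          using bs_value_between_hits[OF pred _ jn less_imp_le[OF tj] j1] by blast
        \<comment> \<open>A cancellation of \<open>y\<close> before step \<open>j\<close> would depend only on signs shared with \<open>x\<close>.\<close>
        have jmu: "j \<le> \<mu> y"
        proof (rule ccontr)
          assume c: "\<not> j \<le> \<mu> y"
          have "\<forall>k\<in>{1..\<mu> y}. x k = y k" using y(2) c by auto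
          then have "\<mu> x = \<mu> y" using mu y(1) x_sign unfolding discrete_stopping_def by blast
          then show False using c j2 unfolding \<phi>_def by simp
        qed
        show ?thesis by (rule gapF[OF jn _ y(1,2) jmu y(3) t dev]) (use tj t in auto)
      qed
    next
      case False
      \<comment> \<open>Past the \<open>\<phi>\<close>-th hit and not past the cancellation: the seller waits until \<open>T\<close>.\<close>
      have phin: "\<phi> = n"
      proof (rule ccontr)
        assume "\<phi> \<noteq> n"
        then show False using sigma phi True False by simp
      qed
      then have un: "u n \<le> t" using False by simp
      have "u (n - 1) \<le> u n" by (rule u_mono) simp
      show "F t ?v - ?V t \<le> ?bound"
      proof (rule gapF[of n x])
        show "n = 0 \<or> u (n - 1) \<le> T" using \<open>u (n - 1) \<le> u n\<close> un t by simp
        show "n \<le> \<mu> x" using phin unfolding \<phi>_def by simp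
        show "?V t \<ge> exp (r * (t - real n * T / n)) * binomial_value T r \<kappa> n z Z0 \<gamma> x n"
          using bs_value_at_hit[of n t] un by simp
        have "min T (u n) = u n" using un t by simp
        then have "\<bar>u n - real n * T / n\<bar> + T / n \<le> d" using d[of n] by simp
        moreover have "real n * T / n = T" using n by simp
        moreover have "0 \<le> T / n" using T by simp
        ultimately show "\<bar>t - real n * T / n\<bar> \<le> d" using un t by linarith
      qed (use t x_sign in auto)
    qed
  next
    case False
    then have st: "\<sigma> < t" by simp
    have phin: "\<phi> < n" using sigma st t phi by (metis leD)
    have su: "\<sigma> = u \<phi>" "u \<phi> \<le> T" using sigma phin st t by (auto simp: min_def split: if_splits)
    let ?G = "\<lambda>t v. F t v + \<Delta> t v"
    have pay: "game_payoff F \<Delta> ?v \<sigma> t - ?V (min \<sigma> t) = ?G (u \<phi>) ?v - ?V (u \<phi>)"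
      unfolding game_payoff_def using st su by simp
    have V: "?V (u \<phi>) = exp (r * (u \<phi> - real \<phi> * T / n)) * binomial_value T r \<kappa> n z Z0 \<gamma> x \<phi>"
      using bs_value_at_hit[OF phi] by simp
    have lt: "real \<phi> * T / n < real n * T / n" using phin T n by (intro divide_strict_right_mono mult_strict_right_mono) auto
    have "?G (real \<phi> * T / n) (binomial_stock T r \<kappa> n z x) \<le> binomial_value T r \<kappa> n z Z0 \<gamma> x \<phi>"
      using hedge[OF x_sign order.refl] lt phin unfolding game_payoff_def \<phi>_def[symmetric] by (simp add: min_absorb1)
    then have "exp (r * (u \<phi> - real \<phi> * T / n)) * ?G (real \<phi> * T / n) (binomial_stock T r \<kappa> n z x) \<le> ?V (u \<phi>)"
      unfolding V by (rule mult_left_mono) simp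
    moreover have "?G (u \<phi>) ?v - exp (r * (u \<phi> - real \<phi> * T / n)) * ?G (real \<phi> * T / n) (binomial_stock T r \<kappa> n z x) \<le> ?bound"
    proof (rule payoff_gap[OF regular_payoff_G[OF pf] L x_sign _ phi _ R w d u(1) su(2)])
      have "u (\<phi> - 1) \<le> u \<phi>" by (rule u_mono) simp
      then show "\<phi> = 0 \<or> u (\<phi> - 1) \<le> T" using su by simp
      have "min T (u \<phi>) = u \<phi>" using su by simp
      then have "\<bar>u \<phi> - real \<phi> * T / n\<bar> + T / n \<le> d" using d[OF phi] by simp
      moreover have "0 \<le> T / n" using T by simp
      ultimately show "\<bar>u \<phi> - real \<phi> * T / n\<bar> \<le> d" by linarith
    qed auto
    ultimately show ?thesis unfolding pay by linarith
  qed
  then show ?thesis unfolding shortfall_def \<sigma>_def[symmetric] using bound0 by simp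
qed

end

section \<open>The shortfall of the transferred hedge\<close>


text \<open>Independence is a property of the joint law.\<close>

lemma (in prob_space) indep_vars_AE_cong:
  fixes X Y :: "nat \<Rightarrow> 'a \<Rightarrow> real"
  assumes X: "indep_vars (\<lambda>_. borel) X I" and I: "finite I"
    and Y: "\<And>i. i \<in> I \<Longrightarrow> Y i \<in> borel_measurable M"
    and eq: "AE \<omega> in M. \<forall>i\<in>I. X i \<omega> = Y i \<omega>"
  shows "indep_vars (\<lambda>_. borel) Y I"
proof (cases "I = {}")
  case True
  then show ?thesis by (simp add: indep_vars_def indep_sets_def)
next
  case False
  have Xm: "X i \<in> borel_measurable M" if "i \<in> I" for i using X that unfolding indep_vars_def by auto
  have "distr M (PiM I (\<lambda>_. borel)) (\<lambda>x. \<lambda>i\<in>I. Y i x) = distr M (PiM I (\<lambda>_. borel)) (\<lambda>x. \<lambda>i\<in>I. X i x)"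
  proof (rule distr_cong_AE)
    show "AE x in M. (\<lambda>i\<in>I. Y i x) = (\<lambda>i\<in>I. X i x)"
      using eq by eventually_elim (auto simp: fun_eq_iff)
  qed (auto intro!: measurable_restrict Xm Y)
  also have "\<dots> = PiM I (\<lambda>i. distr M borel (X i))"
    using indep_vars_iff_distr_eq_PiM'[OF False, of X "\<lambda>_. borel"] X Xm by simp
  also have "\<dots> = PiM I (\<lambda>i. distr M borel (Y i))"
  proof (rule PiM_cong[OF refl])
    fix i assume i: "i \<in> I"
    show "distr M borel (X i) = distr M borel (Y i)"
    proof (rule distr_cong_AE)
      show "AE x in M. X i x = Y i x" using eq by eventually_elim (use i in auto)
    qed (use Xm Y i in auto)
  qed
  finally show ?thesis
    using indep_vars_iff_distr_eq_PiM'[OF False, of Y "\<lambda>_. borel"] Y by simp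
qed

text \<open>Redefine the paths as \<open>0\<close> on a null set.\<close>

lemma continuous_modification:
  assumes B: "standard_brownian_motion M B"
  obtains W Z where "Z \<in> null_sets M" "\<And>t \<omega>. \<omega> \<in> space M - Z \<Longrightarrow> W t \<omega> = B t \<omega>" "continuous_bm M W"
proof -
  interpret prob_space M using B unfolding standard_brownian_motion_def by blast
  have Bm: "B t \<in> borel_measurable M" if "0 \<le> t" for t
    using B that unfolding standard_brownian_motion_def by blast
  have Bg: "distributed M lborel (\<lambda>\<omega>. B t \<omega> - B s \<omega>) (\<lambda>x. ennreal (normal_density 0 (sqrt (t - s)) x))"
    if "0 \<le> s" "s < t" for s t
    using B that unfolding standard_brownian_motion_def by blast
  have Bi: "indep_vars (\<lambda>_. borel) (\<lambda>i \<omega>. B (\<tau> (Suc i)) \<omega> - B (\<tau> i) \<omega>) {..<m}"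
    if "0 \<le> \<tau> 0" "\<And>i. i < m \<Longrightarrow> \<tau> i \<le> \<tau> (Suc i)" for \<tau> and m :: nat
  proof -
    have "\<forall>(m::nat) t. 0 \<le> t 0 \<and> (\<forall>i<m. t i \<le> t (Suc i)) \<longrightarrow>
        indep_vars (\<lambda>_. borel) (\<lambda>i \<omega>. B (t (Suc i)) \<omega> - B (t i) \<omega>) {..<m}"
      using B[unfolded standard_brownian_motion_def] by (elim conjE)
    from this[rule_format, of \<tau> m] that show ?thesis by blast
  qed
  have "AE \<omega> in M. B 0 \<omega> = 0 \<and> continuous_on {0..} (\<lambda>t. B t \<omega>)"
    using B unfolding standard_brownian_motion_def by auto
  then obtain Z where Z: "{\<omega> \<in> space M. \<not> (B 0 \<omega> = 0 \<and> continuous_on {0..} (\<lambda>t. B t \<omega>))} \<subseteq> Z"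
    "emeasure M Z = 0" "Z \<in> sets M" by (rule AE_E)
  define W where "W t \<omega> = (if \<omega> \<in> Z then 0 else B t \<omega>)" for t \<omega>
  have Wm: "W t \<in> borel_measurable M" if "0 \<le> t" for t
    unfolding W_def using Bm[OF that] Z(3) by (intro measurable_If_set) (auto simp: Int_absorb2 sets.sets_into_space)
  have Znull: "Z \<in> null_sets M" using Z by auto
  have AEZ: "AE \<omega> in M. \<omega> \<notin> Z" by (rule AE_not_in[OF Znull])
  have "continuous_bm M W"
  proof
    show "W t \<in> borel_measurable M" if "0 \<le> t" for t by (rule Wm[OF that])
    show "W 0 \<omega> = 0" if "\<omega> \<in> space M" for \<omega> using Z(1) that unfolding W_def by auto
    show "continuous_on {0..} (\<lambda>t. W t \<omega>)" if "\<omega> \<in> space M" for \<omega>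
    proof (cases "\<omega> \<in> Z")
      case False
      then show ?thesis using Z(1) that unfolding W_def by auto
    qed (simp add: W_def)
    show "distributed M lborel (\<lambda>\<omega>. W t \<omega> - W s \<omega>) (\<lambda>x. ennreal (normal_density 0 (sqrt (t - s)) x))"
      if st: "0 \<le> s" "s < t" for s t
    proof -
      have m: "(\<lambda>\<omega>. W t \<omega> - W s \<omega>) \<in> borel_measurable M" "(\<lambda>\<omega>. B t \<omega> - B s \<omega>) \<in> borel_measurable M"
        using st by (auto intro!: borel_measurable_diff Wm Bm)
      have "distr M lborel (\<lambda>\<omega>. W t \<omega> - W s \<omega>) = distr M lborel (\<lambda>\<omega>. B t \<omega> - B s \<omega>)"
      proof (rule distr_cong_AE)
        show "AE \<omega> in M. W t \<omega> - W s \<omega> = B t \<omega> - B s \<omega>"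
          using AEZ by eventually_elim (simp add: W_def)
      qed (use m in auto)
      then show ?thesis using Bg[OF st] m unfolding distributed_def by auto
    qed
    show "indep_vars (\<lambda>_. borel) (\<lambda>i \<omega>. W (\<tau> (Suc i)) \<omega> - W (\<tau> i) \<omega>) {..<m}"
      if \<tau>: "0 \<le> \<tau> 0" "\<And>i. i < m \<Longrightarrow> \<tau> i \<le> \<tau> (Suc i)" for \<tau> and m :: nat
    proof (rule indep_vars_AE_cong[OF Bi[OF \<tau>]])
      have pos: "0 \<le> \<tau> i" if "i \<le> m" for i using that
      proof (induction i)
        case (Suc i) then show ?case using \<tau>(2)[of i] by simp
      qed (use \<tau> in simp)
      show "(\<lambda>\<omega>. W (\<tau> (Suc i)) \<omega> - W (\<tau> i) \<omega>) \<in> borel_measurable M" if "i \<in> {..<m}" for i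
        using that by (intro borel_measurable_diff Wm pos) auto
      show "AE \<omega> in M. \<forall>i\<in>{..<m}. B (\<tau> (Suc i)) \<omega> - B (\<tau> i) \<omega> = W (\<tau> (Suc i)) \<omega> - W (\<tau> i) \<omega>"
        using AEZ by eventually_elim (simp add: W_def)
    qed auto
  qed
  then show ?thesis using Znull that[of Z W] by (auto simp: W_def)
qed

lemma binomial_hedge_everywhere:
  assumes kap: "0 < \<kappa>" "0 < T" and n: "n \<ge> 1" and iid: "iid_signs N \<xi> (up_prob T \<kappa> n)"
    and hedge: "binomial_hedge T r \<kappa> F \<Delta> N \<xi> n z \<mu> Z0 \<gamma>" and y: "y \<in> sign_vectors n" and k: "k \<le> n"
  shows "game_payoff F \<Delta> (binomial_stock T r \<kappa> n z y) (real (\<mu> y) * T / n) (real k * T / n)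
        \<le> binomial_value T r \<kappa> n z Z0 \<gamma> y (min (\<mu> y) k)"
proof -
  have p: "0 < up_prob T \<kappa> n" "up_prob T \<kappa> n < 1" unfolding up_prob_def by (auto simp: add_pos_pos)
  have "\<forall>k\<in>{0..n}. binomial_value T r \<kappa> n z Z0 \<gamma> y (min (\<mu> y) k)
      \<ge> game_payoff F \<Delta> (binomial_stock T r \<kappa> n z y) (real (\<mu> y) * T / n) (real k * T / n)"
    by (rule hedge_holds_everywhere[OF iid p _ y]) (use hedge in \<open>simp add: binomial_hedge_def Let_def\<close>)
  then show ?thesis using k by simp
qed

lemma pathwise_shortfall_bound:
  assumes pos: "0 < T" "0 < r" "0 < \<kappa>" and pf: "payoff_functionals F \<Delta> L"
    and n1: "n \<ge> 1" and z0: "0 < z" and iid: "iid_signs N \<xi> (up_prob T \<kappa> n)"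
    and mu: "\<mu> \<in> discrete_stopping n" and pred: "predictable_holdings n \<gamma>"
    and hedge: "binomial_hedge T r \<kappa> F \<Delta> N \<xi> n z \<mu> Z0 \<gamma>"
    and cont: "continuous_on {0..} (bstar \<kappa> B \<omega>)" "bstar \<kappa> B \<omega> 0 = 0"
    and fin: "\<And>k. \<exists>u\<ge>0. embed_time T \<kappa> B n k \<omega> = ereal u"
    and pc: "path_control T \<kappa> B n \<omega> R d w"
    and t: "t \<in> {0..T}"
  shows "shortfall T r \<kappa> F \<Delta> B n z Z0 \<gamma> \<omega> (cancel_time T \<kappa> B n \<mu> \<omega>) t
    \<le> payoff_const T r \<kappa> L * (F 0 (\<lambda>_. z) + \<Delta> 0 (\<lambda>_. z) + z + 1) * (exp (\<kappa> * R) * (d + w + sqrt (T / n)))"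
proof -
  have R: "0 \<le> R" "\<forall>t\<in>{0..T}. \<bar>bstar \<kappa> B \<omega> t\<bar> \<le> R"
    and d: "\<forall>k\<le>n. \<bar>capped T (embed_time T \<kappa> B n k \<omega>) - real k * T / n\<bar> + T / n \<le> d"
    and w: "0 \<le> w" "\<forall>s\<in>{0..T}. \<forall>t\<in>{0..T}. \<bar>s - t\<bar> \<le> d \<longrightarrow> \<bar>bstar \<kappa> B \<omega> s - bstar \<kappa> B \<omega> t\<bar> \<le> w"
    using pc unfolding path_control_def by simp_all
  obtain u where u: "\<And>k. 0 \<le> u k" "\<And>k. embed_time T \<kappa> B n k \<omega> = ereal (u k)"
    using fin by metis
  interpret embedded_path T r \<kappa> n z B \<omega> u
    by unfold_locales (use pos n1 z0 cont u in auto)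
  have "shortfall T r \<kappa> F \<Delta> B n z Z0 \<gamma> \<omega> (cancel_time T \<kappa> B n \<mu> \<omega>) t
    \<le> payoff_const T r \<kappa> L * (F 0 (\<lambda>_. z) + \<Delta> 0 (\<lambda>_. z) + z + 1) * (exp (\<kappa> * R) * (d + w + h))"
  proof (rule shortfall_le[OF pf pred mu _ R(1) _ w(1)])
    show "game_payoff F \<Delta> (binomial_stock T r \<kappa> n z y) (real (\<mu> y) * T / n) (real k * T / n)
        \<le> binomial_value T r \<kappa> n z Z0 \<gamma> y (min (\<mu> y) k)" if "y \<in> sign_vectors n" "k \<le> n" for y k
      by (rule binomial_hedge_everywhere[OF pos(3,1) n1 iid hedge that])
    show "\<bar>min T (u k) - real k * T / n\<bar> + T / n \<le> d" if "k \<le> n" for k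
      using d that unfolding u(2) by simp
  qed (use R w t in auto)
  then show ?thesis unfolding h_def .
qed

lemma ln_powr_le_powr:
  fixes x \<epsilon> :: real
  assumes "1 \<le> x" "0 < \<epsilon>"
  shows "ln x powr (3 / 4) \<le> (3 / (4 * \<epsilon>)) powr (3 / 4) * x powr \<epsilon>"
proof -
  have "ln x \<le> x powr (4 * \<epsilon> / 3) / (4 * \<epsilon> / 3)" using assms by (intro ln_powr_bound) auto
  then have "ln x powr (3 / 4) \<le> (x powr (4 * \<epsilon> / 3) / (4 * \<epsilon> / 3)) powr (3 / 4)"
    using assms by (intro powr_mono2) auto
  also have "x powr (4 * \<epsilon> / 3) / (4 * \<epsilon> / 3) = 3 / (4 * \<epsilon>) * x powr (4 * \<epsilon> / 3)" using assms by (simp add: field_simps)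
  also have "\<dots> powr (3 / 4) = (3 / (4 * \<epsilon>)) powr (3 / 4) * (x powr (4 * \<epsilon> / 3)) powr (3 / 4)"
    by (rule powr_mult)
  also have "(x powr (4 * \<epsilon> / 3)) powr (3 / 4) = x powr \<epsilon>" by (simp add: powr_powr)
  finally show ?thesis .
qed

theorem theorem2p3:
  fixes T r \<kappa> L :: real
    and F \<Delta> :: "real \<Rightarrow> (real \<Rightarrow> real) \<Rightarrow> real"
    and M :: "'a measure" and B :: "real \<Rightarrow> 'a \<Rightarrow> real"
    and N :: "nat \<Rightarrow> 'b measure" and \<xi> :: "nat \<Rightarrow> nat \<Rightarrow> 'b \<Rightarrow> real"
  assumes "T > 0" "r > 0" "\<kappa> > 0"
    and "payoff_functionals F \<Delta> L"
    and "complete_measure M"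
    and "standard_brownian_motion M B"
    and "\<And>n. n \<ge> 1 \<Longrightarrow> iid_signs (N n) (\<xi> n) (up_prob T \<kappa> n)"
  shows "\<exists>C>0. \<exists>C\<^sub>\<epsilon> :: real \<Rightarrow> real. (\<forall>\<epsilon>>0. C\<^sub>\<epsilon> \<epsilon> > 0) \<and>
    (\<forall>z>0. \<forall>n\<ge>2. \<forall>\<mu>\<in>discrete_stopping n. \<forall>Z0 \<gamma>.
       predictable_holdings n \<gamma> \<longrightarrow> binomial_hedge T r \<kappa> F \<Delta> (N n) (\<xi> n) n z \<mu> Z0 \<gamma> \<longrightarrow>
       (SUP \<tau>\<in>bounded_stopping_times M B T.
          \<integral>\<^sup>+\<omega>. ennreal (shortfall T r \<kappa> F \<Delta> B n z Z0 \<gamma> \<omega> (cancel_time T \<kappa> B n \<mu> \<omega>) (\<tau> \<omega>)) \<partial>M)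
         \<le> ennreal (C * (F 0 (\<lambda>_. z) + \<Delta> 0 (\<lambda>_. z) + z + 1)
                     * real n powr (- 1 / 4) * ln (real n) powr (3 / 4)) \<and>
       (\<forall>\<epsilon>>0.
          (\<integral>\<^sup>+\<omega>. (SUP t\<in>{0..T}. ennreal
             (shortfall T r \<kappa> F \<Delta> B n z Z0 \<gamma> \<omega> (cancel_time T \<kappa> B n \<mu> \<omega>) t)) \<partial>M)
            \<le> ennreal (C\<^sub>\<epsilon> \<epsilon> * (F 0 (\<lambda>_. z) + \<Delta> 0 (\<lambda>_. z) + z + 1)
                        * real n powr (- 1 / 4 + \<epsilon>))))"
proof -
  note T = assms(1-3) and pf = assms(4) and BM = assms(6) and iid = assms(7)
  obtain W Z where Z: "Z \<in> null_sets M" and WB: "\<And>t \<omega>. \<omega> \<in> space M - Z \<Longrightarrow> W t \<omega> = B t \<omega>"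
    and Wbm: "continuous_bm M W"
    by (rule continuous_modification[OF BM]) (rule that)
  interpret continuous_bm M W by (rule Wbm)
  obtain C0 where C0: "0 < C0" and bound: "\<And>n. 2 \<le> n \<Longrightarrow> \<exists>U. mean_le U (C0 * real n powr (- 1 / 4) * ln (real n) powr (3 / 4)) \<and>
    (\<forall>\<omega>\<in>space M. \<exists>R d w. path_control T \<kappa> W n \<omega> R d w \<and> exp (\<kappa> * R) * (d + w + sqrt (T / n)) \<le> U \<omega>)"
    using embedding_error_bound[OF T(1,3,3)] by blast
  define K where "K = payoff_const T r \<kappa> L"
  have K: "0 < K"
  proof -
    have L: "1 \<le> L" using pf[unfolded payoff_functionals_def] by (rule conjunct1)
    then show ?thesis unfolding K_def payoff_const_def Let_def using T
      by (intro add_pos_nonneg add_pos_pos mult_pos_pos) auto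
  qed
  define C where "C = K * C0"
  have C: "0 < C" unfolding C_def using K C0 by simp
  define f where "f z = F 0 (\<lambda>_. z) + \<Delta> 0 (\<lambda>_. z) + z + 1" for z
  define g where "g n = real n powr (- 1 / 4) * ln (real n) powr (3 / 4)" for n :: nat
  have f0: "0 \<le> f z" if "0 < z" for z
  proof -
    have "(\<lambda>_. z) \<in> path_space 0" by (simp add: path_space_def)
    from payoff_functionals_nonneg[OF pf order.refl this] show ?thesis unfolding f_def using that by linarith
  qed
  have sup_bound: "(\<integral>\<^sup>+\<omega>. (SUP t\<in>{0..T}. ennreal (shortfall T r \<kappa> F \<Delta> B n z Z0 \<gamma> \<omega> (cancel_time T \<kappa> B n \<mu> \<omega>) t)) \<partial>M)
      \<le> ennreal (C * f z * g n)"
    if z: "0 < z" and n: "2 \<le> n" and mu: "\<mu> \<in> discrete_stopping n" and pred: "predictable_holdings n \<gamma>"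
      and hedge: "binomial_hedge T r \<kappa> F \<Delta> (N n) (\<xi> n) n z \<mu> Z0 \<gamma>" for z n \<mu> Z0 \<gamma>
  proof -
    obtain U where U: "mean_le U (C0 * real n powr (- 1 / 4) * ln (real n) powr (3 / 4))" and
      est: "\<And>\<omega>. \<omega> \<in> space M \<Longrightarrow> \<exists>R d w. path_control T \<kappa> W n \<omega> R d w \<and> exp (\<kappa> * R) * (d + w + sqrt (T / n)) \<le> U \<omega>"
      using bound[OF n] by blast
    have n1: "1 \<le> n" using n by simp
    have h0: "0 < sqrt (T / n)" using T n by simp
    have "AE \<omega> in M. (SUP t\<in>{0..T}. ennreal (shortfall T r \<kappa> F \<Delta> B n z Z0 \<gamma> \<omega> (cancel_time T \<kappa> B n \<mu> \<omega>) t))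
        \<le> ennreal (K * f z * U \<omega>)"
      using hitting_finite_AE[OF T(3) h0] AE_not_in[OF Z] AE_space
    proof eventually_elim
      case (elim \<omega>)
      then have "(\<lambda>t. W t \<omega>) = (\<lambda>t. B t \<omega>)" using WB by auto
      then have b: "bstar \<kappa> W \<omega> = bstar \<kappa> B \<omega>" unfolding bstar_def by (simp add: fun_eq_iff)
      have e: "embed_time T \<kappa> W n k \<omega> = embed_time T \<kappa> B n k \<omega>" for k unfolding embed_time_def b ..
      obtain R d w where pcW: "path_control T \<kappa> W n \<omega> R d w"
        and le: "exp (\<kappa> * R) * (d + w + sqrt (T / n)) \<le> U \<omega>"
        using est[OF elim(3)] by blast
      have pc: "path_control T \<kappa> B n \<omega> R d w" using pcW unfolding path_control_def b e .
      have fin: "\<exists>u\<ge>0. embed_time T \<kappa> B n k \<omega> = ereal u" for k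
        using elim(1) unfolding embed_time_def b by blast
      have b0: "bstar \<kappa> B \<omega> 0 = 0" using W_0[OF elim(3)] unfolding b[symmetric] by (simp add: bstar_def)
      have cont: "continuous_on {0..} (bstar \<kappa> B \<omega>)" using bstar_cont[OF elim(3), of \<kappa>] unfolding b .
      show ?case
      proof (intro SUP_least ennreal_leI)
        fix t assume t: "t \<in> {0..T}"
        have "shortfall T r \<kappa> F \<Delta> B n z Z0 \<gamma> \<omega> (cancel_time T \<kappa> B n \<mu> \<omega>) t
          \<le> K * f z * (exp (\<kappa> * R) * (d + w + sqrt (T / n)))"
          unfolding K_def f_def
          by (rule pathwise_shortfall_bound[OF T pf n1 z iid[OF n1] mu pred hedge cont b0 fin pc t])
        also have "\<dots> \<le> K * f z * U \<omega>" using le K f0[OF z] by (intro mult_left_mono) auto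
        finally show "shortfall T r \<kappa> F \<Delta> B n z Z0 \<gamma> \<omega> (cancel_time T \<kappa> B n \<mu> \<omega>) t \<le> K * f z * U \<omega>" .
      qed
    qed
    then have "(\<integral>\<^sup>+\<omega>. (SUP t\<in>{0..T}. ennreal (shortfall T r \<kappa> F \<Delta> B n z Z0 \<gamma> \<omega> (cancel_time T \<kappa> B n \<mu> \<omega>) t)) \<partial>M)
        \<le> (\<integral>\<^sup>+\<omega>. ennreal (K * f z * U \<omega>) \<partial>M)" by (rule nn_integral_mono_AE)
    also have "\<dots> \<le> ennreal (K * f z * (C0 * real n powr (- 1 / 4) * ln (real n) powr (3 / 4)))"
      using mean_le_cmult[OF _ U, of "K * f z"] K f0[OF z] unfolding mean_le_def by auto
    also have "K * f z * (C0 * real n powr (- 1 / 4) * ln (real n) powr (3 / 4)) = C * f z * g n"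
      unfolding C_def g_def by simp
    finally show ?thesis .
  qed
  define D where "D \<epsilon> = C * (3 / (4 * \<epsilon>)) powr (3 / 4)" for \<epsilon> :: real
  show ?thesis
  proof (intro exI[of _ C] exI[of _ D] conjI allI ballI impI C)
    show "0 < D \<epsilon>" if "0 < \<epsilon>" for \<epsilon> unfolding D_def using C that by simp
  next
    fix z :: real and n :: nat and \<mu> Z0 \<gamma>
    assume a: "0 < z" "2 \<le> n" "\<mu> \<in> discrete_stopping n" "predictable_holdings n \<gamma>"
      "binomial_hedge T r \<kappa> F \<Delta> (N n) (\<xi> n) n z \<mu> Z0 \<gamma>"
    note sb = sup_bound[OF a]
    show "(SUP \<tau>\<in>bounded_stopping_times M B T.
          \<integral>\<^sup>+\<omega>. ennreal (shortfall T r \<kappa> F \<Delta> B n z Z0 \<gamma> \<omega> (cancel_time T \<kappa> B n \<mu> \<omega>) (\<tau> \<omega>)) \<partial>M)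
         \<le> ennreal (C * (F 0 (\<lambda>_. z) + \<Delta> 0 (\<lambda>_. z) + z + 1)
                     * real n powr (- 1 / 4) * ln (real n) powr (3 / 4))"
    proof (rule SUP_least)
      fix \<tau> assume \<tau>: "\<tau> \<in> bounded_stopping_times M B T"
      have "(\<integral>\<^sup>+\<omega>. ennreal (shortfall T r \<kappa> F \<Delta> B n z Z0 \<gamma> \<omega> (cancel_time T \<kappa> B n \<mu> \<omega>) (\<tau> \<omega>)) \<partial>M)
        \<le> (\<integral>\<^sup>+\<omega>. (SUP t\<in>{0..T}. ennreal (shortfall T r \<kappa> F \<Delta> B n z Z0 \<gamma> \<omega> (cancel_time T \<kappa> B n \<mu> \<omega>) t)) \<partial>M)"
        using \<tau> unfolding bounded_stopping_times_def by (intro nn_integral_mono SUP_upper) auto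
      also note sb
      finally show "(\<integral>\<^sup>+\<omega>. ennreal (shortfall T r \<kappa> F \<Delta> B n z Z0 \<gamma> \<omega> (cancel_time T \<kappa> B n \<mu> \<omega>) (\<tau> \<omega>)) \<partial>M)
        \<le> ennreal (C * (F 0 (\<lambda>_. z) + \<Delta> 0 (\<lambda>_. z) + z + 1)
                     * real n powr (- 1 / 4) * ln (real n) powr (3 / 4))"
        unfolding f_def g_def by (simp add: mult.assoc)
    qed
    show "(\<integral>\<^sup>+\<omega>. (SUP t\<in>{0..T}. ennreal
             (shortfall T r \<kappa> F \<Delta> B n z Z0 \<gamma> \<omega> (cancel_time T \<kappa> B n \<mu> \<omega>) t)) \<partial>M)
            \<le> ennreal (D \<epsilon> * (F 0 (\<lambda>_. z) + \<Delta> 0 (\<lambda>_. z) + z + 1) * real n powr (- 1 / 4 + \<epsilon>))"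
      if \<epsilon>: "0 < \<epsilon>" for \<epsilon>
    proof -
      have "g n \<le> real n powr (- 1 / 4) * ((3 / (4 * \<epsilon>)) powr (3 / 4) * real n powr \<epsilon>)"
        unfolding g_def using a(2) \<epsilon> by (intro mult_left_mono ln_powr_le_powr) auto
      also have "\<dots> = (3 / (4 * \<epsilon>)) powr (3 / 4) * real n powr (- 1 / 4 + \<epsilon>)" unfolding powr_add by simp
      finally have "C * f z * g n \<le> C * f z * ((3 / (4 * \<epsilon>)) powr (3 / 4) * real n powr (- 1 / 4 + \<epsilon>))"
        using C f0[OF a(1)] by (intro mult_left_mono) auto
      also have "\<dots> = D \<epsilon> * (F 0 (\<lambda>_. z) + \<Delta> 0 (\<lambda>_. z) + z + 1) * real n powr (- 1 / 4 + \<epsilon>)"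
        unfolding D_def f_def by (simp add: mult_ac)
      finally show ?thesis using sb by (meson ennreal_leI order_trans)
    qed
  qed
qed

end
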